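(* Let $M$ be an open Riemann surface of finite topology and let $F=(F_1,F_2,F_3):M\to\mathbb{C}^3$ be a null curve. Assume that the map $\mathbb{S}^1\times M\to\mathbb{R}^2$, $(v,P)\mapsto \mathrm{Re}\big(v\,(F_1(P),F_2(P))\big)$, is proper. Then $F$ has finite total curvature.
   Context: $\mathbb{S}^1=\{z\in\mathbb{C} : |z|=1\}$, and $\mathrm{Re}$ of a vector is taken componentwise. An open Riemann surface is a (connected) non-compact Riemann surface without boundary; finite topology means finitely generated fundamental group. A map is proper if preimages of compact sets are compact. A holomorphic map $F=(F_1,F_2,F_3):M\to\mathbb{C}^3$ is a null curve if $(dF_1)^2+(dF_2)^2+(dF_3)^2=0$ on $M$ and $dF$ never vanishes on $M$. Such an $F$ has finite total curvature if the Gauss curvature of the Riemannian metric induced on $M$ by the immersion $F$ from the Euclidean metric of $\mathbb{C}^3\equiv\mathbb{R}^6$ is integrable with respect to the area element of that metric (equivalently, the minimal immersion $\mathrm{Re}(F):M\to\mathbb{R}^3$ has finite total curvature). *)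

theory Defs
  imports "HOL-Analysis.Analysis" "HOL-Algebra.Generated_Groups"
begin

section \<open>Riemann surfaces\<close>

text \<open>
  A surface is given by a topology \<open>X\<close> together with a holomorphic atlas \<open>A\<close>, i.e. a set of
  charts \<open>(U, \<phi>)\<close>. Second countability is not required; for a connected surface it is a
  consequence of the other axioms (Rado's theorem). The atlas need not be maximal.
\<close>

type_synonym 'a chart = "'a set \<times> ('a \<Rightarrow> complex)"

definition complex_chart :: "'a topology \<Rightarrow> 'a chart \<Rightarrow> bool" where
  "complex_chart X c \<longleftrightarrow> (case c of (U, \<phi>) \<Rightarrow>
     openin X U \<and> open (\<phi> ` U) \<and>
     homeomorphic_map (subtopology X U) (top_of_set (\<phi> ` U)) \<phi>)"

definition holomorphic_atlas :: "'a topology \<Rightarrow> 'a chart set \<Rightarrow> bool" where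
  "holomorphic_atlas X A \<longleftrightarrow>
     (\<forall>c\<in>A. complex_chart X c) \<and>
     topspace X = (\<Union>(U, \<phi>)\<in>A. U) \<and>
     (\<forall>(U, \<phi>)\<in>A. \<forall>(V, \<psi>)\<in>A. (\<psi> \<circ> inv_into U \<phi>) holomorphic_on \<phi> ` (U \<inter> V))"

definition riemann_surface :: "'a topology \<Rightarrow> 'a chart set \<Rightarrow> bool" where
  "riemann_surface X A \<longleftrightarrow>
     Hausdorff_space X \<and> connected_space X \<and> topspace X \<noteq> {} \<and> holomorphic_atlas X A"

definition open_riemann_surface :: "'a topology \<Rightarrow> 'a chart set \<Rightarrow> bool" where
  "open_riemann_surface X A \<longleftrightarrow> riemann_surface X A \<and> \<not> compact_space X"

definition in_chart :: "('a \<Rightarrow> 'b) \<Rightarrow> 'a chart \<Rightarrow> complex \<Rightarrow> 'b" where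
  "in_chart f c = f \<circ> inv_into (fst c) (snd c)"


section \<open>Fundamental group and finite topology\<close>

text \<open>
  The library's path operations need a topological type class, whereas surfaces live on an
  abstract topology here. Loops are functions on \<^typ>\<open>real\<close> of which only the values on the unit
  interval matter: functions agreeing there are homotopic.
\<close>

definition loops :: "'a topology \<Rightarrow> 'a \<Rightarrow> (real \<Rightarrow> 'a) set" where
  "loops X x = {p. pathin X p \<and> p 0 = x \<and> p 1 = x}"

definition loop_class :: "'a topology \<Rightarrow> 'a \<Rightarrow> (real \<Rightarrow> 'a) \<Rightarrow> (real \<Rightarrow> 'a) set" where
  "loop_class X x p =
     {q. homotopic_with (\<lambda>r. r 0 = x \<and> r 1 = x) (top_of_set {0..1}) X p q}"

definition concat_loops :: "(real \<Rightarrow> 'a) \<Rightarrow> (real \<Rightarrow> 'a) \<Rightarrow> real \<Rightarrow> 'a" where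
  "concat_loops p q = (\<lambda>t. if t \<le> 1/2 then p (2 * t) else q (2 * t - 1))"

definition fundamental_group :: "'a topology \<Rightarrow> 'a \<Rightarrow> (real \<Rightarrow> 'a) set monoid" where
  "fundamental_group X x =
     \<lparr> carrier = loop_class X x ` loops X x,
       mult = (\<lambda>a b. \<Union>p\<in>a. \<Union>q\<in>b. loop_class X x (concat_loops p q)),
       one = loop_class X x (\<lambda>_. x) \<rparr>"

definition finitely_generated_group :: "('a, 'b) monoid_scheme \<Rightarrow> bool" where
  "finitely_generated_group G \<longleftrightarrow> (\<exists>S\<subseteq>carrier G. finite S \<and> generate G S = carrier G)"

definition finite_topology :: "'a topology \<Rightarrow> bool" where
  "finite_topology X \<longleftrightarrow>
     (\<forall>x\<in>topspace X. finitely_generated_group (fundamental_group X x))"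


section \<open>Proper maps\<close>

text \<open>
  Properness in terms of compact preimages; the library's \<^const>\<open>proper_map\<close> is instead
  defined by closedness of the map and compactness of the fibres.
\<close>

definition compact_preimages :: "'a topology \<Rightarrow> 'b topology \<Rightarrow> ('a \<Rightarrow> 'b) \<Rightarrow> bool" where
  "compact_preimages X Y f \<longleftrightarrow>
     (\<forall>K. compactin Y K \<longrightarrow> compactin X {x \<in> topspace X. f x \<in> K})"


section \<open>Null curves\<close>

definition holomorphic_map :: "'a chart set \<Rightarrow> ('a \<Rightarrow> complex ^ 3) \<Rightarrow> bool" where
  "holomorphic_map A F \<longleftrightarrow>
     (\<forall>c\<in>A. \<forall>j. in_chart (\<lambda>p. F p $ j) c holomorphic_on snd c ` fst c)"

text \<open>
  In a chart with coordinate \<open>z\<close> the one-form \<open>dF\<^sub>j\<close> is \<open>f\<^sub>j'(z) dz\<close>, where \<open>f\<^sub>j\<close> is \<open>F\<^sub>j\<close> read in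
  that chart.
\<close>

definition null_curve :: "'a chart set \<Rightarrow> ('a \<Rightarrow> complex ^ 3) \<Rightarrow> bool" where
  "null_curve A F \<longleftrightarrow>
     holomorphic_map A F \<and>
     (\<forall>c\<in>A. \<forall>z\<in>snd c ` fst c.
        (\<Sum>j\<in>UNIV. (deriv (in_chart (\<lambda>p. F p $ j) c) z)\<^sup>2) = 0 \<and>
        (\<exists>j. deriv (in_chart (\<lambda>p. F p $ j) c) z \<noteq> 0))"


section \<open>Gauss curvature and area of the induced metric\<close>

text \<open>Coordinates are \<open>z = x + \<i>y\<close>; index 1 is the \<open>x\<close>-direction and index 2 the \<open>y\<close>-direction.\<close>

definition partial :: "2 \<Rightarrow> (complex \<Rightarrow> 'b::real_normed_vector) \<Rightarrow> complex \<Rightarrow> 'b" where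
  "partial i h z =
     vector_derivative (\<lambda>t::real. h (z + t *\<^sub>R (if i = 1 then 1 else \<i>))) (at 0)"

text \<open>
  The inner product of \<^typ>\<open>complex ^ 3\<close> is the real Euclidean one of six-dimensional real space.
\<close>

definition induced_metric :: "(complex \<Rightarrow> complex ^ 3) \<Rightarrow> complex \<Rightarrow> real ^ 2 ^ 2" where
  "induced_metric f z = (\<chi> i j. partial i f z \<bullet> partial j f z)"

definition christoffel :: "(complex \<Rightarrow> real ^ 2 ^ 2) \<Rightarrow> 2 \<Rightarrow> 2 \<Rightarrow> 2 \<Rightarrow> complex \<Rightarrow> real" where
  "christoffel g k i j z =
     (\<Sum>l\<in>UNIV. matrix_inv (g z) $ k $ l *
        (partial i (\<lambda>w. g w $ j $ l) z + partial j (\<lambda>w. g w $ i $ l) z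
          - partial l (\<lambda>w. g w $ i $ j) z)) / 2"

text \<open>
  \<open>curvature_tensor g l k i j\<close> is the \<open>l\<close>-th component of \<open>R(\<partial>\<^sub>i, \<partial>\<^sub>j) \<partial>\<^sub>k\<close>, with
  \<open>R(V, W) = \<nabla>\<^sub>V \<nabla>\<^sub>W - \<nabla>\<^sub>W \<nabla>\<^sub>V - \<nabla>\<^bsub>[V, W]\<^esub>\<close>. With this sign the round sphere has positive curvature below.
\<close>

definition curvature_tensor ::
    "(complex \<Rightarrow> real ^ 2 ^ 2) \<Rightarrow> 2 \<Rightarrow> 2 \<Rightarrow> 2 \<Rightarrow> 2 \<Rightarrow> complex \<Rightarrow> real" where
  "curvature_tensor g l k i j z =
     partial i (christoffel g l j k) z - partial j (christoffel g l i k) z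
     + (\<Sum>m\<in>UNIV. christoffel g m j k z * christoffel g l i m z
                 - christoffel g m i k z * christoffel g l j m z)"

text \<open>\<open>\<langle>R(\<partial>\<^sub>1, \<partial>\<^sub>2) \<partial>\<^sub>2, \<partial>\<^sub>1\<rangle> / det g\<close>\<close>

definition gauss_curvature :: "(complex \<Rightarrow> real ^ 2 ^ 2) \<Rightarrow> complex \<Rightarrow> real" where
  "gauss_curvature g z =
     (\<Sum>l\<in>UNIV. g z $ 1 $ l * curvature_tensor g l 2 1 2 z) / det (g z)"

text \<open>For an immersion the value does not depend on the chosen chart around the point.\<close>

definition induced_gauss_curvature ::
    "'a chart set \<Rightarrow> ('a \<Rightarrow> complex ^ 3) \<Rightarrow> 'a \<Rightarrow> real" where
  "induced_gauss_curvature A F p =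
     (let c = (SOME c. c \<in> A \<and> p \<in> fst c)
      in gauss_curvature (induced_metric (in_chart F c)) (snd c p))"

text \<open>
  The area measure is the Borel measure given by \<open>\<surd>(det g) dx dy\<close> in every chart. For a smooth
  immersion of a Riemann surface (which is second countable) exactly one such measure exists.
\<close>

definition induced_area_measure ::
    "'a topology \<Rightarrow> 'a chart set \<Rightarrow> ('a \<Rightarrow> complex ^ 3) \<Rightarrow> 'a measure \<Rightarrow> bool" where
  "induced_area_measure X A F \<mu> \<longleftrightarrow>
     sets \<mu> = sets (sigma (topspace X) {U. openin X U}) \<and>
     (\<forall>c\<in>A. \<forall>B\<in>sets \<mu>. B \<subseteq> fst c \<longrightarrow>
        emeasure \<mu> B =
          (\<integral>\<^sup>+ z \<in> snd c ` B. ennreal (sqrt (det (induced_metric (in_chart F c) z))) \<partial>lborel))"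

definition finite_total_curvature ::
    "'a topology \<Rightarrow> 'a chart set \<Rightarrow> ('a \<Rightarrow> complex ^ 3) \<Rightarrow> bool" where
  "finite_total_curvature X A F \<longleftrightarrow>
     (\<exists>\<mu>. induced_area_measure X A F \<mu> \<and> integrable \<mu> (induced_gauss_curvature A F))"

end

theory Submission
  imports Defs "HOL-Complex_Analysis.Complex_Analysis"
begin

text \<open>
  Put \<open>G = F\<^sub>1 + \<i> F\<^sub>2\<close> and \<open>H = F\<^sub>1 - \<i> F\<^sub>2\<close>. Minimising \<open>\<bar>Re (v (F\<^sub>1, F\<^sub>2))\<bar>\<close> over the circle gives
  \<open>\<bar>\<bar>G\<bar> - \<bar>H\<bar>\<bar> / 2\<close>, so the hypothesis says that \<open>\<bar>G\<bar> - \<bar>H\<bar>\<close> is proper. Hence \<open>G\<close> restricted to the end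
  \<open>\<bar>H\<bar> \<le> \<bar>G\<bar>\<close>, \<open>\<bar>G\<bar> > R\<close> is a proper holomorphic map onto a punctured disc around infinity (and symmetrically
  with \<open>G\<close> and \<open>H\<close> exchanged), that is, a branched covering of finite degree.

  The covering has only finitely many critical values near infinity. At a critical point \<open>dG = 0\<close>, so \<open>dH \<noteq> 0\<close>
  and \<open>H\<close> separates the sheets that meet there; thus \<open>H\<close> takes fewer values on a critical fibre than on a
  generic one, and a symmetric function of the fibre, which is holomorphic with at most a pole at infinity,
  vanishes at every critical value.

  Where there are no critical values, \<open>H = h(G)\<close> for an algebraic branch \<open>h(w)\<close> with \<open>\<bar>h(w)\<bar> \<le> \<bar>w\<bar>\<close>. After
  \<open>w = \<zeta>\<^sup>-\<^sup>n\<close> the derivative \<open>h'\<close> extends holomorphically to \<open>\<zeta> = 0\<close>, whence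
  \<open>\<bar>h''\<bar>\<^sup>2 \<le> C \<bar>w\<bar>\<^bsup>-2-1/n\<^esup> \<bar>h'\<bar>\<close>. In the coordinate \<open>w = G\<close> the null condition reads \<open>(F\<^sub>3')\<^sup>2 = - h'\<close>, and
  the curvature density \<open>\<bar>K\<bar> dA\<close> is at most a multiple of \<open>\<bar>w\<bar>\<^bsup>-2-1/n\<^esup> dx dy\<close>, which is integrable at infinity.
\<close>

section \<open>Decay of algebraic branches at infinity\<close>

text \<open>Decay of \<open>h''\<close> alone would not suffice. Since
  \<open>(F_3')^2 = - h'\<close>, one has \<open>|F_3''|^2 = |h''|^2 / (4 |h'|)\<close>, so
  \<open>h''\<close> must be controlled relative to \<open>h'\<close>, also near zeros of
  \<open>h'\<close>. With \<open>h' = U(\<zeta>)\<close> and \<open>U = \<zeta>^p v\<close>,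
  \<open>v\<close> zero-free, the quotient \<open>|\<zeta> U'|^2 / |U|\<close> is
  \<open>O(|\<zeta>|)\<close>; this factor \<open>|\<zeta>| = |w|^(-1/n)\<close> is the gain that
  makes the density integrable. It needs \<open>U\<close> holomorphic at 0, which is what
  \<open>|h| \<le> |w|\<close> provides. The ordinary discriminant of the values of \<open>H\<close>
  on a fibre of \<open>G\<close> may vanish identically: \<open>(F_1, F_2)\<close> need not be
  injective, and then \<open>H\<close> can agree on different sheets everywhere. Hence
  \<open>sheets\<close> counts distinct values, and \<open>disc\<close> sums Vandermonde products
  over all subsets of that size. No second countability is assumed. The compact sublevel sets of
  \<open>||G| - |H||\<close> exhaust the surface, which yields countably many charts and with them
  the area measure.\<close>

lemma holomorphic_log_derivative_bound:
  assumes U: "U holomorphic_on ball 0 r" and r: "0 < r"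
  obtains \<rho> C where "0 < \<rho>" "\<rho> \<le> r" "0 < C"
    "\<And>\<zeta>. norm \<zeta> < \<rho> \<Longrightarrow> (norm (\<zeta> * deriv U \<zeta>))\<^sup>2 \<le> C * norm \<zeta> * norm (U \<zeta>)"
    "\<And>\<zeta>. norm \<zeta> < \<rho> \<Longrightarrow> norm (U \<zeta>) \<le> C"
    "\<And>\<zeta>. 0 < norm \<zeta> \<Longrightarrow> norm \<zeta> < \<rho> \<Longrightarrow> U \<zeta> = 0 \<Longrightarrow> \<forall>\<xi>\<in>ball 0 r. U \<xi> = 0"
proof (cases "\<forall>\<xi>\<in>ball 0 r. U \<xi> = 0")
  case True
  have "deriv U \<zeta> = 0" if "norm \<zeta> < r" for \<zeta>
  proof -
    have "deriv U \<zeta> = deriv (\<lambda>_. 0) \<zeta>"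
      using that True by (intro deriv_cong_ev eventually_nhds_in_open[THEN eventually_mono, of "ball 0 r"]) auto
    then show ?thesis by simp
  qed
  with True r show ?thesis by (intro that[of r 1]) auto
next
  case False
  then obtain \<beta> where \<beta>: "\<beta> \<in> ball 0 r" "U \<beta> \<noteq> 0" by auto
  \<comment> \<open>Near 0 the function \<open>U\<close> is a power of the variable times a
    zero-free factor; a nonzero value at 0 is the case \<open>p = 0\<close>.\<close>
  have "\<exists>p v \<rho>. 0 < \<rho> \<and> \<rho> \<le> r \<and> v holomorphic_on ball 0 \<rho> \<and>
      (\<forall>w\<in>ball 0 \<rho>. U w = w ^ p * v w \<and> v w \<noteq> 0)"
  proof (cases "U 0 = 0")
    case True
    have nc: "\<not> U constant_on ball 0 r"
      using True \<beta> r unfolding constant_on_def by (metis centre_in_ball)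
    show ?thesis
    proof (rule holomorphic_factor_zero_nonconstant[OF U open_ball connected_ball _ _ nc, of 0])
      fix v \<rho> p
      assume "0 < \<rho>" "ball (0::complex) \<rho> \<subseteq> ball 0 r" "v holomorphic_on ball 0 \<rho>"
        "\<And>w. w \<in> ball 0 \<rho> \<Longrightarrow> U w = (w - 0) ^ p * v w" "\<And>w. w \<in> ball 0 \<rho> \<Longrightarrow> v w \<noteq> 0"
      moreover from this have "\<rho> \<le> r"
        using ball_subset_ball_iff[of "0::complex" \<rho> 0 r] by simp
      ultimately show ?thesis
        by (intro exI[of _ p] exI[of _ v] exI[of _ \<rho>]) auto
    qed (use True r in auto)
  next
    case False
    have "continuous (at 0) U"
      using holomorphic_on_imp_continuous_on[OF U] r by (simp add: continuous_on_eq_continuous_at)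
    then obtain \<rho> where "0 < \<rho>" "\<And>w. dist 0 w < \<rho> \<Longrightarrow> U w \<noteq> 0"
      using continuous_at_avoid[of 0 U 0] False by auto
    then show ?thesis using r U
      by (intro exI[of _ 0] exI[of _ U] exI[of _ "min \<rho> r"]) (auto intro: holomorphic_on_subset)
  qed
  then obtain p v \<rho>0 where 0: "0 < \<rho>0" "\<rho>0 \<le> r" and v: "v holomorphic_on ball 0 \<rho>0"
      and Uv: "\<And>w. w\<in>ball 0 \<rho>0 \<Longrightarrow> U w = w ^ p * v w" and v0: "\<And>w. w\<in>ball 0 \<rho>0 \<Longrightarrow> v w \<noteq> 0"
    by blast
  define \<rho> where "\<rho> = min (\<rho>0 / 2) 1"
  have \<rho>: "0 < \<rho>" "\<rho> \<le> 1" "cball 0 \<rho> \<subseteq> ball 0 \<rho>0" "\<rho> \<le> r"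
    using 0 by (auto simp: \<rho>_def subset_iff)
  have cv: "continuous_on (cball 0 \<rho>) v" and cdv: "continuous_on (cball 0 \<rho>) (deriv v)"
    using v holomorphic_deriv[OF v open_ball] \<rho>
    by (auto intro: holomorphic_on_imp_continuous_on continuous_on_subset)
  have "compact (v ` cball 0 \<rho>)" "compact (deriv v ` cball 0 \<rho>)"
    using cv cdv by (auto intro: compact_continuous_image)
  then obtain B1 B2 where B: "\<And>w. w \<in> cball 0 \<rho> \<Longrightarrow> norm (v w) \<le> B1"
      "\<And>w. w \<in> cball 0 \<rho> \<Longrightarrow> norm (deriv v w) \<le> B2"
    by (metis bounded_iff compact_imp_bounded imageI)
  have "compact ((\<lambda>w. norm (v w)) ` cball 0 \<rho>)" "((\<lambda>w. norm (v w)) ` cball 0 \<rho>) \<noteq> {}"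
    using cv \<rho> by (auto intro!: compact_continuous_image continuous_intros)
  then obtain w0 where w0: "w0 \<in> cball 0 \<rho>" "\<And>w. w \<in> cball 0 \<rho> \<Longrightarrow> norm (v w0) \<le> norm (v w)"
    using compact_attains_inf[of "(\<lambda>w. norm (v w)) ` cball 0 \<rho>"] by auto
  define b where "b = norm (v w0)"
  have b: "0 < b" using v0[of w0] subsetD[OF \<rho>(3) w0(1)] by (simp add: b_def)
  have B0: "0 \<le> B1" "0 \<le> B2"
    using order_trans[OF norm_ge_zero B(1)[of 0]] order_trans[OF norm_ge_zero B(2)[of 0]] \<rho> by auto
  define K where "K = of_nat p * B1 + B2"
  have K: "0 \<le> K" using B0 by (auto simp: K_def)
  define C where "C = K\<^sup>2 / b + B1 + 1"
  have dU: "\<zeta> * deriv U \<zeta> = \<zeta> ^ p * (of_nat p * v \<zeta> + \<zeta> * deriv v \<zeta>)" if "\<zeta> \<in> ball 0 \<rho>" for \<zeta>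
  proof -
    have zin: "\<zeta> \<in> ball 0 \<rho>0" using that subsetD[OF \<rho>(3), of \<zeta>] by simp
    have "(v has_field_derivative deriv v \<zeta>) (at \<zeta>)"
      using v zin by (intro holomorphic_derivI[of _ "ball 0 \<rho>0"]) auto
    then have "((\<lambda>w. w ^ p * v w) has_field_derivative (of_nat p * \<zeta> ^ (p - 1) * v \<zeta> + \<zeta> ^ p * deriv v \<zeta>)) (at \<zeta>)"
      by (auto intro!: derivative_eq_intros simp: algebra_simps)
    moreover have "deriv U \<zeta> = deriv (\<lambda>w. w ^ p * v w) \<zeta>"
      using zin Uv
      by (intro deriv_cong_ev eventually_nhds_in_open[THEN eventually_mono, of "ball 0 \<rho>0"]) auto
    ultimately have "deriv U \<zeta> = of_nat p * \<zeta> ^ (p - 1) * v \<zeta> + \<zeta> ^ p * deriv v \<zeta>"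
      by (simp add: DERIV_imp_deriv)
    then show ?thesis by (cases p) (auto simp: algebra_simps)
  qed
  show ?thesis
  proof (rule that[of \<rho> C])
    show "0 < \<rho>" "\<rho> \<le> r" "0 < C" using \<rho> K b B0 by (auto simp: C_def add_nonneg_pos)
    fix \<zeta> :: complex assume z: "norm \<zeta> < \<rho>"
    then have z': "\<zeta> \<in> ball 0 \<rho>" "\<zeta> \<in> cball 0 \<rho>" "\<zeta> \<in> ball 0 \<rho>0" using subsetD[OF \<rho>(3), of \<zeta>] by auto
    have z1: "norm \<zeta> \<le> 1" using z \<rho> by simp
    have "norm (U \<zeta>) = norm \<zeta> ^ p * norm (v \<zeta>)" using Uv z' by (simp add: norm_mult norm_power)
    then have Ub: "norm \<zeta> ^ p * b \<le> norm (U \<zeta>)" "norm (U \<zeta>) \<le> B1"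
      using w0 z' B[of \<zeta>] z1 power_le_one[OF norm_ge_zero z1, of p]
      by (auto simp: b_def intro!: mult_left_mono mult_left_le_one_le[THEN order_trans])
    have "0 \<le> K\<^sup>2 / b" using b by simp
    then show "norm (U \<zeta>) \<le> C" using Ub(2) unfolding C_def by linarith
    have "norm (of_nat p * v \<zeta> + \<zeta> * deriv v \<zeta>) \<le> of_nat p * norm (v \<zeta>) + norm \<zeta> * norm (deriv v \<zeta>)"
      by (metis norm_mult norm_of_nat norm_triangle_ineq)
    also have "\<dots> \<le> of_nat p * B1 + norm \<zeta> * B2"
      using B z' by (intro add_mono mult_left_mono) auto
    finally have n1: "norm (of_nat p * v \<zeta> + \<zeta> * deriv v \<zeta>) \<le> of_nat p * B1 + norm \<zeta> * B2" .
    \<comment> \<open>The square of \<open>\<zeta> U'\<close> must have order at least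
      \<open>p + 1\<close>. For \<open>p > 0\<close> its order is at least
      \<open>2 p \<ge> p + 1\<close>; for \<open>p = 0\<close> the term \<open>p v\<close> drops out
      and the remaining \<open>\<zeta> v'\<close> supplies the factor
      \<open>\<zeta>\<close>.\<close>
    have n2: "(norm \<zeta> ^ p * norm (of_nat p * v \<zeta> + \<zeta> * deriv v \<zeta>))\<^sup>2 \<le> norm \<zeta> ^ p * norm \<zeta> * K\<^sup>2"
    proof (cases "p = 0")
      case True
      have "(norm (\<zeta> * deriv v \<zeta>))\<^sup>2 \<le> (norm \<zeta> * K)\<^sup>2"
        using n1 True by (intro power_mono) (auto simp: K_def norm_mult)
      also have "\<dots> = (norm \<zeta> * K\<^sup>2) * norm \<zeta>" by (simp add: power2_eq_square)
      also have "\<dots> \<le> norm \<zeta> * K\<^sup>2 * 1" using z1 by (intro mult_left_mono) auto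
      finally show ?thesis using True by simp
    next
      case False
      have "norm \<zeta> * B2 \<le> 1 * B2" using z1 B0 by (intro mult_right_mono) auto
      then have "norm (of_nat p * v \<zeta> + \<zeta> * deriv v \<zeta>) \<le> K" using n1 by (simp add: K_def)
      then have "(norm (of_nat p * v \<zeta> + \<zeta> * deriv v \<zeta>))\<^sup>2 \<le> K\<^sup>2" by (intro power_mono) auto
      moreover have "(norm \<zeta> ^ p)\<^sup>2 \<le> norm \<zeta> ^ p * norm \<zeta>"
        unfolding power2_eq_square using z1 False power_decreasing[of 1 p "norm \<zeta>"]
        by (intro mult_left_mono) auto
      ultimately show ?thesis unfolding power_mult_distrib by (intro mult_mono) auto
    qed
    have "(norm (\<zeta> * deriv U \<zeta>))\<^sup>2 \<le> norm \<zeta> ^ p * norm \<zeta> * K\<^sup>2"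
      unfolding dU[OF z'(1)] norm_mult norm_power by (rule n2)
    also have "\<dots> = (norm \<zeta> ^ p * b) * (norm \<zeta> * (K\<^sup>2 / b))" using b by simp
    also have "\<dots> \<le> norm (U \<zeta>) * (norm \<zeta> * C)"
      using Ub B0 K b by (intro mult_mono) (auto simp: C_def)
    finally show "(norm (\<zeta> * deriv U \<zeta>))\<^sup>2 \<le> C * norm \<zeta> * norm (U \<zeta>)" by (simp add: mult_ac)
    \<comment> \<open>\<open>U\<close> has no zero in the punctured disc, so the premises are
      contradictory in this case.\<close>
    show "\<forall>\<xi>\<in>ball 0 r. U \<xi> = 0" if "0 < norm \<zeta>" "U \<zeta> = 0"
      using Uv[OF z'(3)] v0[OF z'(3)] that by auto
  qed
qed

text \<open>\<open>s\<close> is a logarithm of \<open>w\<close>: for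
  \<open>\<eta> s = h (exp s)\<close> the function \<open>u\<close> is \<open>h'\<close> and
  \<open>deriv u\<close> is \<open>w h''\<close>. Periodicity makes \<open>\<eta>\<close> a
  single-valued function of \<open>exp (- s / n)\<close>, and the bound by
  \<open>norm (exp s)\<close> says that its singularity at 0 is at most a pole of order
  \<open>n\<close>.\<close>

lemma periodic_puiseux_bound:
  fixes \<eta> :: "complex \<Rightarrow> complex"
  defines "u \<equiv> \<lambda>s. deriv \<eta> s * exp (- s)"
  assumes hol: "\<eta> holomorphic_on {s. L < Re s}" and n: "0 < n"
    and bnd: "\<And>s. L < Re s \<Longrightarrow> norm (\<eta> s) \<le> norm (exp s)"
    and per: "\<And>s. L < Re s \<Longrightarrow> \<eta> (s + 2 * pi * \<i> * of_nat n) = \<eta> s"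
  obtains M C where "L \<le> M" "0 < C"
    "\<And>s. M < Re s \<Longrightarrow> (norm (deriv u s))\<^sup>2 \<le> C * exp (- Re s / n) * norm (u s)"
    "\<And>s. M < Re s \<Longrightarrow> norm (u s) \<le> C"
    "\<And>s. M < Re s \<Longrightarrow> u s = 0 \<Longrightarrow> \<forall>t. L < Re t \<longrightarrow> u t = 0"
proof -
  have n': "0 < real n" using n by simp
  define r where "r = exp (- L / n)"
  have r: "0 < r" by (simp add: r_def)
  define z where "z = (\<lambda>s::complex. exp (- s / n))"
  have nz: "norm (z s) = exp (- Re s / n)" for s by (simp add: z_def)
  have zr: "norm (z s) < r \<longleftrightarrow> L < Re s" for s
    using n' by (simp add: nz r_def field_simps)
  have per2: "\<eta> (s + 2 * pi * \<i> * of_nat n * of_nat k) = \<eta> s" if "L < Re s" for s k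
  proof (induction k)
    case (Suc k)
    have "\<eta> (s + 2 * pi * \<i> * of_nat n * of_nat (Suc k)) = \<eta> ((s + 2 * pi * \<i> * of_nat n * of_nat k) + 2 * pi * \<i> * of_nat n)"
      by (simp add: algebra_simps)
    also have "\<dots> = \<eta> (s + 2 * pi * \<i> * of_nat n * of_nat k)" using that by (intro per) simp
    finally show ?case using Suc by simp
  qed simp
  have per3: "\<eta> (s + 2 * pi * \<i> * of_nat n * of_int k) = \<eta> s" if "L < Re s" for s k
  proof (cases "0 \<le> k")
    case True then show ?thesis using per2[OF that, of "nat k"] by simp
  next
    case False
    have "\<eta> (s + 2 * pi * \<i> * of_nat n * of_int k + 2 * pi * \<i> * of_nat n * of_nat (nat (-k))) = \<eta> (s + 2 * pi * \<i> * of_nat n * of_int k)"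
      using that by (intro per2) simp
    then show ?thesis using False by simp
  qed
  have perz: "\<eta> s = \<eta> t" if "z s = z t" "L < Re t" for s t
  proof -
    have "exp (- s / n) = exp (- t / n)" using that by (simp add: z_def)
    then obtain k :: int where "- s / n = - t / n + of_int (2 * k) * pi * \<i>"
      unfolding exp_eq by blast
    moreover have "s = - of_nat n * (- s / n)" "t = - of_nat n * (- t / n)" using n by auto
    ultimately have "s = - of_nat n * (- t / n + of_int (2 * k) * pi * \<i>)" by metis
    also have "\<dots> = t + 2 * pi * \<i> * of_nat n * of_int (- k)"
      using n by (simp add: field_simps)
    finally have "s = t + 2 * pi * \<i> * of_nat n * of_int (- k)" .
    then show ?thesis using per3 that by metis
  qed
  define q where "q = (\<lambda>\<zeta>. \<eta> (- of_nat n * Ln \<zeta>))"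
  have zLn: "z (- of_nat n * Ln \<zeta>) = \<zeta>" if "\<zeta> \<noteq> 0" for \<zeta> using that n by (simp add: z_def)
  have qz: "q (z s) = \<eta> s" if "L < Re s" for s
    unfolding q_def by (rule perz) (use that zLn[of "z s"] in \<open>auto simp: z_def\<close>)
  have holq: "q holomorphic_on (ball 0 r - {0})"
    unfolding holomorphic_on_def
  proof
    fix \<zeta>0 :: complex assume z0: "\<zeta>0 \<in> ball 0 r - {0}"
    \<comment> \<open>A logarithm centred at \<open>\<zeta>0\<close>, so that the cut of
      \<open>Ln\<close> stays away from \<open>\<zeta>0\<close>; by \<open>perz\<close> all choices
      of the logarithm give the same value of \<open>\<eta>\<close>.\<close>
    define l where "l = (\<lambda>\<zeta>. - of_nat n * Ln \<zeta>0 - of_nat n * Ln (\<zeta> / \<zeta>0))"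
    have zl: "z (l \<zeta>) = \<zeta>" if "\<zeta> \<noteq> 0" for \<zeta>
    proof -
      have "z (l \<zeta>) = exp (Ln \<zeta>0 + Ln (\<zeta> / \<zeta>0))"
        using n by (simp add: z_def l_def diff_divide_distrib field_simps)
      also have "\<dots> = \<zeta>" using that z0 by (simp add: exp_add)
      finally show ?thesis .
    qed
    have "L < Re (l \<zeta>0)" using zl[of \<zeta>0] z0 zr[of "l \<zeta>0"] by auto
    then have "\<eta> field_differentiable at (l \<zeta>0)"
      using hol by (intro holomorphic_on_imp_differentiable_at[of _ "{s. L < Re s}"])
        (auto simp: open_halfspace_Re_gt)
    moreover have "l field_differentiable at \<zeta>0"
    proof -
      have "\<zeta>0 / \<zeta>0 \<notin> \<real>\<^sub>\<le>\<^sub>0" using z0 by auto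
      then have "(l has_field_derivative - (of_nat n * (1 / \<zeta>0 * inverse (\<zeta>0 / \<zeta>0)))) (at \<zeta>0)"
        unfolding l_def using z0 by (auto intro!: derivative_eq_intros simp: divide_simps)
      then show ?thesis using field_differentiable_def by blast
    qed
    ultimately have "(\<eta> \<circ> l) field_differentiable at \<zeta>0"
      by (rule field_differentiable_compose[rotated])
    then obtain D where "((\<eta> \<circ> l) has_field_derivative D) (at \<zeta>0)"
      by (auto simp: field_differentiable_def)
    then have "(q has_field_derivative D) (at \<zeta>0)"
    proof (rule has_field_derivative_transform_within_open[of _ _ _ "ball 0 r - {0}"])
      fix x assume x: "x \<in> ball 0 r - {0::complex}"
      then have "L < Re (l x)" using zl[of x] zr[of "l x"] by auto
      then show "(\<eta> \<circ> l) x = q x" using qz[of "l x"] zl[of x] x by simp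
    qed (use z0 in auto)
    then show "q field_differentiable at \<zeta>0 within (ball 0 r - {0})"
      using field_differentiable_at_within field_differentiable_def by blast
  qed
  have zL: "\<exists>s. L < Re s \<and> z s = \<zeta>" if "\<zeta> \<in> ball 0 r - {0}" for \<zeta>
    using zLn[of \<zeta>] zr[of "- of_nat n * Ln \<zeta>"] that
    by (intro exI[of _ "- of_nat n * Ln \<zeta>"]) auto
  have zn: "z s ^ n = exp (- s)" for s
    using n by (simp add: z_def exp_of_nat_mult[symmetric])
  have "(\<lambda>\<zeta>. \<zeta> ^ n * q \<zeta>) holomorphic_on (ball 0 r - {0})"
    using holq by (intro holomorphic_intros)
  moreover have "\<forall>\<^sub>F \<zeta> in at 0. norm (\<zeta> ^ n * q \<zeta>) \<le> 1"
  proof -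
    have "\<forall>\<^sub>F \<zeta> in at 0. \<zeta> \<in> ball 0 r - {0::complex}"
      using r by (auto simp: eventually_at_filter intro: eventually_nhds_in_open[THEN eventually_mono, of "ball 0 r"])
    then show ?thesis
    proof eventually_elim
      case (elim \<zeta>)
      then obtain s where s: "L < Re s" "z s = \<zeta>" using zL by blast
      have "norm (\<zeta> ^ n * q \<zeta>) = norm (exp (-s)) * norm (\<eta> s)"
        using qz[OF s(1)] s(2) zn[of s] by (simp add: norm_mult)
      also have "\<dots> \<le> norm (exp (-s)) * norm (exp s)" using bnd[OF s(1)] by (intro mult_left_mono) auto
      also have "\<dots> = 1" by (metis norm_mult exp_minus_inverse mult.commute norm_one)
      finally show ?case .
    qed
  qed
  ultimately obtain a where a: "a holomorphic_on ball 0 r" "\<And>\<zeta>. \<zeta> \<in> ball 0 r - {0} \<Longrightarrow> a \<zeta> = \<zeta> ^ n * q \<zeta>"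
    using holomorphic_on_extend_bounded[of "\<lambda>\<zeta>. \<zeta> ^ n * q \<zeta>" "ball 0 r" 0] r by (auto simp: interior_open)
  \<comment> \<open>This is \<open>deriv \<eta> s * exp (- s)\<close> in the variable
    \<open>z s\<close>, computed from \<open>\<eta> s = a (z s) * exp s\<close> and
    \<open>dz/ds = - z / n\<close>.\<close>
  define U where "U = (\<lambda>\<zeta>. a \<zeta> - \<zeta> * deriv a \<zeta> / n)"
  have holU: "U holomorphic_on ball 0 r"
    unfolding U_def using a n by (intro holomorphic_intros) auto
  have z0: "z s \<noteq> 0" for s by (simp add: z_def)
  have zball: "z s \<in> ball 0 r" if "L < Re s" for s using zr that by simp
  have dz: "(z has_field_derivative (- z s / n)) (at s)" for s
    unfolding z_def using n by (auto intro!: derivative_eq_intros)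
  have \<eta>a: "\<eta> s = a (z s) * exp s" if "L < Re s" for s
    using a(2)[of "z s"] zball[OF that] z0 zn qz[OF that] by (simp add: exp_minus)
  have uU: "u s = U (z s)" if s: "L < Re s" for s
  proof -
    have "(a has_field_derivative deriv a (z s)) (at (z s))"
      using a zball[OF s] by (intro holomorphic_derivI[of _ "ball 0 r"]) auto
    then have "((\<lambda>s. a (z s) * exp s) has_field_derivative
        (deriv a (z s) * (- z s / n) * exp s + a (z s) * exp s)) (at s)"
      by (auto intro!: derivative_eq_intros DERIV_chain2[OF _ dz])
    then have "(\<eta> has_field_derivative (deriv a (z s) * (- z s / n) * exp s + a (z s) * exp s)) (at s)"
      by (rule has_field_derivative_transform_within_open[of _ _ _ "{s. L < Re s}"])
        (use s \<eta>a in \<open>auto simp: open_halfspace_Re_gt\<close>)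
    then have "deriv \<eta> s = (deriv a (z s) * (- z s / n) * exp s + a (z s) * exp s)"
      by (rule DERIV_imp_deriv)
    then show ?thesis by (simp add: u_def U_def exp_minus field_simps)
  qed
  have du: "deriv u s = - (z s * deriv U (z s)) / n" if s: "L < Re s" for s
  proof -
    have "(U has_field_derivative deriv U (z s)) (at (z s))"
      using holU zball[OF s] by (intro holomorphic_derivI[of _ "ball 0 r"]) auto
    then have "((\<lambda>s. U (z s)) has_field_derivative (deriv U (z s) * (- z s / n))) (at s)"
      by (rule DERIV_chain2[OF _ dz])
    then have "(u has_field_derivative (deriv U (z s) * (- z s / n))) (at s)"
      by (rule has_field_derivative_transform_within_open[of _ _ _ "{s. L < Re s}"])
        (use s uU in \<open>auto simp: open_halfspace_Re_gt\<close>)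
    then show ?thesis by (simp add: DERIV_imp_deriv)
  qed
  obtain \<rho> C where \<rho>: "0 < \<rho>" "\<rho> \<le> r" "0 < C"
    and C1: "\<And>\<zeta>. norm \<zeta> < \<rho> \<Longrightarrow> (norm (\<zeta> * deriv U \<zeta>))\<^sup>2 \<le> C * norm \<zeta> * norm (U \<zeta>)"
    and C2: "\<And>\<zeta>. norm \<zeta> < \<rho> \<Longrightarrow> norm (U \<zeta>) \<le> C"
    and C3: "\<And>\<zeta>. 0 < norm \<zeta> \<Longrightarrow> norm \<zeta> < \<rho> \<Longrightarrow> U \<zeta> = 0 \<Longrightarrow> \<forall>\<xi>\<in>ball 0 r. U \<xi> = 0"
    using holomorphic_log_derivative_bound[OF holU r] by metis
  define M where "M = - n * ln \<rho>"
  have M: "norm (z s) < \<rho> \<longleftrightarrow> M < Re s" for s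
  proof -
    have "norm (z s) < \<rho> \<longleftrightarrow> - Re s / n < ln \<rho>"
      using \<rho> by (metis nz exp_less_cancel_iff exp_ln)
    also have "\<dots> \<longleftrightarrow> M < Re s" using n' by (auto simp: M_def field_simps)
    finally show ?thesis .
  qed
  have LM: "L \<le> M"
  proof -
    have "ln \<rho> \<le> - L / n" using \<rho> by (metis ln_exp ln_le_cancel_iff r r_def)
    then show ?thesis using n' by (simp add: M_def field_simps)
  qed
  show thesis
  proof (rule that[of M C])
    fix s assume s: "M < Re s"
    then have sL: "L < Re s" using LM by simp
    have "(norm (deriv u s))\<^sup>2 = (norm (z s * deriv U (z s)))\<^sup>2 / (real n)\<^sup>2"
      using du[OF sL] by (simp add: norm_divide power_divide)
    also have "\<dots> \<le> (norm (z s * deriv U (z s)))\<^sup>2 / 1"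
      using n by (intro divide_left_mono) (auto simp: Suc_le_eq)
    also have "\<dots> \<le> C * norm (z s) * norm (U (z s))" using C1 M s by simp
    finally show "(norm (deriv u s))\<^sup>2 \<le> C * exp (- Re s / n) * norm (u s)"
      using uU[OF sL] nz by simp
    show "norm (u s) \<le> C" using uU[OF sL] C2 M s by simp
    show "\<forall>t. L < Re t \<longrightarrow> u t = 0" if "u s = 0"
      using C3[of "z s"] uU M s z0 zball that sL by auto
  qed (use \<rho> LM in auto)
qed

section \<open>Branches of a finite-valued holomorphic function\<close>

text \<open>Local triviality of \<open>V\<close> as an unramified finite covering with holomorphic
  sheets. \<open>V s\<close> is a set of values, so sheets on which the values coincide count
  once.\<close>

definition local_branches where
  "local_branches V s r \<beta> \<longleftrightarrow> 0 < r \<and> finite (V s) \<and>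
     (\<forall>y\<in>V s. \<beta> y holomorphic_on ball s r \<and> \<beta> y s = y) \<and>
     (\<forall>t\<in>ball s r. bij_betw (\<lambda>y. \<beta> y t) (V s) (V t))"

text \<open>A continuous selection cannot change sheets: it avoids the finitely many other branches
  at \<open>s\<close>, hence also near \<open>s\<close>, and the branches exhaust
  \<open>V t\<close>.\<close>

lemma local_branches_unique:
  assumes b: "local_branches V s r \<beta>" and S: "open S" "s \<in> S"
    and c: "continuous_on S \<eta>" and V: "\<And>t. t \<in> S \<Longrightarrow> \<eta> t \<in> V t"
  shows "\<forall>\<^sub>F t in nhds s. \<eta> t = \<beta> (\<eta> s) t"
proof -
  have r: "0 < r" "finite (V s)" using b by (auto simp: local_branches_def)
  have "\<forall>\<^sub>F t in nhds s. \<eta> t \<noteq> \<beta> y t" if y: "y \<in> V s - {\<eta> s}" for y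
  proof -
    have "continuous_on (ball s r) (\<beta> y)" "\<beta> y s = y"
      using b y by (auto simp: local_branches_def intro: holomorphic_on_imp_continuous_on)
    then have "isCont (\<lambda>t. \<eta> t - \<beta> y t) s" "\<eta> s - \<beta> y s \<noteq> 0"
      using c S r y by (auto intro!: continuous_intros simp: continuous_on_eq_continuous_at)
    then obtain e where "0 < e" "\<And>t. dist s t < e \<Longrightarrow> \<eta> t - \<beta> y t \<noteq> 0"
      using continuous_at_avoid[of s "\<lambda>t. \<eta> t - \<beta> y t" 0] by auto
    then show ?thesis by (auto simp: eventually_nhds_metric dist_commute intro!: exI[of _ e])
  qed
  then have "\<forall>\<^sub>F t in nhds s. \<forall>y\<in>V s - {\<eta> s}. \<eta> t \<noteq> \<beta> y t"
    using r by (intro eventually_ball_finite) auto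
  moreover have "\<forall>\<^sub>F t in nhds s. t \<in> S \<inter> ball s r"
    using S r by (intro eventually_nhds_in_open) auto
  ultimately show ?thesis
  proof eventually_elim
    case (elim t)
    then have "bij_betw (\<lambda>y. \<beta> y t) (V s) (V t)" using b by (auto simp: local_branches_def)
    then obtain y where "y \<in> V s" "\<eta> t = \<beta> y t"
      using V[of t] elim by (auto simp: bij_betw_def)
    then show ?case using elim by auto
  qed
qed

text \<open>The graph of \<open>V\<close> is a covering space of \<open>\<Omega>\<close>, and a
  convex base is simply connected; the identity therefore lifts through the prescribed point, and
  the second component of the lift is the branch.\<close>

lemma holomorphic_branch_exists:
  fixes V :: "complex \<Rightarrow> complex set"
  assumes \<Omega>: "open \<Omega>" "convex \<Omega>"
    and ne: "\<And>s. s \<in> \<Omega> \<Longrightarrow> V s \<noteq> {}"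
    and loc: "\<And>s. s \<in> \<Omega> \<Longrightarrow> \<exists>r \<beta>. ball s r \<subseteq> \<Omega> \<and> local_branches V s r \<beta>"
    and s0: "s0 \<in> \<Omega>" "y0 \<in> V s0"
  obtains \<eta> where "\<eta> holomorphic_on \<Omega>" "\<eta> s0 = y0" "\<And>s. s \<in> \<Omega> \<Longrightarrow> \<eta> s \<in> V s"
proof -
  define C where "C = Sigma \<Omega> V"
  have cov: "covering_space C fst \<Omega>"
  proof
    show "continuous_on C fst" by (intro continuous_intros)
    show "fst ` C = \<Omega>" using ne by (force simp: C_def)
    fix x assume x: "x \<in> \<Omega>"
    obtain r \<beta> where r: "r > 0" "ball x r \<subseteq> \<Omega>"
      and hol: "\<And>y. y \<in> V x \<Longrightarrow> \<beta> y holomorphic_on ball x r" "\<And>y. y \<in> V x \<Longrightarrow> \<beta> y x = y"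
      and bij: "\<And>s. s \<in> ball x r \<Longrightarrow> bij_betw (\<lambda>y. \<beta> y s) (V x) (V s)"
      and fin: "finite (V x)"
      using loc[OF x] unfolding local_branches_def by metis
    have cont: "continuous_on (ball x r) (\<beta> y)" if "y \<in> V x" for y
      using hol that by (auto intro: holomorphic_on_imp_continuous_on)
    have inj: "y = y'" if "\<beta> y s = \<beta> y' s" "s \<in> ball x r" "y \<in> V x" "y' \<in> V x" for y y' s
      using bij_betw_imp_inj_on[OF bij[OF that(2)]] that by (auto dest: inj_onD)
    have mem: "\<beta> y s \<in> V s" if "s \<in> ball x r" "y \<in> V x" for y s
      using bij_betw_apply[OF bij[OF that(1)] that(2)] .
    have sur: "\<exists>y\<in>V x. v = \<beta> y s" if "s \<in> ball x r" "v \<in> V s" for v s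
      using bij_betw_imp_surj_on[OF bij[OF that(1)]] that(2) by auto
    define S where "S = (\<lambda>y. (\<lambda>s. (s, \<beta> y s)) ` ball x r)"
    show "\<exists>T. x \<in> T \<and> openin (top_of_set \<Omega>) T \<and>
            (\<exists>v. \<Union> v = C \<inter> fst -` T \<and> (\<forall>u\<in>v. openin (top_of_set C) u) \<and> pairwise disjnt v \<and>
                 (\<forall>u\<in>v. \<exists>q. homeomorphism u T fst q))"
    proof (intro exI[of _ "ball x r"] exI[of _ "S ` V x"] conjI)
      show "x \<in> ball x r" using r by simp
      show "openin (top_of_set \<Omega>) (ball x r)"
        using r \<Omega> by (metis open_ball openin_open_eq)
      show "\<Union> (S ` V x) = C \<inter> fst -` ball x r"
        using sur mem r by (fastforce simp: S_def C_def)
      show "pairwise disjnt (S ` V x)"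
      proof (rule pairwiseI)
        fix u u' assume "u \<in> S ` V x" "u' \<in> S ` V x" "u \<noteq> u'"
        then obtain y y' where y: "y \<in> V x" "y' \<in> V x" "y \<noteq> y'" "u = S y" "u' = S y'" by auto
        show "disjnt u u'"
          unfolding y disjnt_def S_def using inj[OF _ _ y(1,2)] y(3) by fastforce
      qed
      show "\<forall>u\<in>S ` V x. \<exists>q. homeomorphism u (ball x r) fst q"
      proof
        fix u assume "u \<in> S ` V x"
        then obtain y where y: "y \<in> V x" "u = S y" by auto
        show "\<exists>q. homeomorphism u (ball x r) fst q"
          by (intro exI[of _ "\<lambda>s. (s, \<beta> y s)"] homeomorphismI)
            (use cont y in \<open>auto simp: S_def intro!: continuous_intros\<close>)
      qed
      show "\<forall>u\<in>S ` V x. openin (top_of_set C) u"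
      proof
        fix u assume "u \<in> S ` V x"
        then obtain y where y: "y \<in> V x" "u = S y" by auto
        \<comment> \<open>A sheet is open in the graph because it is cut out by finitely many open
          conditions: not to lie on any other sheet.\<close>
        define O' where "O' = (\<Inter>y'\<in>V x - {y}. {p \<in> ball x r \<times> UNIV. snd p - \<beta> y' (fst p) \<in> - {0}})"
        have "open {p \<in> ball x r \<times> UNIV. snd p - \<beta> y' (fst p) \<in> - {0}}" if "y' \<in> V x" for y'
        proof (rule continuous_open_preimage[of _ _ "- {0}", unfolded vimage_def Collect_conj_eq[symmetric] Int_def mem_Collect_eq])
          show "continuous_on (ball x r \<times> UNIV) (\<lambda>p. snd p - \<beta> y' (fst p))"
            by (intro continuous_intros continuous_on_compose2[OF cont[OF that]]) auto
        qed (auto intro: open_Times)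
        then have "open O'" unfolding O'_def using fin by (intro open_INT) auto
        then have "open (O' \<inter> (ball x r \<times> UNIV))" by (intro open_Int open_Times) auto
        moreover have "u = C \<inter> (O' \<inter> (ball x r \<times> UNIV))"
        proof
          show "u \<subseteq> C \<inter> (O' \<inter> ball x r \<times> UNIV)"
            using y mem inj r by (fastforce simp: S_def O'_def C_def)
          show "C \<inter> (O' \<inter> ball x r \<times> UNIV) \<subseteq> u"
          proof
            fix p assume p: "p \<in> C \<inter> (O' \<inter> ball x r \<times> UNIV)"
            then obtain y' where y': "y' \<in> V x" "snd p = \<beta> y' (fst p)"
              using sur[of "fst p" "snd p"] by (auto simp: C_def)
            then have "y' = y" using p by (fastforce simp: O'_def)
            then show "p \<in> u" using p y' y by (force simp: S_def)
          qed
        qed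
        ultimately show "openin (top_of_set C) u" by (auto simp: openin_open)
      qed
    qed
  qed
  have sc: "simply_connected \<Omega>" "path_connected \<Omega>" "locally path_connected \<Omega>"
    using \<Omega> by (auto simp: convex_imp_simply_connected convex_imp_path_connected open_imp_locally_path_connected)
  obtain g where g: "continuous_on \<Omega> g" "g \<in> \<Omega> \<rightarrow> C" "g s0 = (s0, y0)" "\<And>y. y \<in> \<Omega> \<Longrightarrow> fst (g y) = id y"
    by (rule covering_space_lift_strong[OF cov _ s0(1) sc(1,3), of "(s0,y0)" id])
      (use s0 in \<open>auto simp: C_def\<close>)
  define \<eta> where "\<eta> = snd \<circ> g"
  have \<eta>V: "\<eta> s \<in> V s" if "s \<in> \<Omega>" for s
    using g(2) g(4)[OF that] that by (auto simp: \<eta>_def C_def Pi_iff)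
  have c\<eta>: "continuous_on \<Omega> \<eta>" unfolding \<eta>_def o_def by (intro continuous_intros g)
  show thesis
  proof (rule that)
    show "\<eta> s0 = y0" by (simp add: \<eta>_def g)
    show "\<And>s. s \<in> \<Omega> \<Longrightarrow> \<eta> s \<in> V s" by (rule \<eta>V)
    show "\<eta> holomorphic_on \<Omega>"
      unfolding holomorphic_on_open[OF \<Omega>(1)] field_differentiable_def[symmetric]
    proof
      fix s assume s: "s \<in> \<Omega>"
      obtain r \<beta> where r: "ball s r \<subseteq> \<Omega>" and b: "local_branches V s r \<beta>" using loc[OF s] by blast
      \<comment> \<open>The lift is only known to be continuous; holomorphy follows since near
        \<open>s\<close> it coincides with one of the holomorphic sheets.\<close>
      have ev: "\<forall>\<^sub>F t in nhds s. \<eta> t = \<beta> (\<eta> s) t"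
        by (rule local_branches_unique[OF b \<Omega>(1) s c\<eta> \<eta>V])
      have "\<beta> (\<eta> s) field_differentiable at s"
        using b \<eta>V[OF s] holomorphic_on_imp_differentiable_at[of "\<beta> (\<eta> s)" "ball s r" s]
        by (auto simp: local_branches_def)
      then show "\<eta> field_differentiable at s"
        using DERIV_cong_ev[OF refl ev refl] by (auto simp: field_differentiable_def)
    qed
  qed
qed


text \<open>Agreement at one point spreads to a neighbourhood, as both functions follow the same
  sheet, and then to \<open>\<Omega>\<close> by the identity theorem.\<close>

lemma holomorphic_branch_unique:
  fixes V :: "complex \<Rightarrow> complex set"
  assumes \<Omega>: "open \<Omega>" "connected \<Omega>"
    and loc: "\<And>s. s \<in> \<Omega> \<Longrightarrow> \<exists>r \<beta>. ball s r \<subseteq> \<Omega> \<and> local_branches V s r \<beta>"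
    and \<eta>: "\<eta> holomorphic_on \<Omega>" "\<And>s. s \<in> \<Omega> \<Longrightarrow> \<eta> s \<in> V s"
    and \<theta>: "\<theta> holomorphic_on \<Omega>" "\<And>s. s \<in> \<Omega> \<Longrightarrow> \<theta> s \<in> V s"
    and eq: "s \<in> \<Omega>" "\<eta> s = \<theta> s" and t: "t \<in> \<Omega>"
  shows "\<eta> t = \<theta> t"
proof -
  obtain r \<beta> where b: "local_branches V s r \<beta>" using loc[OF eq(1)] by blast
  have "\<forall>\<^sub>F t in nhds s. \<eta> t = \<beta> (\<eta> s) t" "\<forall>\<^sub>F t in nhds s. \<theta> t = \<beta> (\<theta> s) t"
    using \<eta> \<theta> by (auto intro!: local_branches_unique[OF b \<Omega>(1) eq(1)] holomorphic_on_imp_continuous_on)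
  then have "\<forall>\<^sub>F t in nhds s. \<eta> t = \<theta> t"
    by eventually_elim (simp add: eq)
  moreover have "\<forall>\<^sub>F t in nhds s. t \<in> \<Omega>" using \<Omega> eq by (intro eventually_nhds_in_open) auto
  ultimately have "\<forall>\<^sub>F t in nhds s. t \<in> \<Omega> \<and> \<eta> t = \<theta> t" by eventually_elim auto
  then obtain S where S: "open S" "s \<in> S" "\<And>t. t \<in> S \<Longrightarrow> t \<in> \<Omega> \<and> \<eta> t = \<theta> t"
    unfolding eventually_nhds by auto
  have "\<eta> t - \<theta> t = 0"
  proof (rule analytic_continuation[OF _ \<Omega>, of "\<lambda>t. \<eta> t - \<theta> t" S s])
    show "s islimpt S" using S by (simp add: interior_limit_point interior_open)
  qed (use S \<eta> \<theta> eq t in \<open>auto intro!: holomorphic_intros\<close>)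
  then show ?thesis by simp
qed

text \<open>Passing to logarithms turns the neighbourhood of infinity into a half-plane, on which
  all \<open>m\<close> branches are global functions; the monodromy becomes translation by
  \<open>2 \<pi> \<i>\<close>, and finiteness of \<open>m\<close> makes every branch
  periodic.\<close>

lemma algebraic_branch_bound:
  fixes V :: "complex \<Rightarrow> complex set"
  assumes R: "0 < R"
    and card: "\<And>w. R < norm w \<Longrightarrow> card (V w) = m"
    and loc: "\<And>w. R < norm w \<Longrightarrow> \<exists>r \<beta>. local_branches V w r \<beta>"
    and bnd: "\<And>w y. R < norm w \<Longrightarrow> y \<in> V w \<Longrightarrow> norm y \<le> norm w"
  obtains R' C \<delta> where "R \<le> R'" "0 < C" "0 < \<delta>"
    "\<And>w h S. \<lbrakk>R' < norm w; open S; w \<in> S; h holomorphic_on S; \<And>x. x \<in> S \<Longrightarrow> h x \<in> V x\<rbrakk> \<Longrightarrow>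
       (norm (deriv (deriv h) w))\<^sup>2 \<le> C * norm w powr (-2 - \<delta>) * norm (deriv h w) \<and>
       norm (deriv h w) \<le> C \<and> (deriv h w = 0 \<longrightarrow> (\<forall>\<^sub>F x in nhds w. deriv h x = 0))"
proof (cases "m = 0")
  case True
  then have "V w = {}" if "R < norm w" for w
    using card[OF that] loc[OF that] by (auto simp: local_branches_def)
  \<comment> \<open>No \<open>h\<close> can select from an empty \<open>V w\<close>, so the estimate
    is vacuous and the constants are arbitrary.\<close>
  then show ?thesis by (intro that[of R 1 1]) (use R in force)+
next
  case False
  define L where "L = ln R"
  define \<Omega> where "\<Omega> = {s. L < Re s}"
  define V' where "V' = (\<lambda>s. V (exp s))"
  have \<Omega>: "open \<Omega>" "convex \<Omega>" "connected \<Omega>"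
    by (auto simp: \<Omega>_def open_halfspace_Re_gt convex_halfspace_Re_gt convex_connected)
  have ex: "R < norm (exp s)" if "s \<in> \<Omega>" for s
    using that R by (auto simp: \<Omega>_def L_def) (metis exp_less_cancel_iff exp_ln)
  have card': "card (V' s) = m" "V' s \<noteq> {}" "finite (V' s)" if "s \<in> \<Omega>" for s
    using card[OF ex[OF that]] False by (auto simp: V'_def intro: card_ge_0_finite)
  have loc': "\<exists>r \<beta>. ball s r \<subseteq> \<Omega> \<and> local_branches V' s r \<beta>" if s: "s \<in> \<Omega>" for s
  proof -
    obtain r \<beta> where b: "local_branches V (exp s) r \<beta>" using loc[OF ex[OF s]] by blast
    have "open (\<Omega> \<inter> exp -` ball (exp s) r)"
      using \<Omega> by (intro open_Int open_vimage continuous_intros) auto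
    moreover have "s \<in> \<Omega> \<inter> exp -` ball (exp s) r" using s b by (auto simp: local_branches_def)
    ultimately obtain r' where r': "0 < r'" "ball s r' \<subseteq> \<Omega> \<inter> exp -` ball (exp s) r"
      using open_contains_ball_eq by blast
    have "local_branches V' s r' (\<lambda>y t. \<beta> y (exp t))"
      unfolding local_branches_def
    proof (intro conjI ballI)
      fix y assume "y \<in> V' s"
      then have "\<beta> y holomorphic_on ball (exp s) r" using b by (auto simp: local_branches_def V'_def)
      then have "(\<beta> y \<circ> exp) holomorphic_on ball s r'"
        by (intro holomorphic_on_compose_gen[of _ _ _ "ball (exp s) r"] holomorphic_intros) (use r' in auto)
      then show "(\<lambda>t. \<beta> y (exp t)) holomorphic_on ball s r'" by (simp add: o_def)
    qed (use b r' card'[OF s] in \<open>auto simp: local_branches_def V'_def subset_iff\<close>)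
    then show ?thesis using r' by blast
  qed
  define s0 :: complex where "s0 = of_real (L + 1)"
  have s0: "s0 \<in> \<Omega>" by (simp add: s0_def \<Omega>_def)
  have "\<exists>\<eta>. \<eta> holomorphic_on \<Omega> \<and> \<eta> s0 = y \<and> (\<forall>s\<in>\<Omega>. \<eta> s \<in> V' s)" if "y \<in> V' s0" for y
    using holomorphic_branch_exists[OF \<Omega>(1,2) card'(2) loc' s0 that] by metis
  then obtain \<eta> where \<eta>: "\<And>y. y \<in> V' s0 \<Longrightarrow> \<eta> y holomorphic_on \<Omega>" "\<And>y. y \<in> V' s0 \<Longrightarrow> \<eta> y s0 = y"
      "\<And>y s. y \<in> V' s0 \<Longrightarrow> s \<in> \<Omega> \<Longrightarrow> \<eta> y s \<in> V' s"
    by metis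
  have uniq: "f t = g t" if "f holomorphic_on \<Omega>" "\<And>s. s \<in> \<Omega> \<Longrightarrow> f s \<in> V' s"
      "g holomorphic_on \<Omega>" "\<And>s. s \<in> \<Omega> \<Longrightarrow> g s \<in> V' s" "s \<in> \<Omega>" "f s = g s" "t \<in> \<Omega>" for f g s t
    by (rule holomorphic_branch_unique[OF \<Omega>(1,3), of V' f g s t]) (use loc' that in auto)
  have all: "\<exists>y\<in>V' s0. v = \<eta> y s" if s: "s \<in> \<Omega>" "v \<in> V' s" for v s
  proof -
    have inj: "inj_on (\<lambda>y. \<eta> y s) (V' s0)"
    proof (rule inj_onI)
      fix y y' assume y: "y \<in> V' s0" "y' \<in> V' s0" and eq: "\<eta> y s = \<eta> y' s"
      have "\<eta> y s0 = \<eta> y' s0"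
        by (rule uniq[of "\<eta> y" "\<eta> y'" s]) (use s eq s0 \<eta>(1,3) y in auto)
      then show "y = y'" using \<eta>(2) y by simp
    qed
    moreover have sub: "(\<lambda>y. \<eta> y s) ` V' s0 \<subseteq> V' s" using \<eta>(3) s by auto
    ultimately have "(\<lambda>y. \<eta> y s) ` V' s0 = V' s"
      using card' s0 s by (intro card_subset_eq) (auto simp: card_image)
    then show ?thesis using s by blast
  qed
  have per: "\<exists>n>0. \<forall>s\<in>\<Omega>. \<eta> y (s + 2 * pi * \<i> * of_nat n) = \<eta> y s" if y: "y \<in> V' s0" for y
  proof -
    define \<tau> where "\<tau> = (\<lambda>k::nat. 2 * pi * \<i> * of_nat k)"
    have \<tau>: "s + \<tau> k \<in> \<Omega>" "s - \<tau> k \<in> \<Omega>" "V' (s + \<tau> k) = V' s" if "s \<in> \<Omega>" for s k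
    proof -
      have "exp (s + \<tau> k) = exp s" unfolding exp_eq
        by (intro exI[of _ "int k"]) (simp add: \<tau>_def)
      then show "V' (s + \<tau> k) = V' s" by (simp add: V'_def)
    qed (use that in \<open>auto simp: \<Omega>_def \<tau>_def\<close>)
    \<comment> \<open>Pigeonhole: the \<open>m + 1\<close> translates take their values at
      \<open>s0\<close> in a set of \<open>m\<close> elements. Two of them agree there, hence
      everywhere by uniqueness, and the difference of the shifts is a period.\<close>
    have "(\<lambda>k. \<eta> y (s0 + \<tau> k)) ` {0..m} \<subseteq> V' s0" using \<eta>(3)[OF y] \<tau> s0 by force
    then have "card ((\<lambda>k. \<eta> y (s0 + \<tau> k)) ` {0..m}) \<le> m"
      using card'[OF s0] card_mono by metis
    then have "\<not> inj_on (\<lambda>k. \<eta> y (s0 + \<tau> k)) {0..m}" using card_image by fastforce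
    then obtain k k' where k: "k < k'" "\<eta> y (s0 + \<tau> k) = \<eta> y (s0 + \<tau> k')"
      unfolding inj_on_def by (metis linorder_neqE_nat)
    have hol: "(\<lambda>s. \<eta> y (s + \<tau> k)) holomorphic_on \<Omega>" for k
    proof -
      have "(\<eta> y \<circ> (\<lambda>s. s + \<tau> k)) holomorphic_on \<Omega>"
        by (intro holomorphic_on_compose_gen[OF _ \<eta>(1)[OF y]] holomorphic_intros) (use \<tau> in auto)
      then show ?thesis by (simp add: o_def)
    qed
    have *: "\<eta> y (s + \<tau> k) = \<eta> y (s + \<tau> k')" if "s \<in> \<Omega>" for s
      by (rule uniq[of "\<lambda>s. \<eta> y (s + \<tau> k)" "\<lambda>s. \<eta> y (s + \<tau> k')" s0])
        (use hol s0 k(2) that \<eta>(3)[OF y] \<tau> in metis)+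
    show ?thesis
    proof (intro exI[of _ "k' - k"] conjI ballI)
      fix s assume s: "s \<in> \<Omega>"
      have "\<eta> y (s - \<tau> k + \<tau> k) = \<eta> y (s - \<tau> k + \<tau> k')" using * \<tau> s by blast
      then show "\<eta> y (s + 2 * pi * \<i> * of_nat (k' - k)) = \<eta> y s"
        using k by (simp add: \<tau>_def of_nat_diff algebra_simps)
    qed (use k in auto)
  qed
  define u where "u = (\<lambda>y s. deriv (\<eta> y) s * exp (- s))"
  have "\<exists>M C n. 0 < C \<and> 0 < n \<and> (\<forall>s. M < Re s \<longrightarrow>
      (norm (deriv (u y) s))\<^sup>2 \<le> C * exp (- Re s / real n) * norm (u y s) \<and>
      norm (u y s) \<le> C \<and> (u y s = 0 \<longrightarrow> (\<forall>t. L < Re t \<longrightarrow> u y t = 0)))" if y: "y \<in> V' s0" for y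
  proof -
    obtain n where n: "0 < n" "\<And>s. s\<in>\<Omega> \<Longrightarrow> \<eta> y (s + 2 * pi * \<i> * of_nat n) = \<eta> y s" using per[OF y] by blast
    have hol: "\<eta> y holomorphic_on {s. L < Re s}" using \<eta>(1)[OF y] by (simp add: \<Omega>_def)
    have nb: "norm (\<eta> y s) \<le> norm (exp s)" if "L < Re s" for s
      using bnd[OF ex, of s "\<eta> y s"] \<eta>(3)[OF y, of s] that by (simp add: \<Omega>_def V'_def)
    show ?thesis
    proof (rule periodic_puiseux_bound[OF hol n(1) nb n(2)])
      fix M C :: real
      assume "0 < C" and M:
        "\<And>s. M < Re s \<Longrightarrow> (norm (deriv (\<lambda>s. deriv (\<eta> y) s * exp (- s)) s))\<^sup>2
            \<le> C * exp (- Re s / n) * norm (deriv (\<eta> y) s * exp (- s))"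
        "\<And>s. M < Re s \<Longrightarrow> norm (deriv (\<eta> y) s * exp (- s)) \<le> C"
        "\<And>s. M < Re s \<Longrightarrow> deriv (\<eta> y) s * exp (- s) = 0 \<Longrightarrow>
            \<forall>t. L < Re t \<longrightarrow> deriv (\<eta> y) t * exp (- t) = 0"
      then show ?thesis
        unfolding u_def using n(1) by (intro exI[of _ M] exI[of _ C] exI[of _ n]) blast
    qed (auto simp: \<Omega>_def)
  qed
  then obtain M C n where MCn: "\<And>y. y \<in> V' s0 \<Longrightarrow> 0 < C y \<and> 0 < n y \<and> (\<forall>s. M y < Re s \<longrightarrow>
      (norm (deriv (u y) s))\<^sup>2 \<le> C y * exp (- Re s / real (n y)) * norm (u y s) \<and>
      norm (u y s) \<le> C y \<and> (u y s = 0 \<longrightarrow> (\<forall>t. L < Re t \<longrightarrow> u y t = 0)))" by metis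
  note ne = card'(2,3)[OF s0]
  \<comment> \<open>Only the finitely many branches indexed by \<open>V' s0\<close> exist on the
    half-plane, so maxima of their constants serve every local branch \<open>h\<close>.\<close>
  define MM CC nn where "MM = Max (M ` V' s0)" and "CC = Max (C ` V' s0)" and "nn = Max (n ` V' s0)"
  have mx: "M y \<le> MM" "C y \<le> CC" "n y \<le> nn" if "y \<in> V' s0" for y
    using ne that by (auto simp: MM_def CC_def nn_def)
  have pos: "0 < CC" "0 < nn"
    using ne mx MCn by (meson equals0I order_less_le_trans, meson equals0I order_less_le_trans)
  \<comment> \<open>Beyond modulus 1 the quantity \<open>norm w powr (- 1 / n)\<close> grows with
    \<open>n\<close>, so the largest period gives a decay valid for all branches.\<close>
  define R' where "R' = max R (max 1 (exp MM))"
  have key: "(norm (deriv (deriv h) w))\<^sup>2 \<le> CC * norm w powr (-2 - 1 / real nn) * norm (deriv h w) \<and>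
       norm (deriv h w) \<le> CC \<and> (deriv h w = 0 \<longrightarrow> (\<forall>\<^sub>F x in nhds w. deriv h x = 0))"
    if w: "R' < norm w" and S: "open S" "w \<in> S" and h: "h holomorphic_on S" "\<And>x. x \<in> S \<Longrightarrow> h x \<in> V x" for w h S
  proof -
    have w0: "w \<noteq> 0" "1 < norm w" using w R by (auto simp: R'_def)
    define s where "s = Ln w"
    have es: "exp s = w" and Res: "Re s = ln (norm w)" using w0 by (auto simp: s_def)
    have "L < Re s" unfolding Res L_def using w R w0 by (auto simp: R'_def)
    then have s: "s \<in> \<Omega>" by (simp add: \<Omega>_def)
    have "MM < Re s"
    proof -
      have "exp MM < norm w" using w by (simp add: R'_def)
      then show ?thesis using Res w0 by (metis exp_gt_zero ln_exp ln_less_cancel_iff order_less_trans)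
    qed
    obtain y where y: "y \<in> V' s0" "h w = \<eta> y s"
      using all[OF s, of "h w"] h(2)[OF S(2)] by (auto simp: V'_def es)
    have b: "(norm (deriv (u y) s))\<^sup>2 \<le> C y * exp (- Re s / real (n y)) * norm (u y s)"
      "norm (u y s) \<le> C y" "u y s = 0 \<Longrightarrow> \<forall>t. L < Re t \<longrightarrow> u y t = 0"
      using MCn[OF y(1)] order_le_less_trans[OF mx(1)[OF y(1)] \<open>MM < Re s\<close>] by blast+
    obtain r \<beta> where lb: "local_branches V' s r \<beta>" using loc'[OF s] by blast
    define T where "T = \<Omega> \<inter> exp -` S"
    have T: "open T" "s \<in> T" unfolding T_def using S \<Omega> s es
      by (auto intro!: open_Int open_vimage continuous_intros)
    have he: "(\<lambda>t. h (exp t)) holomorphic_on T"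
      using holomorphic_on_compose_gen[OF _ h(1), of exp T] by (auto simp: o_def T_def intro: holomorphic_intros)
    have "\<forall>\<^sub>F t in nhds s. h (exp t) = \<beta> (h (exp s)) t"
      using he h by (intro local_branches_unique[OF lb T]) (auto intro: holomorphic_on_imp_continuous_on simp: T_def V'_def)
    moreover have "\<forall>\<^sub>F t in nhds s. \<eta> y t = \<beta> (\<eta> y s) t"
      using \<eta>[OF y(1)] by (intro local_branches_unique[OF lb \<Omega>(1) s]) (auto intro: holomorphic_on_imp_continuous_on)
    ultimately have "\<forall>\<^sub>F t in nhds s. \<eta> y t = h (exp t)"
      by eventually_elim (simp add: y es)
    then have "\<forall>\<^sub>F t in nhds s. \<forall>\<^sub>F t in nhds t. \<eta> y t = h (exp t)"
      by (simp add: eventually_eventually)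
    moreover have "\<forall>\<^sub>F t in nhds s. t \<in> T" using T by (rule eventually_nhds_in_open)
    ultimately have ev: "\<forall>\<^sub>F t in nhds s. u y t = deriv h (exp t)"
    proof eventually_elim
      case (elim t)
      have "(h has_field_derivative deriv h (exp t)) (at (exp t))"
        using h S elim by (intro holomorphic_derivI[of _ S]) (auto simp: T_def)
      then have "((\<lambda>t. h (exp t)) has_field_derivative deriv h (exp t) * exp t) (at t)"
        by (rule DERIV_chain2) (rule DERIV_exp)
      then have "deriv (\<eta> y) t = deriv h (exp t) * exp t"
        using DERIV_imp_deriv deriv_cong_ev[OF elim(1) refl] by fastforce
      then show ?case by (simp add: u_def exp_minus)
    qed
    have us: "u y s = deriv h w" using eventually_nhds_x_imp_x[OF ev] es by simp
    have "(deriv h has_field_derivative deriv (deriv h) (exp s)) (at (exp s))"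
      unfolding es by (rule holomorphic_derivI[OF holomorphic_deriv[OF h(1) S(1)] S])
    then have "((\<lambda>t. deriv h (exp t)) has_field_derivative deriv (deriv h) (exp s) * exp s) (at s)"
      by (rule DERIV_chain2) (rule DERIV_exp)
    then have du: "deriv (u y) s = deriv (deriv h) w * w"
      unfolding deriv_cong_ev[OF ev refl] es by (rule DERIV_imp_deriv)
    have e1: "exp (- Re s / real (n y)) \<le> norm w powr (- 1 / nn)"
    proof -
      have "- Re s / real (n y) \<le> - Re s / real nn"
        using Res w0 mx[OF y(1)] MCn[OF y(1)] by (auto simp: divide_simps intro!: mult_left_mono)
      then have "exp (- Re s / real (n y)) \<le> exp (- Re s / real nn)" by simp
      also have "\<dots> = norm w powr (- 1 / nn)" using w0 Res by (simp add: powr_def)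
      finally show ?thesis .
    qed
    have "(norm (deriv (deriv h) w))\<^sup>2 * (norm w)\<^sup>2 \<le> C y * exp (- Re s / real (n y)) * norm (deriv h w)"
      using b(1) us du by (simp add: norm_mult power_mult_distrib)
    also have "\<dots> \<le> CC * norm w powr (- 1 / nn) * norm (deriv h w)"
      using e1 mx[OF y(1)] pos by (intro mult_mono) auto
    finally have "(norm (deriv (deriv h) w))\<^sup>2 \<le> CC * norm w powr (- 1 / nn) * norm (deriv h w) / (norm w)\<^sup>2"
      using w0 by (simp add: field_simps)
    also have "\<dots> = CC * (norm w powr (- 1 / nn) / norm w powr 2) * norm (deriv h w)"
      using w0 by (simp add: powr_numeral)
    also have "norm w powr (- 1 / nn) / norm w powr 2 = norm w powr (-2 - 1 / real nn)"
    proof -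
      have "-2 - 1 / real nn = - 1 / nn - 2" by simp
      then show ?thesis by (simp only: powr_diff)
    qed
    finally have 1: "(norm (deriv (deriv h) w))\<^sup>2 \<le> CC * norm w powr (-2 - 1 / real nn) * norm (deriv h w)" .
    have 2: "norm (deriv h w) \<le> CC" using b(2) us mx[OF y(1)] by simp
    have 3: "\<forall>\<^sub>F x in nhds w. deriv h x = 0" if "deriv h w = 0"
    proof -
      obtain T' where T': "open T'" "s \<in> T'" "\<And>t. t \<in> T' \<Longrightarrow> u y t = deriv h (exp t)"
        using ev unfolding eventually_nhds by auto
      define T'' where "T'' = T' \<inter> \<Omega>"
      have "u y t = 0" if "t \<in> T''" for t
        using b(3) us \<open>deriv h w = 0\<close> that by (auto simp: \<Omega>_def T''_def)
      then have z: "deriv h (exp t) = 0" if "t \<in> T''" for t using T' that by (auto simp: T''_def)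
      \<comment> \<open>A local logarithm at \<open>w\<close> with value \<open>s\<close>; it
        transports the vanishing of \<open>u y\<close> near \<open>s\<close> to a neighbourhood of
        \<open>w\<close>.\<close>
      define g where "g = (\<lambda>x. s + Ln (x / w))"
      have "w / w \<notin> \<real>\<^sub>\<le>\<^sub>0" using w0 by auto
      then have "isCont g w" unfolding g_def using w0 by (intro continuous_intros) auto
      moreover have "g w = s" using w0 by (simp add: g_def)
      moreover have "open T''" "s \<in> T''" using T' \<Omega> s by (auto simp: T''_def)
      ultimately have "\<forall>\<^sub>F x in nhds w. g x \<in> T''"
        using topological_tendstoD[of g "g w" "at w" T''] by (auto simp: isCont_def eventually_nhds_conv_at)
      moreover have "\<forall>\<^sub>F x in nhds w. x \<in> - {0}"
        using w0 by (intro eventually_nhds_in_open) auto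
      ultimately show ?thesis
      proof eventually_elim
        case (elim x)
        then have "exp (g x) = x" using w0 es by (simp add: g_def exp_add)
        then show ?case using z[OF elim(1)] by simp
      qed
    qed
    show ?thesis using 1 2 3 by blast
  qed
  show thesis
  proof (rule that[of R' CC "1 / nn"])
    show "R \<le> R'" "0 < CC" "0 < 1 / real nn" using pos by (auto simp: R'_def)
  qed (fact key)
qed

section \<open>Change of variables under injective holomorphic maps\<close>

text \<open>The change of variables formula with Jacobian determinants lives on
  \<open>real ^ 'n\<close>; this identification of the plane with \<open>real ^ 2\<close> preserves
  Lebesgue measure.\<close>

definition vec_complex :: "real ^ 2 \<Rightarrow> complex" where
  "vec_complex v = Complex (v $ 1) (v $ 2)"

definition complex_vec :: "complex \<Rightarrow> real ^ 2" where
  "complex_vec z = vector [Re z, Im z]"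

lemma vec_complex_inverse [simp]: "complex_vec (vec_complex v) = v"
  by (simp add: complex_vec_def vec_complex_def vec_eq_iff forall_2)

lemma complex_vec_inverse [simp]: "vec_complex (complex_vec z) = z"
  by (simp add: complex_vec_def vec_complex_def)

lemma linear_vec_complex: "linear vec_complex"
  by (auto intro!: linearI simp: vec_complex_def complex_eq_iff)

lemma linear_complex_vec: "linear complex_vec"
  by (auto intro!: linearI simp: complex_vec_def vec_eq_iff forall_2)

lemma vec_complex_borel [measurable]: "vec_complex \<in> borel \<rightarrow>\<^sub>M borel"
  using linear_vec_complex by (intro borel_measurable_continuous_onI linear_continuous_on) (simp add: linear_conv_bounded_linear)

lemma distr_lborel_vec_complex: "distr lborel borel vec_complex = lborel"
proof (rule lborel_eqI[symmetric])
  fix l u :: complex assume lu: "\<And>b. b \<in> Basis \<Longrightarrow> l \<bullet> b \<le> u \<bullet> b"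
  have "Re l \<le> Re u" "Im l \<le> Im u" using lu[of 1] lu[of \<i>] by (auto simp: Basis_complex_def)
  have v: "vec_complex -` box l u = box (complex_vec l) (complex_vec u)"
    by (auto simp: box_def Basis_complex_def Basis_vec_def vec_complex_def complex_vec_def inner_axis forall_2)
  have B2: "Basis = {axis 1 1, axis 2 (1::real) :: real^2}"
    by (auto simp: Basis_vec_def UNIV_2)
  have ne: "axis 1 (1::real) \<noteq> (axis 2 1 :: real^2)" by (simp add: axis_eq_axis)
  have "emeasure (distr lborel borel vec_complex) (box l u) = emeasure lborel (box (complex_vec l) (complex_vec u))"
    by (simp add: emeasure_distr v)
  also have "\<dots> = (\<Prod>b\<in>Basis. (complex_vec u - complex_vec l) \<bullet> b)"
    using \<open>Re l \<le> Re u\<close> \<open>Im l \<le> Im u\<close>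
    by (intro emeasure_lborel_box) (auto simp: B2 inner_axis complex_vec_def)
  also have "\<dots> = (\<Prod>b\<in>Basis. (u - l) \<bullet> b)"
    using ne by (simp add: B2 Basis_complex_def inner_axis complex_vec_def)
  finally show "emeasure (distr lborel borel vec_complex) (box l u) = (\<Prod>b\<in>Basis. (u - l) \<bullet> b)" .
qed simp

lemma emeasure_lborel_vec_complex:
  "B \<in> sets borel \<Longrightarrow> emeasure lborel (vec_complex -` B) = emeasure lborel B"
  using emeasure_distr[of vec_complex lborel borel B] by (simp add: distr_lborel_vec_complex)

lemma nn_integral_lborel_vec_complex:
  "f \<in> borel_measurable borel \<Longrightarrow> (\<integral>\<^sup>+ v. f (vec_complex v) \<partial>lborel) = (\<integral>\<^sup>+ z. f z \<partial>lborel)"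
  using nn_integral_distr[of vec_complex lborel borel f] by (simp add: distr_lborel_vec_complex)

lemma holomorphic_image_borel:
  assumes S: "open S" and T: "T holomorphic_on S" "inj_on T S" and B: "B \<in> sets borel" "B \<subseteq> S"
  shows "T ` B \<in> sets borel"
proof -
  obtain g where g: "g holomorphic_on (T ` S)" "\<And>z. z \<in> S \<Longrightarrow> g (T z) = z"
    using holomorphic_has_inverse[OF T(1) S T(2)] by metis
  have o: "open (T ` S)" using open_mapping_thm3[OF T(1) S T(2)] .
  have "continuous_on (T ` S) g" using g(1) by (rule holomorphic_on_imp_continuous_on)
  then have "g \<in> borel_measurable (restrict_space borel (T ` S))"
    by (rule borel_measurable_continuous_on_restrict)
  then have "g -` B \<inter> space (restrict_space borel (T ` S)) \<in> sets (restrict_space borel (T ` S))"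
    using B(1) by (rule measurable_sets)
  then have "g -` B \<inter> (T ` S) \<in> sets borel"
    using o by (subst (asm) sets_restrict_space_iff) (auto simp: space_restrict_space)
  also have "g -` B \<inter> (T ` S) = T ` B" using g(2) B(2) by force
  finally show ?thesis .
qed

text \<open>By the Cauchy-Riemann equations the real Jacobian determinant of \<open>T\<close> is the
  squared modulus of its complex derivative.\<close>

lemma emeasure_holomorphic_image:
  assumes S: "open S" and T: "T holomorphic_on S" "inj_on T S" and B: "B \<in> sets borel" "B \<subseteq> S"
  shows "emeasure lborel (T ` B) = (\<integral>\<^sup>+ z\<in>B. ennreal ((norm (deriv T z))\<^sup>2) \<partial>lborel)"
proof -
  define D where "D = (\<lambda>z. (norm (deriv T z))\<^sup>2)"
  define B' where "B' = vec_complex -` B"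
  define T' where "T' = complex_vec \<circ> T \<circ> vec_complex"
  define dT where "dT = (\<lambda>v. complex_vec \<circ> (*) (deriv T (vec_complex v)) \<circ> vec_complex)"
  have B': "B' \<in> sets borel" unfolding B'_def using measurable_sets[OF vec_complex_borel B(1)] by simp
  have der: "(T' has_derivative dT v) (at v within B')" if "v \<in> B'" for v
  proof -
    have "(T has_derivative (*) (deriv T (vec_complex v))) (at (vec_complex v))"
      using T B S that by (intro has_field_derivative_imp_has_derivative holomorphic_derivI[of _ S]) (auto simp: B'_def)
    moreover have "(vec_complex has_derivative vec_complex) (at v within B')"
      using linear_vec_complex by (simp add: linear_imp_has_derivative)
    moreover have "(complex_vec has_derivative complex_vec) (at (T (vec_complex v)))"
      using linear_complex_vec by (simp add: linear_imp_has_derivative)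
    ultimately show ?thesis unfolding T'_def dT_def
      by (intro diff_chain_within) (auto intro: has_derivative_at_withinI)
  qed
  have det: "\<bar>det (matrix (dT v))\<bar> = D (vec_complex v)" for v
  proof -
    have "det (matrix (dT v)) = (Re (deriv T (vec_complex v)))\<^sup>2 + (Im (deriv T (vec_complex v)))\<^sup>2"
      by (simp add: det_2 matrix_def dT_def complex_vec_def vec_complex_def axis_def power2_eq_square)
    then show ?thesis by (simp add: D_def cmod_power2)
  qed
  have inj: "inj_on T' B'"
    using T(2) B(2) unfolding inj_on_def T'_def B'_def
    by (metis comp_apply complex_vec_inverse subsetD vec_complex_inverse vimage_eq)
  have TB: "T ` B \<in> sets borel" by (rule holomorphic_image_borel[OF S T B])
  have im: "T' ` B' = vec_complex -` (T ` B)"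
  proof
    show "vec_complex -` (T ` B) \<subseteq> T' ` B'"
    proof
      fix x assume "x \<in> vec_complex -` (T ` B)"
      then obtain b where b: "b \<in> B" "vec_complex x = T b" by auto
      then have "x = T' (complex_vec b)" by (simp add: T'_def b(2)[symmetric])
      then show "x \<in> T' ` B'" using b by (auto simp: B'_def)
    qed
  qed (auto simp: T'_def B'_def)
  have e1: "emeasure lborel (T ` B) = emeasure lborel (T' ` B')"
    by (simp add: im emeasure_lborel_vec_complex TB)
  have meas: "T' ` B' \<in> sets borel"
    unfolding im using measurable_sets[OF vec_complex_borel TB] by simp
  have Dm: "(\<lambda>z. D z * indicator B z) \<in> borel_measurable borel"
  proof -
    have "continuous_on S D" unfolding D_def
      using holomorphic_on_imp_continuous_on[OF holomorphic_deriv[OF T(1) S]] by (intro continuous_intros)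
    then have "D \<in> borel_measurable (restrict_space borel B)"
      using B by (intro borel_measurable_continuous_on_restrict) (auto intro: continuous_on_subset)
    then show ?thesis using B by (subst (asm) borel_measurable_restrict_space_iff) (auto simp: mult.commute)
  qed
  have e2: "(\<integral>\<^sup>+ z\<in>B. ennreal (D z) \<partial>lborel) = (\<integral>\<^sup>+ v. ennreal (D (vec_complex v) * indicator B' v) \<partial>lborel)"
  proof -
    have "(\<integral>\<^sup>+ z\<in>B. ennreal (D z) \<partial>lborel) = (\<integral>\<^sup>+ z. ennreal (D z * indicator B z) \<partial>lborel)"
      by (intro nn_integral_cong) (auto simp: indicator_def)
    also have "\<dots> = (\<integral>\<^sup>+ v. ennreal (D (vec_complex v) * indicator B (vec_complex v)) \<partial>lborel)"
      using Dm by (subst nn_integral_lborel_vec_complex) auto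
    finally show ?thesis by (simp add: B'_def indicator_def)
  qed
  have Dm': "(\<lambda>v. D (vec_complex v) * indicator B' v) \<in> borel_measurable borel"
    using measurable_compose[OF vec_complex_borel Dm] by (simp add: B'_def indicator_def)
  have hi: "((\<lambda>v. D (vec_complex v)) has_integral m) B' \<longleftrightarrow>
      (\<integral>\<^sup>+ v. ennreal (D (vec_complex v) * indicator B' v) \<partial>lborel) = ennreal m \<and> 0 \<le> m" for m
  proof -
    have "((\<lambda>v. D (vec_complex v)) has_integral m) B' \<longleftrightarrow>
        ((\<lambda>v. D (vec_complex v) * indicator B' v) has_integral m) UNIV"
      unfolding has_integral_restrict_UNIV[of B', symmetric] by (rule has_integral_cong) (auto simp: indicator_def)
    also have "\<dots> \<longleftrightarrow> integral\<^sup>N lebesgue (\<lambda>v. D (vec_complex v) * indicator B' v) = ennreal m \<and> 0 \<le> m"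
    proof -
      have "(\<lambda>v. D (vec_complex v) * indicator B' v) \<in> borel_measurable lebesgue"
        by (rule measurable_completion) (use Dm' in simp)
      moreover have "0 \<le> D (vec_complex v) * indicator B' v" for v by (simp add: D_def)
      ultimately show ?thesis
        using has_integral_iff_nn_integral_lebesgue[of "\<lambda>v. D (vec_complex v) * indicator B' v" m] by blast
    qed
    also have "integral\<^sup>N lebesgue (\<lambda>v. ennreal (D (vec_complex v) * indicator B' v)) = integral\<^sup>N lborel (\<lambda>v. ennreal (D (vec_complex v) * indicator B' v))"
      using Dm' by (intro nn_integral_completion)
    finally show ?thesis .
  qed
  have key: "T' ` B' \<in> lmeasurable \<and> measure lebesgue (T' ` B') = m \<longleftrightarrow>
      (\<integral>\<^sup>+ v. ennreal (D (vec_complex v) * indicator B' v) \<partial>lborel) = ennreal m \<and> 0 \<le> m" for m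
  proof -
    have "B' \<in> sets lebesgue" using B' by simp
    from has_measure_differentiable_image[OF this der inj, of m] show ?thesis unfolding det hi .
  qed
  \<comment> \<open>\<open>key\<close> speaks of finite values only. If the image has infinite
    measure, a finite value of the integral would contradict \<open>key\<close>, so both sides are
    infinite.\<close>
  have "emeasure lborel (T' ` B') = (\<integral>\<^sup>+ v. ennreal (D (vec_complex v) * indicator B' v) \<partial>lborel)" (is "?a = ?b")
  proof (cases "T' ` B' \<in> lmeasurable")
    case True
    then have "?b = ennreal (measure lebesgue (T' ` B'))" using key by blast
    also have "\<dots> = emeasure lebesgue (T' ` B')" by (rule emeasure_eq_measure2[OF True, symmetric])
    also have "\<dots> = ?a" using meas by simp
    finally show ?thesis by simp
  next
    case False
    have "?b = \<infinity>"
    proof (cases ?b)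
      case (real m) then show ?thesis using False key[of m] by blast
    qed simp
    moreover have "\<not> emeasure lebesgue (T' ` B') < \<infinity>"
      using False meas unfolding fmeasurable_def by simp
    then have "?a = \<infinity>" using meas by (simp add: top.not_eq_extremum[symmetric])
    ultimately show ?thesis by simp
  qed
  then show ?thesis using e1 e2 by (simp add: D_def)
qed

text \<open>The formula for sets says that \<open>T\<close> pushes the density \<open>D\<close>
  forward to Lebesgue measure on the image; integrating \<open>f\<close> against both measures gives
  the claim.\<close>

lemma nn_integral_holomorphic_image:
  assumes S: "open S" and T: "T holomorphic_on S" "inj_on T S" and B: "B \<in> sets borel" "B \<subseteq> S"
    and f: "f \<in> borel_measurable borel"
  shows "(\<integral>\<^sup>+ w\<in>T ` B. f w \<partial>lborel) = (\<integral>\<^sup>+ z\<in>B. f (T z) * ennreal ((norm (deriv T z))\<^sup>2) \<partial>lborel)"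
proof -
  \<comment> \<open>A version of \<open>T\<close> that is measurable on the whole plane; the density
    \<open>D\<close> vanishes off \<open>B\<close>, where the value is set to 0.\<close>
  define T' where "T' = (\<lambda>z. if z \<in> B then T z else 0)"
  define D where "D = (\<lambda>z. ennreal ((norm (deriv T z))\<^sup>2) * indicator B z)"
  have cT: "T \<in> borel_measurable (restrict_space borel B)"
    using B holomorphic_on_imp_continuous_on[OF T(1)]
    by (intro borel_measurable_continuous_on_restrict) (auto intro: continuous_on_subset)
  have T': "T' \<in> borel_measurable borel"
    unfolding T'_def using cT B by (intro measurable_If_restrict_space_iff[THEN iffD2]) auto
  have "continuous_on S (\<lambda>z. (norm (deriv T z))\<^sup>2)"
    using holomorphic_on_imp_continuous_on[OF holomorphic_deriv[OF T(1) S]] by (intro continuous_intros)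
  then have "(\<lambda>z. (norm (deriv T z))\<^sup>2) \<in> borel_measurable (restrict_space borel B)"
    using B by (intro borel_measurable_continuous_on_restrict) (auto intro: continuous_on_subset)
  then have "(\<lambda>z. (norm (deriv T z))\<^sup>2 * indicator B z) \<in> borel_measurable borel"
    using B by (subst (asm) borel_measurable_restrict_space_iff) (auto simp: mult.commute)
  then have "(\<lambda>z. ennreal ((norm (deriv T z))\<^sup>2 * indicator B z)) \<in> borel_measurable borel" by measurable
  then have Dm: "D \<in> borel_measurable borel"
    unfolding D_def by (rule measurable_cong[THEN iffD1, rotated]) (auto simp: indicator_def)
  have TB: "T ` C \<in> sets borel" if "C \<in> sets borel" "C \<subseteq> B" for C
    using that B by (intro holomorphic_image_borel[OF S T]) auto
  have eq: "density lborel (indicator (T ` B)) = distr (density lborel D) borel T'"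
  proof (rule measure_eqI)
    fix A assume "A \<in> sets (density lborel (indicator (T ` B) :: complex \<Rightarrow> ennreal))"
    then have A: "A \<in> sets borel" by simp
    define C where "C = T' -` A \<inter> B"
    have C: "C \<in> sets borel" "C \<subseteq> B"
      using measurable_sets[OF T' A] B by (auto simp: C_def)
    have TC: "T ` C = T ` B \<inter> A" by (auto simp: C_def T'_def)
    have "emeasure (density lborel (indicator (T ` B))) A = emeasure lborel (T ` B \<inter> A)"
      using A TB[OF B(1)] by (simp add: emeasure_density indicator_inter_arith[symmetric] del: nn_integral_indicator)
        (simp add: nn_integral_indicator)
    also have "\<dots> = (\<integral>\<^sup>+ z\<in>C. ennreal ((norm (deriv T z))\<^sup>2) \<partial>lborel)"
      unfolding TC[symmetric] using C B by (intro emeasure_holomorphic_image[OF S T]) auto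
    also have "\<dots> = (\<integral>\<^sup>+ z. D z * indicator (T' -` A) z \<partial>lborel)"
      by (intro nn_integral_cong) (auto simp: D_def C_def indicator_def)
    also have "\<dots> = emeasure (distr (density lborel D) borel T') A"
      using A T' Dm measurable_sets[OF T' A] by (simp add: emeasure_distr emeasure_density)
    finally show "emeasure (density lborel (indicator (T ` B))) A = emeasure (distr (density lborel D) borel T') A" .
  qed simp
  have "(\<integral>\<^sup>+ w\<in>T ` B. f w \<partial>lborel) = integral\<^sup>N (density lborel (indicator (T ` B))) f"
    using f TB[OF B(1)] by (subst nn_integral_density) (auto simp: mult.commute)
  also have "\<dots> = (\<integral>\<^sup>+ z. D z * f (T' z) \<partial>lborel)"
    unfolding eq using f T' Dm by (simp add: nn_integral_distr nn_integral_density)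
  also have "\<dots> = (\<integral>\<^sup>+ z\<in>B. f (T z) * ennreal ((norm (deriv T z))\<^sup>2) \<partial>lborel)"
    by (intro nn_integral_cong) (auto simp: D_def T'_def indicator_def mult.commute)
  finally show ?thesis .
qed

section \<open>Gauss curvature of a holomorphic curve\<close>

definition velocity :: "(complex \<Rightarrow> complex ^ 3) \<Rightarrow> complex \<Rightarrow> complex ^ 3" where
  "velocity f z = (\<chi> j. deriv (\<lambda>w. f w $ j) z)"

definition acceleration :: "(complex \<Rightarrow> complex ^ 3) \<Rightarrow> complex \<Rightarrow> complex ^ 3" where
  "acceleration f z = (\<chi> j. deriv (deriv (\<lambda>w. f w $ j)) z)"

definition hermitian :: "complex ^ 'n \<Rightarrow> complex ^ 'n \<Rightarrow> complex" where
  "hermitian a b = (\<Sum>j\<in>UNIV. a $ j * cnj (b $ j))"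

text \<open>The Hermitian Gram determinant of \<open>a\<close> and \<open>b\<close>, that is, the
  squared norm of their wedge product.\<close>

definition gram_defect :: "complex ^ 'n \<Rightarrow> complex ^ 'n \<Rightarrow> real" where
  "gram_defect a b = (norm a)\<^sup>2 * (norm b)\<^sup>2 - (norm (hermitian b a))\<^sup>2"

lemma norm_vec_sqr: "(norm (a :: complex ^ 'n))\<^sup>2 = (\<Sum>j\<in>UNIV. (norm (a $ j))\<^sup>2)"
  by (simp add: norm_vec_def L2_set_def sum_nonneg)

lemma hermitian_self: "hermitian a a = of_real ((norm a)\<^sup>2)"
  by (simp add: hermitian_def norm_vec_sqr complex_norm_square flip: of_real_power)

lemma hermitian_cnj: "cnj (hermitian a b) = hermitian b a"
  by (simp add: hermitian_def cnj_sum mult.commute)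

lemma gram_defect_complex:
  "of_real (gram_defect a b) = hermitian a a * hermitian b b - hermitian b a * hermitian a b"
  by (simp add: gram_defect_def hermitian_self complex_norm_square hermitian_cnj flip: of_real_power)

lemma gram_defect_bounds: "0 \<le> gram_defect a b" "gram_defect a b \<le> (norm a)\<^sup>2 * (norm b)\<^sup>2"
proof -
  have "norm (hermitian b a) \<le> (\<Sum>j\<in>UNIV. norm (b $ j) * norm (a $ j))"
    unfolding hermitian_def by (rule sum_norm_le) (simp add: norm_mult)
  also have "\<dots> \<le> norm b * norm a"
    using L2_set_mult_ineq[of "\<lambda>j. norm (b $ j)" "\<lambda>j. norm (a $ j)" UNIV] by (simp add: norm_vec_def)
  finally have "(norm (hermitian b a))\<^sup>2 \<le> (norm b * norm a)\<^sup>2" by (intro power_mono) auto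
  then show "0 \<le> gram_defect a b" by (simp add: gram_defect_def power_mult_distrib mult.commute)
qed (simp add: gram_defect_def)

text \<open>The wedge of \<open>s a\<close> with \<open>s^2 b + t a\<close> is \<open>s^3\<close>
  times that of \<open>a\<close> with \<open>b\<close>. Velocity and acceleration change in exactly
  this way under a change of coordinate \<open>T\<close>, with \<open>s = T'\<close> and
  \<open>t = T''\<close>.\<close>

lemma gram_defect_reparam:
  "gram_defect (s *s a) (s\<^sup>2 *s b + t *s a) = (norm s)^6 * gram_defect a b"
proof -
  have lin: "hermitian (x *s c + y *s d) e = x * hermitian c e + y * hermitian d e"
    "hermitian e (x *s c + y *s d) = cnj x * hermitian e c + cnj y * hermitian e d"
    "hermitian (x *s c) e = x * hermitian c e" "hermitian e (x *s c) = cnj x * hermitian e c"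
    for c d e :: "complex ^ 'n" and x y
    by (simp_all add: hermitian_def sum.distrib sum_distrib_left algebra_simps)
  have "complex_of_real ((norm s)^6) = (s * cnj s)^3"
    by (simp add: complex_norm_square[symmetric] flip: power_mult)
  then have "complex_of_real (gram_defect (s *s a) (s\<^sup>2 *s b + t *s a)) = of_real ((norm s)^6 * gram_defect a b)"
    unfolding of_real_mult gram_defect_complex by (simp add: lin power2_eq_square power3_eq_cube algebra_simps)
  then show ?thesis by (simp only: of_real_eq_iff)
qed

text \<open>The direction along which \<open>partial i\<close> differentiates; for holomorphic
  \<open>g\<close> the partial derivative is \<open>unit_dir i * deriv g z\<close>.\<close>

definition unit_dir :: "2 \<Rightarrow> complex" where
  "unit_dir i = (if i = 1 then 1 else \<i>)"

lemmas has_vector_derivative_Re' = bounded_linear.has_vector_derivative[OF bounded_linear_Re]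
lemmas has_vector_derivative_Im' = bounded_linear.has_vector_derivative[OF bounded_linear_Im]

lemma partial_eqI:
  assumes "((\<lambda>t. h (z + t *\<^sub>R unit_dir i)) has_vector_derivative D) (at 0)"
  shows "partial i h z = D"
  unfolding partial_def using assms by (intro vector_derivative_at) (simp add: unit_dir_def)

lemma line_in_open:
  fixes z :: complex
  assumes "open S" "z \<in> S"
  shows "\<forall>\<^sub>F t in nhds (0::real). z + t *\<^sub>R unit_dir i \<in> S"
proof -
  have "open ((\<lambda>t. z + t *\<^sub>R unit_dir i) -` S)"
    using assms(1) by (intro open_vimage continuous_intros)
  then show ?thesis using assms(2) eventually_nhds_in_open[of "(\<lambda>t. z + t *\<^sub>R unit_dir i) -` S" 0] by simp
qed

lemma partial_eqI_open:
  assumes S: "open S" "z \<in> S" and eq: "\<And>w. w \<in> S \<Longrightarrow> h w = g w"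
    and D: "((\<lambda>t. g (z + t *\<^sub>R unit_dir i)) has_vector_derivative D) (at 0)"
  shows "partial i h z = D"
proof (rule partial_eqI)
  have "\<forall>\<^sub>F t in nhds 0. g (z + t *\<^sub>R unit_dir i) = h (z + t *\<^sub>R unit_dir i)"
    using line_in_open[OF S, of i] by eventually_elim (simp add: eq)
  then show "((\<lambda>t. h (z + t *\<^sub>R unit_dir i)) has_vector_derivative D) (at 0)"
    using has_vector_derivative_cong_ev[where x = 0 and S = UNIV and f = "\<lambda>t. g (z + t *\<^sub>R unit_dir i)"
        and g = "\<lambda>t. h (z + t *\<^sub>R unit_dir i)" and f' = D]
      D eq[OF S(2)] by simp
qed

lemma holomorphic_line_derivative:
  assumes "g holomorphic_on S" "open S" "z \<in> S"
  shows "((\<lambda>t. g (z + t *\<^sub>R unit_dir i)) has_vector_derivative (unit_dir i * deriv g z)) (at 0)"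
proof -
  have "((\<lambda>t::real. z + t *\<^sub>R unit_dir i) has_vector_derivative unit_dir i) (at 0)"
    by (auto intro!: derivative_eq_intros)
  moreover have "(g has_field_derivative deriv g z) (at (z + 0 *\<^sub>R unit_dir i))"
    using assms by (auto intro: holomorphic_derivI)
  ultimately show ?thesis
    using field_vector_diff_chain_at[of "\<lambda>t. z + t *\<^sub>R unit_dir i" "unit_dir i" 0 g "deriv g z"]
    by (simp add: o_def)
qed

lemma has_vector_derivative_vecI:
  fixes f :: "real \<Rightarrow> complex ^ 3"
  assumes "\<And>j. ((\<lambda>t. f t $ j) has_vector_derivative D $ j) (at t)"
  shows "(f has_vector_derivative D) (at t)"
  unfolding has_vector_derivative_def has_derivative_componentwise_within[of f]
proof
  fix b :: "complex ^ 3" assume "b \<in> Basis"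
  then obtain j c where b: "b = axis j c" by (auto simp: Basis_vec_def)
  have "((\<lambda>t. f t $ j \<bullet> c) has_derivative (\<lambda>x. (x *\<^sub>R D $ j) \<bullet> c)) (at t)"
    using assms[of j] unfolding has_vector_derivative_def by (rule has_derivative_inner_left)
  then show "((\<lambda>x. f x \<bullet> b) has_derivative (\<lambda>x. (x *\<^sub>R D) \<bullet> b)) (at t)"
    by (simp add: b inner_axis)
qed

lemma matrix_inv_eqI:
  assumes "A ** B = mat 1" "B ** A = mat 1"
  shows "matrix_inv A = B"
proof -
  have "A ** matrix_inv A = mat 1 \<and> matrix_inv A ** A = mat 1"
    unfolding matrix_inv_def by (rule someI[of _ B]) (use assms in auto)
  then show ?thesis by (metis assms(2) matrix_mul_assoc matrix_mul_lid matrix_mul_rid)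
qed

section \<open>Curvature of the conformal metric of a holomorphic immersion\<close>

locale holomorphic_immersion =
  fixes f :: "complex \<Rightarrow> complex ^ 3" and S :: "complex set"
  assumes S: "open S" and hol: "\<And>j. (\<lambda>w. f w $ j) holomorphic_on S"
    and imm: "\<And>z. z \<in> S \<Longrightarrow> velocity f z \<noteq> 0"
begin

abbreviation "E z \<equiv> (norm (velocity f z))\<^sup>2"
abbreviation "N z \<equiv> hermitian (acceleration f z) (velocity f z)"

lemma E_pos: "z \<in> S \<Longrightarrow> 0 < E z"
  using imm by simp

lemma partial_f: "z \<in> S \<Longrightarrow> partial i f z = unit_dir i *s velocity f z"
  by (intro partial_eqI has_vector_derivative_vecI)
    (auto simp: velocity_def intro!: holomorphic_line_derivative[OF hol S])

text \<open>The coordinate vectors are \<open>f'\<close> and \<open>\<i> f'\<close>, which are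
  orthogonal and of equal length in the real inner product.\<close>

lemma induced_metric_eq:
  assumes "z \<in> S"
  shows "induced_metric f z = (\<chi> i j. if i = j then E z else 0)"
proof -
  have Ez: "E z = (\<Sum>j\<in>UNIV. Re (velocity f z $ j) * Re (velocity f z $ j) + Im (velocity f z $ j) * Im (velocity f z $ j))"
    unfolding norm_vec_sqr cmod_power2 by (simp add: power2_eq_square)
  have "(unit_dir i *s velocity f z) \<bullet> (unit_dir j *s velocity f z) = (if i = j then E z else 0)" for i j
    using exhaust_2[of i] exhaust_2[of j]
    unfolding Ez by (auto simp: unit_dir_def inner_vec_def inner_complex_def sum.distrib sum_negf mult.commute)
  then show ?thesis unfolding induced_metric_def partial_f[OF assms] by simp
qed

lemma det_induced_metric: "z \<in> S \<Longrightarrow> det (induced_metric f z) = (E z)\<^sup>2"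
  by (simp add: induced_metric_eq det_2 power2_eq_square)

lemma matrix_inv_metric:
  assumes "z \<in> S"
  shows "matrix_inv (induced_metric f z) = (\<chi> i j. if i = j then 1 / E z else 0)"
  unfolding induced_metric_eq[OF assms]
  by (rule matrix_inv_eqI; use E_pos[OF assms] in \<open>simp add: matrix_matrix_mult_def mat_def vec_eq_iff forall_2 sum_2\<close>)

lemma velocity_line:
  assumes "z \<in> S"
  shows "((\<lambda>t. velocity f (z + t *\<^sub>R unit_dir i) $ j) has_vector_derivative unit_dir i * acceleration f z $ j) (at 0)"
  using holomorphic_line_derivative[OF holomorphic_deriv[OF hol S] S assms, of j i]
  by (simp add: velocity_def acceleration_def)

text \<open>The third derivative enters through the derivative of \<open>N\<close>; it cancels in
  the curvature.\<close>

definition jerk :: "complex \<Rightarrow> complex ^ 3" where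
  "jerk z = (\<chi> j. deriv (deriv (deriv (\<lambda>w. f w $ j))) z)"

lemma acceleration_line:
  assumes "z \<in> S"
  shows "((\<lambda>t. acceleration f (z + t *\<^sub>R unit_dir i) $ j) has_vector_derivative unit_dir i * jerk z $ j) (at 0)"
  using holomorphic_line_derivative[OF holomorphic_deriv[OF holomorphic_deriv[OF hol S] S] S assms, of j i]
  by (simp add: jerk_def acceleration_def)

lemma E_line:
  assumes "z \<in> S"
  shows "((\<lambda>t. complex_of_real (E (z + t *\<^sub>R unit_dir i))) has_vector_derivative of_real (2 * Re (unit_dir i * N z))) (at 0)"
proof -
  have "((\<lambda>t. hermitian (velocity f (z + t *\<^sub>R unit_dir i)) (velocity f (z + t *\<^sub>R unit_dir i))) has_vector_derivative
     (\<Sum>j\<in>UNIV. velocity f (z + 0 *\<^sub>R unit_dir i) $ j * cnj (unit_dir i * acceleration f z $ j) +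
        (unit_dir i * acceleration f z $ j) * cnj (velocity f (z + 0 *\<^sub>R unit_dir i) $ j))) (at 0)"
    unfolding hermitian_def
    by (intro has_vector_derivative_sum has_vector_derivative_mult has_vector_derivative_cnj velocity_line[OF assms])
  also have "(\<Sum>j\<in>UNIV. velocity f (z + 0 *\<^sub>R unit_dir i) $ j * cnj (unit_dir i * acceleration f z $ j) +
        (unit_dir i * acceleration f z $ j) * cnj (velocity f (z + 0 *\<^sub>R unit_dir i) $ j))
      = cnj (unit_dir i * N z) + unit_dir i * N z"
    by (simp add: hermitian_def sum.distrib sum_distrib_left cnj_sum algebra_simps)
  also have "\<dots> = of_real (2 * Re (unit_dir i * N z))" by (simp add: complex_eq_iff)
  finally show ?thesis by (simp only: hermitian_self)
qed

lemma E_line_real: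
  assumes "z \<in> S"
  shows "((\<lambda>t. E (z + t *\<^sub>R unit_dir i)) has_vector_derivative (2 * Re (unit_dir i * N z))) (at 0)"
  using has_vector_derivative_Re'[OF E_line[OF assms, of i]] by simp

lemma N_line:
  assumes "z \<in> S"
  shows "((\<lambda>t. N (z + t *\<^sub>R unit_dir i)) has_vector_derivative
     (unit_dir i * hermitian (jerk z) (velocity f z) + cnj (unit_dir i) * of_real ((norm (acceleration f z))\<^sup>2))) (at 0)"
proof -
  have "((\<lambda>t. N (z + t *\<^sub>R unit_dir i)) has_vector_derivative
     (\<Sum>j\<in>UNIV. acceleration f (z + 0 *\<^sub>R unit_dir i) $ j * cnj (unit_dir i * acceleration f z $ j) +
        (unit_dir i * jerk z $ j) * cnj (velocity f (z + 0 *\<^sub>R unit_dir i) $ j))) (at 0)"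
    unfolding hermitian_def
    by (intro has_vector_derivative_sum has_vector_derivative_mult has_vector_derivative_cnj velocity_line[OF assms] acceleration_line[OF assms])
  also have "(\<Sum>j\<in>UNIV. acceleration f (z + 0 *\<^sub>R unit_dir i) $ j * cnj (unit_dir i * acceleration f z $ j) +
        (unit_dir i * jerk z $ j) * cnj (velocity f (z + 0 *\<^sub>R unit_dir i) $ j)) =
     unit_dir i * hermitian (jerk z) (velocity f z) + cnj (unit_dir i) * hermitian (acceleration f z) (acceleration f z)"
    by (simp add: hermitian_def sum.distrib sum_distrib_left algebra_simps)
  finally show ?thesis by (simp only: hermitian_self)
qed

text \<open>The complex derivative of \<open>log E\<close> with respect to the coordinate. For a
  conformal metric every Christoffel symbol is, up to sign, its real or imaginary part.\<close>

definition L :: "complex \<Rightarrow> complex" where "L z = N z / of_real (E z)"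

lemma L_line:
  assumes "z \<in> S"
  shows "((\<lambda>t. L (z + t *\<^sub>R unit_dir i)) has_vector_derivative
     ((unit_dir i * hermitian (jerk z) (velocity f z) + cnj (unit_dir i) * of_real ((norm (acceleration f z))\<^sup>2)) / of_real (E z)
       - N z * of_real (2 * Re (unit_dir i * N z)) / of_real (E z)^2)) (at 0)"
proof -
  have E0: "E (z + 0 *\<^sub>R unit_dir i) \<noteq> 0" "E z \<noteq> 0" using E_pos[OF assms] by auto
  have "((\<lambda>t. inverse (E (z + t *\<^sub>R unit_dir i))) has_vector_derivative
      - (2 * Re (unit_dir i * N z)) / (E z)\<^sup>2) (at 0)"
    using DERIV_inverse_fun[OF E_line_real[OF assms, of i, folded has_real_derivative_iff_has_vector_derivative] E0(1)]
    unfolding has_real_derivative_iff_has_vector_derivative[symmetric]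
    by (rule DERIV_cong) (use E0 in \<open>simp add: field_simps power2_eq_square\<close>)
  note * = has_vector_derivative_mult[OF N_line[OF assms] has_vector_derivative_of_real[OF this[folded has_real_derivative_iff_has_vector_derivative]]]
  have "(\<lambda>t. L (z + t *\<^sub>R unit_dir i)) = (\<lambda>t. N (z + t *\<^sub>R unit_dir i) * of_real (inverse (E (z + t *\<^sub>R unit_dir i))))"
    by (simp add: L_def fun_eq_iff divide_inverse)
  then show ?thesis
    using * by (rule_tac has_vector_derivative_eq_rhs) (use E0 in \<open>auto simp: field_simps\<close>)
qed

lemma partial_metric:
  assumes "z \<in> S"
  shows "partial i (\<lambda>w. induced_metric f w $ j $ l) z = (if j = l then 2 * Re (unit_dir i * N z) else 0)"
proof (rule partial_eqI_open[OF S assms, of _ "\<lambda>w. if j = l then E w else 0"])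
  show "((\<lambda>t. if j = l then E (z + t *\<^sub>R unit_dir i) else 0) has_vector_derivative (if j = l then 2 * Re (unit_dir i * N z) else 0)) (at 0)"
    using E_line_real[OF assms] by simp
qed (simp add: induced_metric_eq)

lemma christoffel_eq:
  assumes "z \<in> S"
  shows "christoffel (induced_metric f) 1 1 1 z = Re (L z)" "christoffel (induced_metric f) 1 1 2 z = - Im (L z)"
    "christoffel (induced_metric f) 1 2 1 z = - Im (L z)" "christoffel (induced_metric f) 1 2 2 z = - Re (L z)"
    "christoffel (induced_metric f) 2 1 1 z = Im (L z)" "christoffel (induced_metric f) 2 1 2 z = Re (L z)"
    "christoffel (induced_metric f) 2 2 1 z = Re (L z)" "christoffel (induced_metric f) 2 2 2 z = - Im (L z)"
  using E_pos[OF assms]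
  by (simp_all add: christoffel_def matrix_inv_metric[OF assms] partial_metric[OF assms] sum_2 unit_dir_def L_def
      Re_divide_of_real Im_divide_of_real)

lemma gauss_curvature_eq:
  assumes z: "z \<in> S"
  shows "gauss_curvature (induced_metric f) z = - 2 * gram_defect (velocity f z) (acceleration f z) / (E z)^3"
proof -
  let ?D = "\<lambda>i. (unit_dir i * hermitian (jerk z) (velocity f z) + cnj (unit_dir i) * of_real ((norm (acceleration f z))\<^sup>2)) / of_real (E z)
       - N z * of_real (2 * Re (unit_dir i * N z)) / of_real (E z)^2"
  note Rl = has_vector_derivative_Re'[OF L_line[OF z]] and Il = has_vector_derivative_Im'[OF L_line[OF z]]
  have p1: "partial 1 (christoffel (induced_metric f) 1 2 2) z = - Re (?D 1)"
    by (rule partial_eqI_open[OF S z, of _ "\<lambda>w. - Re (L w)"])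
      (auto simp only: christoffel_eq intro!: has_vector_derivative_minus Rl)
  have p2: "partial 2 (christoffel (induced_metric f) 1 1 2) z = - Im (?D 2)"
    by (rule partial_eqI_open[OF S z, of _ "\<lambda>w. - Im (L w)"])
      (auto simp only: christoffel_eq intro!: has_vector_derivative_minus Il)
  have E0: "E z > 0" using E_pos[OF z] .
  \<comment> \<open>The products of Christoffel symbols cancel, and so do the two
    \<open>jerk\<close> terms; what remains is minus half the Laplacian of
    \<open>log E\<close>.\<close>
  have "curvature_tensor (induced_metric f) 1 2 1 2 z = Im (?D 2) - Re (?D 1)"
    by (simp add: curvature_tensor_def p1 p2 christoffel_eq[OF z] sum_2)
  also have "\<dots> = - 2 * (norm (acceleration f z))\<^sup>2 / E z + 2 * (norm (N z))\<^sup>2 / (E z)\<^sup>2"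
    using E0 by (simp add: unit_dir_def Re_divide_of_real Im_divide_of_real cmod_power2 flip: of_real_power)
      (simp add: field_simps power2_eq_square)
  also have "\<dots> = - 2 * gram_defect (velocity f z) (acceleration f z) / (E z)\<^sup>2"
  proof -
    have "- 2 * F / e + 2 * n / e\<^sup>2 = - 2 * (e * F - n) / e\<^sup>2" if "0 < e" for e F n :: real
      using that by (simp add: field_simps power2_eq_square)
    from this[OF E0] show ?thesis unfolding gram_defect_def .
  qed
  finally have c: "curvature_tensor (induced_metric f) 1 2 1 2 z = \<dots>" .
  have "gauss_curvature (induced_metric f) z = E z * curvature_tensor (induced_metric f) 1 2 1 2 z / (E z)\<^sup>2"
    by (simp add: gauss_curvature_def sum_2 det_induced_metric[OF z, unfolded induced_metric_eq[OF z]] induced_metric_eq[OF z])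
  then show ?thesis using E0 unfolding c by (simp add: field_simps power2_eq_square power3_eq_cube)
qed

end


context holomorphic_immersion
begin

lemma continuous_velocity: "continuous_on S (\<lambda>z. velocity f z $ j)"
  using holomorphic_deriv[OF hol S] by (simp add: velocity_def holomorphic_on_imp_continuous_on)

lemma continuous_acceleration: "continuous_on S (\<lambda>z. acceleration f z $ j)"
  using holomorphic_deriv[OF holomorphic_deriv[OF hol S] S] by (simp add: acceleration_def holomorphic_on_imp_continuous_on)

lemma continuous_E: "continuous_on S E"
  unfolding norm_vec_sqr by (intro continuous_intros continuous_velocity)

lemma continuous_gauss_curvature: "continuous_on S (gauss_curvature (induced_metric f))"
proof -
  have "continuous_on S (\<lambda>z. - 2 * gram_defect (velocity f z) (acceleration f z) / (E z)^3)"
    unfolding gram_defect_def norm_vec_sqr hermitian_def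
    using E_pos[unfolded norm_vec_sqr]
    by (intro continuous_intros continuous_velocity continuous_acceleration) fastforce
  then show ?thesis by (rule continuous_on_cong[THEN iffD1, rotated -1]) (simp_all add: gauss_curvature_eq)
qed

text \<open>The left side is the density of \<open>|K| dA\<close> in the coordinate. The bound
  results from dropping the subtracted square in \<open>gram_defect\<close>.\<close>

lemma gauss_curvature_bound:
  assumes z: "z \<in> S"
  shows "\<bar>gauss_curvature (induced_metric f) z\<bar> * E z \<le> 2 * (norm (acceleration f z))\<^sup>2 / E z"
proof -
  have "gram_defect (velocity f z) (acceleration f z) \<le> E z * (norm (acceleration f z))\<^sup>2"
    "0 \<le> gram_defect (velocity f z) (acceleration f z)"
    using gram_defect_bounds by auto
  then have "2 * gram_defect (velocity f z) (acceleration f z) / (E z)^3 * E z \<le> 2 * (E z * (norm (acceleration f z))\<^sup>2) / (E z)^3 * E z"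
    using E_pos[OF z] by (intro mult_right_mono divide_right_mono) auto
  also have "\<dots> = 2 * (norm (acceleration f z))\<^sup>2 / E z"
    using E_pos[OF z] by (simp add: field_simps power3_eq_cube)
  finally show ?thesis
    using gram_defect_bounds(1)[of "velocity f z" "acceleration f z"]
    unfolding gauss_curvature_eq[OF z] by (simp add: abs_mult)
qed

end

section \<open>Behaviour under a change of coordinate\<close>

lemma velocity_acceleration_comp:
  fixes f g :: "complex \<Rightarrow> complex ^ 3"
  assumes S: "open S" "z \<in> S" and T: "T holomorphic_on S" "T ` S \<subseteq> S'"
    and g: "open S'" "\<And>j. (\<lambda>w. g w $ j) holomorphic_on S'"
    and eq: "\<And>w. w \<in> S \<Longrightarrow> f w = g (T w)"
  shows "velocity f z = deriv T z *s velocity g (T z)"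
    "acceleration f z = (deriv T z)\<^sup>2 *s acceleration g (T z) + deriv (deriv T) z *s velocity g (T z)"
proof -
  have 1: "deriv (\<lambda>w. f w $ j) w = deriv T w * deriv (\<lambda>w. g w $ j) (T w)" if w: "w \<in> S" for w j
  proof -
    have "((\<lambda>w. g w $ j) has_field_derivative deriv (\<lambda>w. g w $ j) (T w)) (at (T w))"
      using g T w by (intro holomorphic_derivI[of _ S']) auto
    then have "((\<lambda>w. g (T w) $ j) has_field_derivative deriv (\<lambda>w. g w $ j) (T w) * deriv T w) (at w)"
      using T S w by (intro DERIV_chain2[of "\<lambda>w. g w $ j" _ T] holomorphic_derivI[of T S]) auto
    then have "((\<lambda>w. f w $ j) has_field_derivative deriv (\<lambda>w. g w $ j) (T w) * deriv T w) (at w)"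
      by (rule has_field_derivative_transform_within_open[of _ _ _ S]) (use S w eq in auto)
    then show ?thesis by (simp add: DERIV_imp_deriv mult.commute)
  qed
  then show "velocity f z = deriv T z *s velocity g (T z)"
    using S by (simp add: velocity_def vec_eq_iff)
  have 2: "deriv (deriv (\<lambda>w. f w $ j)) z = deriv (deriv T) z * deriv (\<lambda>w. g w $ j) (T z) +
      deriv T z * (deriv (deriv (\<lambda>w. g w $ j)) (T z) * deriv T z)" for j
  proof -
    have "(deriv (\<lambda>w. g w $ j) has_field_derivative deriv (deriv (\<lambda>w. g w $ j)) (T z)) (at (T z))"
      using g T S holomorphic_deriv[OF g(2,1)] by (intro holomorphic_derivI[of _ S']) auto
    then have "((\<lambda>w. deriv (\<lambda>w. g w $ j) (T w)) has_field_derivative deriv (deriv (\<lambda>w. g w $ j)) (T z) * deriv T z) (at z)"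
      using T S by (intro DERIV_chain2[of "deriv (\<lambda>w. g w $ j)" _ T] holomorphic_derivI[of T S]) auto
    moreover have "(deriv T has_field_derivative deriv (deriv T) z) (at z)"
      using S holomorphic_deriv[OF T(1) S(1)] by (intro holomorphic_derivI[of _ S]) auto
    ultimately have "((\<lambda>w. deriv T w * deriv (\<lambda>w. g w $ j) (T w)) has_field_derivative
      (deriv (deriv T) z * deriv (\<lambda>w. g w $ j) (T z) +
      deriv T z * (deriv (deriv (\<lambda>w. g w $ j)) (T z) * deriv T z))) (at z)"
      by (auto intro!: derivative_eq_intros)
    then have "(deriv (\<lambda>w. f w $ j) has_field_derivative
      (deriv (deriv T) z * deriv (\<lambda>w. g w $ j) (T z) +
      deriv T z * (deriv (deriv (\<lambda>w. g w $ j)) (T z) * deriv T z))) (at z)"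
      by (rule has_field_derivative_transform_within_open[of _ _ _ S]) (use S 1 in auto)
    then show ?thesis by (simp add: DERIV_imp_deriv)
  qed
  show "acceleration f z = (deriv T z)\<^sup>2 *s acceleration g (T z) + deriv (deriv T) z *s velocity g (T z)"
    using 2 by (simp add: acceleration_def velocity_def vec_eq_iff power2_eq_square)
qed

lemma norm_smult_complex_vec: "norm (c *s (a :: complex ^ 'n)) = norm c * norm a"
proof -
  have "(norm (c *s a))\<^sup>2 = (norm c * norm a)\<^sup>2"
    unfolding power_mult_distrib norm_vec_sqr by (simp add: norm_mult power_mult_distrib sum_distrib_left)
  then show ?thesis by (simp add: power2_eq_iff_nonneg)
qed

text \<open>The Gram determinant and the cube of the conformal factor both scale by the sixth power
  of \<open>norm (deriv T z)\<close>, so their quotient is invariant.\<close>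

lemma gauss_curvature_reparam:
  fixes f g :: "complex \<Rightarrow> complex ^ 3"
  assumes "open S" "z \<in> S" "T holomorphic_on S" "T ` S \<subseteq> S'" "open S'"
    and "\<And>j. (\<lambda>w. g w $ j) holomorphic_on S'"
    and eq: "\<And>w. w \<in> S \<Longrightarrow> f w = g (T w)"
    and f: "holomorphic_immersion f S" and g: "holomorphic_immersion g S'"
  shows "(norm (velocity f z))\<^sup>2 = (norm (deriv T z))\<^sup>2 * (norm (velocity g (T z)))\<^sup>2"
    "gauss_curvature (induced_metric f) z = gauss_curvature (induced_metric g) (T z)"
proof -
  have va: "velocity f z = deriv T z *s velocity g (T z)"
    "acceleration f z = (deriv T z)\<^sup>2 *s acceleration g (T z) + deriv (deriv T) z *s velocity g (T z)"
    using velocity_acceleration_comp[of S z T S' g f] assms by blast+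
  show E: "(norm (velocity f z))\<^sup>2 = (norm (deriv T z))\<^sup>2 * (norm (velocity g (T z)))\<^sup>2"
    by (simp add: va norm_smult_complex_vec power_mult_distrib)
  have nz: "deriv T z \<noteq> 0"
    using holomorphic_immersion.imm[OF f assms(2)] va(1) by auto
  have Tz: "T z \<in> S'" using assms by auto
  have "gram_defect (velocity f z) (acceleration f z) = (norm (deriv T z))^6 * gram_defect (velocity g (T z)) (acceleration g (T z))"
    unfolding va by (rule gram_defect_reparam)
  then show "gauss_curvature (induced_metric f) z = gauss_curvature (induced_metric g) (T z)"
    using nz unfolding holomorphic_immersion.gauss_curvature_eq[OF f assms(2)]
      holomorphic_immersion.gauss_curvature_eq[OF g Tz] E
    by (simp add: power_mult_distrib flip: power_mult)
qed

section \<open>Holomorphic functions on a surface\<close>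

definition holomorphic_fun :: "'a chart set \<Rightarrow> ('a \<Rightarrow> complex) \<Rightarrow> bool" where
  "holomorphic_fun A f \<longleftrightarrow> (\<forall>c\<in>A. in_chart f c holomorphic_on snd c ` fst c)"

definition chart_deriv :: "('a \<Rightarrow> complex) \<Rightarrow> 'a chart \<Rightarrow> 'a \<Rightarrow> complex" where
  "chart_deriv f c p = deriv (in_chart f c) (snd c p)"

text \<open>Transition maps are biholomorphic, so one chart decides. With the existential form the
  negation gives a vanishing derivative in every chart at once.\<close>

definition regular_at :: "'a chart set \<Rightarrow> ('a \<Rightarrow> complex) \<Rightarrow> 'a \<Rightarrow> bool" where
  "regular_at A f p \<longleftrightarrow> (\<exists>c\<in>A. p \<in> fst c \<and> chart_deriv f c p \<noteq> 0)"

locale surface =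
  fixes X :: "'a topology" and A :: "'a chart set"
  assumes atlas: "holomorphic_atlas X A" and hausdorff: "Hausdorff_space X"
begin

lemma chart:
  assumes "c \<in> A"
  shows "openin X (fst c)" "open (snd c ` fst c)"
    "homeomorphic_map (subtopology X (fst c)) (top_of_set (snd c ` fst c)) (snd c)"
  using assms atlas by (auto simp: holomorphic_atlas_def complex_chart_def)

lemma chart_subset: "c \<in> A \<Longrightarrow> fst c \<subseteq> topspace X"
  using chart(1) openin_subset by blast

lemma topspace_charts: "topspace X = (\<Union>c\<in>A. fst c)"
  using atlas by (simp add: holomorphic_atlas_def case_prod_unfold)

lemma chart_at: "p \<in> topspace X \<Longrightarrow> \<exists>c\<in>A. p \<in> fst c"
  by (simp add: topspace_charts)

lemma chart_inj: "c \<in> A \<Longrightarrow> inj_on (snd c) (fst c)"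
  using homeomorphic_imp_injective_map[OF chart(3)[of c]] chart_subset[of c]
  by (simp add: Int_absorb1)

lemma chart_inverse: "c \<in> A \<Longrightarrow> p \<in> fst c \<Longrightarrow> inv_into (fst c) (snd c) (snd c p) = p"
  by (rule inv_into_f_f[OF chart_inj])

lemma inverse_chart: "z \<in> snd c ` fst c \<Longrightarrow> inv_into (fst c) (snd c) z \<in> fst c \<and> snd c (inv_into (fst c) (snd c) z) = z"
  by (simp add: inv_into_into f_inv_into_f)

lemma in_chart_apply: "c \<in> A \<Longrightarrow> p \<in> fst c \<Longrightarrow> in_chart f c (snd c p) = f p"
  by (simp add: in_chart_def chart_inverse)

lemma open_chart_image:
  assumes "c \<in> A" "openin X V" "V \<subseteq> fst c"
  shows "open (snd c ` V)"
proof -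
  have "openin (subtopology X (fst c)) V" using assms by (metis inf.absorb2 inf_commute openin_subtopology_Int)
  then have "openin (top_of_set (snd c ` fst c)) (snd c ` V)"
    using homeomorphic_imp_open_map[OF chart(3)[OF assms(1)]] by (simp add: open_map_def)
  then show ?thesis using chart(2)[OF assms(1)] openin_open_trans by blast
qed

lemma openin_chart_preimage:
  assumes "c \<in> A" "open Q"
  shows "openin X {p \<in> fst c. snd c p \<in> Q}"
proof -
  have "continuous_map (subtopology X (fst c)) (top_of_set (snd c ` fst c)) (snd c)"
    using homeomorphic_imp_continuous_map chart(3)[OF assms(1)] by blast
  then have "openin (subtopology X (fst c)) {p \<in> topspace (subtopology X (fst c)). snd c p \<in> Q \<inter> snd c ` fst c}"
    by (rule openin_continuous_map_preimage) (use assms(2) in \<open>auto simp: openin_open\<close>)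
  also have "{p \<in> topspace (subtopology X (fst c)). snd c p \<in> Q \<inter> snd c ` fst c} = {p \<in> fst c. snd c p \<in> Q}"
    using chart_subset[OF assms(1)] by auto
  finally show ?thesis using chart(1)[OF assms(1)] openin_trans_full by blast
qed

lemma inverse_chart_image:
  assumes "c \<in> A" "Q \<subseteq> snd c ` fst c"
  shows "inv_into (fst c) (snd c) ` Q = {p \<in> fst c. snd c p \<in> Q}"
proof (intro equalityI subsetI)
  fix p assume "p \<in> inv_into (fst c) (snd c) ` Q"
  then obtain z where "z \<in> Q" "p = inv_into (fst c) (snd c) z" by blast
  then show "p \<in> {p \<in> fst c. snd c p \<in> Q}" using assms(2) inverse_chart[of z c] by auto
next
  fix p assume "p \<in> {p \<in> fst c. snd c p \<in> Q}"
  then show "p \<in> inv_into (fst c) (snd c) ` Q"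
    using chart_inverse[OF assms(1), of p] by (metis (lifting) imageI mem_Collect_eq)
qed

lemma openin_inverse_chart_image:
  assumes "c \<in> A" "open Q" "Q \<subseteq> snd c ` fst c"
  shows "openin X (inv_into (fst c) (snd c) ` Q)"
  unfolding inverse_chart_image[OF assms(1,3)] by (rule openin_chart_preimage[OF assms(1,2)])

lemma holomorphic_fun_continuous:
  assumes f: "holomorphic_fun A f"
  shows "continuous_map X euclidean f"
  unfolding continuous_map_def
proof (intro conjI allI impI)
  fix Q :: "complex set" assume "openin euclidean Q"
  then have Q: "open Q" by simp
  show "openin X {x \<in> topspace X. f x \<in> Q}"
  proof (subst openin_subopen, intro ballI)
    fix p assume p: "p \<in> {x \<in> topspace X. f x \<in> Q}"
    then obtain c where c: "c \<in> A" "p \<in> fst c" using chart_at by blast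
    have "continuous_on (snd c ` fst c) (in_chart f c)"
      using f c by (auto simp: holomorphic_fun_def intro: holomorphic_on_imp_continuous_on)
    then have "open (snd c ` fst c \<inter> in_chart f c -` Q)"
      using Q chart(2)[OF c(1)] by (simp add: continuous_on_open_vimage Int_commute)
    then have "openin X {q \<in> fst c. snd c q \<in> snd c ` fst c \<inter> in_chart f c -` Q}"
      by (rule openin_chart_preimage[OF c(1)])
    moreover have "{q \<in> fst c. snd c q \<in> snd c ` fst c \<inter> in_chart f c -` Q} = {q \<in> fst c. f q \<in> Q}"
      using in_chart_apply[OF c(1), of _ f] by fastforce
    ultimately show "\<exists>T. openin X T \<and> p \<in> T \<and> T \<subseteq> {x \<in> topspace X. f x \<in> Q}"
      using c p chart_subset[OF c(1)] by (intro exI[of _ "{q \<in> fst c. f q \<in> Q}"]) auto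
  qed
qed auto

lemma openin_holomorphic_preimage:
  "holomorphic_fun A f \<Longrightarrow> open Q \<Longrightarrow> openin X {p \<in> topspace X. f p \<in> Q}"
  using openin_continuous_map_preimage[OF holomorphic_fun_continuous] by auto

lemma chart_disc:
  assumes c: "c \<in> A" "p \<in> fst c" and Q: "openin X Q" "p \<in> Q"
  obtains r where "0 < r" "ball (snd c p) r \<subseteq> snd c ` (Q \<inter> fst c)"
    "openin X (inv_into (fst c) (snd c) ` ball (snd c p) r)"
    "inv_into (fst c) (snd c) ` ball (snd c p) r \<subseteq> Q \<inter> fst c"
    "p \<in> inv_into (fst c) (snd c) ` ball (snd c p) r"
proof -
  have "open (snd c ` (Q \<inter> fst c))" using Q chart(1)[OF c(1)] by (intro open_chart_image c) auto
  then obtain r where r: "0 < r" "ball (snd c p) r \<subseteq> snd c ` (Q \<inter> fst c)"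
    using c Q by (metis IntI imageI open_contains_ball)
  have sub: "ball (snd c p) r \<subseteq> snd c ` fst c" using r by auto
  show thesis
  proof (rule that[OF r openin_inverse_chart_image[OF c(1) open_ball sub]])
    show "inv_into (fst c) (snd c) ` ball (snd c p) r \<subseteq> Q \<inter> fst c"
      using r chart_inverse[OF c(1)] by (fastforce simp: image_iff)
    show "p \<in> inv_into (fst c) (snd c) ` ball (snd c p) r"
      unfolding inverse_chart_image[OF c(1) sub] using c r by simp
  qed
qed

text \<open>The inverse function theorem: near a regular point \<open>G\<close> is a coordinate, and
  composing with its inverse \<open>\<sigma>\<close> reads every other holomorphic function in that
  coordinate.\<close>

lemma local_section:
  assumes G: "holomorphic_fun A G" and reg: "regular_at A G p" and Q: "openin X Q" "p \<in> Q"
  obtains r \<sigma> V where "0 < r" "openin X V" "p \<in> V" "V \<subseteq> Q" "\<sigma> ` ball (G p) r = V" "\<sigma> (G p) = p"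
    "\<And>w. w \<in> ball (G p) r \<Longrightarrow> G (\<sigma> w) = w" "\<And>q. q \<in> V \<Longrightarrow> G q \<in> ball (G p) r \<and> \<sigma> (G q) = q"
    "\<And>q. q \<in> V \<Longrightarrow> regular_at A G q"
    "\<And>f. holomorphic_fun A f \<Longrightarrow> (\<lambda>w. f (\<sigma> w)) holomorphic_on ball (G p) r"
proof -
  obtain c where c: "c \<in> A" "p \<in> fst c" "chart_deriv G c p \<noteq> 0"
    using reg by (auto simp: regular_at_def)
  define \<psi> where "\<psi> = inv_into (fst c) (snd c)"
  define g where "g = in_chart G c"
  obtain r0 where r0: "0 < r0" "ball (snd c p) r0 \<subseteq> snd c ` (Q \<inter> fst c)"
    using chart_disc[OF c(1,2) Q] by metis
  have holg: "g holomorphic_on snd c ` fst c" using G c by (simp add: holomorphic_fun_def g_def)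
  have "ball (snd c p) r0 \<subseteq> snd c ` fst c" using r0 by auto
  with holg have "g holomorphic_on ball (snd c p) r0" by (rule holomorphic_on_subset)
  then obtain r1 where r1: "0 < r1" "ball (snd c p) r1 \<subseteq> ball (snd c p) r0"
    "open (g ` ball (snd c p) r1)" "inj_on g (ball (snd c p) r1)"
    using has_complex_derivative_locally_invertible[of g "ball (snd c p) r0" "snd c p"] r0 c
    by (auto simp: chart_deriv_def g_def)
  define D where "D = ball (snd c p) r1"
  have D: "open D" "snd c p \<in> D" "D \<subseteq> snd c ` fst c" "D \<subseteq> snd c ` (Q \<inter> fst c)" "inj_on g D"
    using r0 r1 by (auto simp: D_def)
  have holD: "g holomorphic_on D" using holg D(3) by (rule holomorphic_on_subset)
  obtain k where k: "k holomorphic_on g ` D" "\<And>z. z \<in> D \<Longrightarrow> deriv g z * deriv k (g z) = 1" "\<And>z. z \<in> D \<Longrightarrow> k (g z) = z"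
    using holomorphic_has_inverse[OF holD D(1,5)] by metis
  have gp: "g (snd c p) = G p" using in_chart_apply[OF c(1,2)] by (simp add: g_def)
  obtain r where r: "0 < r" "ball (G p) r \<subseteq> g ` D"
    using r1(3) D(2) gp unfolding D_def by (metis imageI open_contains_ball)
  define B where "B = ball (G p) r"
  have kB: "k w \<in> D" "g (k w) = w" if "w \<in> B" for w
    using r that k by (auto simp: B_def)
  have kim: "k ` B = D \<inter> g -` B" using kB k(3) by (force simp: image_iff)
  have openk: "open (k ` B)"
    unfolding kim using holomorphic_on_imp_continuous_on[OF holD] D(1)
    by (auto simp: B_def intro!: continuous_open_preimage)
  define \<sigma> where "\<sigma> = (\<lambda>w. \<psi> (k w))"
  have ksub: "k ` B \<subseteq> snd c ` fst c" using kB D by auto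
  have \<sigma>im: "\<sigma> ` B = {q \<in> fst c. snd c q \<in> k ` B}"
    using inverse_chart_image[OF c(1) ksub] by (simp add: \<sigma>_def \<psi>_def image_image)
  have G\<sigma>: "G (\<sigma> w) = w" if "w \<in> B" for w
    using kB[OF that] by (simp add: \<sigma>_def \<psi>_def g_def in_chart_def)
  have \<sigma>G: "\<sigma> (G q) = q" if "q \<in> \<sigma> ` B" for q
    using that G\<sigma> by auto
  show thesis
  proof (rule that[of r "\<sigma> ` B" \<sigma>])
    show "openin X (\<sigma> ` B)" unfolding \<sigma>im by (rule openin_chart_preimage[OF c(1) openk])
    have "\<sigma> (G p) = p"
      using k(3)[OF D(2)] gp chart_inverse[OF c(1,2)] by (simp add: \<sigma>_def \<psi>_def)
    then show "\<sigma> (G p) = p" "p \<in> \<sigma> ` B" using r by (auto simp: B_def image_iff) (metis centre_in_ball)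
    show "\<sigma> ` B \<subseteq> Q"
    proof
      fix q assume "q \<in> \<sigma> ` B"
      then have "q \<in> fst c" "snd c q \<in> D" using \<sigma>im kim by auto
      then show "q \<in> Q" using D(4) inj_onD[OF chart_inj[OF c(1)]] by (smt (verit) Int_iff imageE subsetD)
    qed
    show "G q \<in> ball (G p) r \<and> \<sigma> (G q) = q" if "q \<in> \<sigma> ` B" for q
      using that G\<sigma> \<sigma>G by (auto simp: B_def)
    show "regular_at A G q" if "q \<in> \<sigma> ` B" for q
    proof -
      have q: "q \<in> fst c" "snd c q \<in> D" using that \<sigma>im kim by auto
      have "deriv g (snd c q) \<noteq> 0" using k(2)[OF q(2)] by auto
      then show ?thesis using q c by (auto simp: regular_at_def chart_deriv_def g_def)
    qed
    show "(\<lambda>w. f (\<sigma> w)) holomorphic_on ball (G p) r" if "holomorphic_fun A f" for f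
    proof -
      have "(in_chart f c \<circ> k) holomorphic_on B"
        using that c(1) ksub k(1) r
        by (intro holomorphic_on_compose_gen[of k B "in_chart f c" "snd c ` fst c"])
          (auto simp: holomorphic_fun_def B_def intro: holomorphic_on_subset)
      then show ?thesis by (simp add: o_def in_chart_def \<sigma>_def \<psi>_def B_def)
    qed
  qed (use r G\<sigma> in \<open>auto simp: B_def\<close>)
qed

text \<open>Isolation of zeros is applied to both \<open>g - G p\<close> and \<open>deriv g\<close>;
  the latter vanishes identically only if \<open>g\<close> is constant.\<close>

lemma locally_constant_or_isolated:
  assumes G: "holomorphic_fun A G" and p: "p \<in> topspace X"
  obtains (const) V where "openin X V" "p \<in> V" "\<And>q. q \<in> V \<Longrightarrow> G q = G p"
  | (isolated) V where "openin X V" "p \<in> V" "\<And>q. q \<in> V \<Longrightarrow> q \<noteq> p \<Longrightarrow> G q \<noteq> G p \<and> regular_at A G q"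
proof -
  obtain c where c: "c \<in> A" "p \<in> fst c" using chart_at[OF p] by blast
  define \<psi> where "\<psi> = inv_into (fst c) (snd c)"
  define g where "g = in_chart G c"
  obtain r where r: "0 < r" "ball (snd c p) r \<subseteq> snd c ` (fst c \<inter> fst c)" "openin X (\<psi> ` ball (snd c p) r)" "p \<in> \<psi> ` ball (snd c p) r"
    using chart_disc[OF c chart(1)[OF c(1)] c(2)] unfolding \<psi>_def by metis
  define D where "D = ball (snd c p) r"
  have D: "open D" "connected D" "snd c p \<in> D" "D \<subseteq> snd c ` fst c" using r by (auto simp: D_def)
  have hol: "g holomorphic_on D" using G c D by (auto simp: holomorphic_fun_def g_def intro: holomorphic_on_subset)
  have gp: "g (snd c p) = G p" using in_chart_apply[OF c] by (simp add: g_def)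
  have \<psi>D: "\<psi> ` Q = {q \<in> fst c. snd c q \<in> Q}" if "Q \<subseteq> D" for Q
    unfolding \<psi>_def using D that by (intro inverse_chart_image c) auto
  have Gg: "G q = g (snd c q)" if "q \<in> fst c" for q using in_chart_apply[OF c(1) that, of G] by (simp add: g_def)
  show thesis
  proof (cases "g constant_on D")
    case True
    then have "g z = G p" if "z \<in> D" for z using that D(3) gp by (auto simp: constant_on_def)
    then have "G q = G p" if "q \<in> \<psi> ` D" for q using that \<psi>D Gg by auto
    then show thesis using const r by (metis D_def)
  next
    case False
    then obtain \<beta> where \<beta>: "\<beta> \<in> D" "g \<beta> \<noteq> G p" by (auto simp: constant_on_def)
    obtain r1 where r1: "0 < r1" "ball (snd c p) r1 \<subseteq> D" "\<And>z. z \<in> ball (snd c p) r1 - {snd c p} \<Longrightarrow> g z - G p \<noteq> 0"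
    proof (rule isolated_zeros[of "\<lambda>z. g z - G p" D "snd c p" \<beta>])
      show "(\<lambda>z. g z - G p) holomorphic_on D" using hol by (intro holomorphic_intros)
    qed (use D gp \<beta> in simp_all)
    have "\<exists>r2>0. ball (snd c p) r2 \<subseteq> D \<and> (\<forall>z\<in>ball (snd c p) r2 - {snd c p}. deriv g z \<noteq> 0)"
    proof (cases "\<exists>\<gamma>\<in>D. deriv g \<gamma> \<noteq> 0")
      case True
      then obtain \<gamma> where g: "\<gamma> \<in> D" "deriv g \<gamma> \<noteq> 0" by blast
      have hd: "deriv g holomorphic_on D" using hol D by (simp add: holomorphic_deriv)
      show ?thesis
      proof (cases "deriv g (snd c p) = 0")
        case True
        from isolated_zeros[OF hd D(1,2,3) True g] show ?thesis by metis
      next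
        case False
        have "isCont (deriv g) (snd c p)"
          using holomorphic_on_imp_continuous_on[OF hd] D by (simp add: continuous_on_eq_continuous_at)
        then obtain e where "0 < e" "\<And>z. dist (snd c p) z < e \<Longrightarrow> deriv g z \<noteq> 0"
          using continuous_at_avoid[of "snd c p" "deriv g" 0] False by auto
        then show ?thesis using r by (intro exI[of _ "min e r"]) (auto simp: D_def)
      qed
    next
      case False
      then have "(g has_field_derivative 0) (at z within D)" if "z \<in> D" for z
        using holomorphic_derivI[OF hol D(1) that] that by (simp add: has_field_derivative_at_within)
      then obtain k where "\<And>z. z \<in> D \<Longrightarrow> g z = k"
        using has_field_derivative_zero_constant[of D g] by (auto simp: D_def)
      then show ?thesis using \<beta> D(3) gp by force
    qed
    then obtain r2 where r2: "0 < r2" "ball (snd c p) r2 \<subseteq> D" "\<And>z. z \<in> ball (snd c p) r2 - {snd c p} \<Longrightarrow> deriv g z \<noteq> 0"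
      by blast
    define D' where "D' = ball (snd c p) (min r1 r2)"
    have D': "D' \<subseteq> D" "snd c p \<in> D'" "open D'" using r1 r2 by (auto simp: D'_def)
    show thesis
    proof (rule isolated[of "\<psi> ` D'"])
      show "openin X (\<psi> ` D')" unfolding \<psi>_def using D D' by (intro openin_inverse_chart_image c) auto
      show "p \<in> \<psi> ` D'" using \<psi>D[OF D'(1)] c D' by auto
      fix q assume q: "q \<in> \<psi> ` D'" "q \<noteq> p"
      then have q': "q \<in> fst c" "snd c q \<in> D'" using \<psi>D[OF D'(1)] by auto
      then have "snd c q \<noteq> snd c p" using q inj_onD[OF chart_inj[OF c(1)]] c by blast
      then show "G q \<noteq> G p \<and> regular_at A G q"
        using r1(3)[of "snd c q"] r2(3)[of "snd c q"] q' c Gg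
        by (auto simp: D'_def regular_at_def chart_deriv_def g_def)
    qed
  qed
qed

text \<open>Contraposition of the fact that an injective holomorphic function has no critical point.
  It supplies two nearby points of one fibre, the sheets that meet at a branch point.\<close>

lemma critical_not_injective:
  assumes G: "holomorphic_fun A G" and p: "p \<in> topspace X" and crit: "\<not> regular_at A G p"
    and V: "openin X V" "p \<in> V"
  shows "\<exists>q1\<in>V. \<exists>q2\<in>V. q1 \<noteq> q2 \<and> G q1 = G q2"
proof (rule ccontr)
  assume no: "\<not> ?thesis"
  obtain c where c: "c \<in> A" "p \<in> fst c" using chart_at[OF p] by blast
  define \<psi> where "\<psi> = inv_into (fst c) (snd c)"
  obtain r where r: "0 < r" "ball (snd c p) r \<subseteq> snd c ` (V \<inter> fst c)" "\<psi> ` ball (snd c p) r \<subseteq> V \<inter> fst c"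
    using chart_disc[OF c V] unfolding \<psi>_def by metis
  have "inj_on (in_chart G c) (ball (snd c p) r)"
  proof (rule inj_onI)
    fix x y assume x: "x \<in> ball (snd c p) r" and y: "y \<in> ball (snd c p) r" and "in_chart G c x = in_chart G c y"
    then have "G (\<psi> x) = G (\<psi> y)" by (simp add: in_chart_def \<psi>_def)
    moreover have "\<psi> x \<in> V" "\<psi> y \<in> V" using x y r(3) by auto
    ultimately have "\<psi> x = \<psi> y" using no by blast
    moreover have "x \<in> snd c ` fst c" "y \<in> snd c ` fst c" using x y r(2) by auto
    ultimately show "x = y" using inverse_chart unfolding \<psi>_def by metis
  qed
  moreover have "ball (snd c p) r \<subseteq> snd c ` fst c" using r(2) by auto
  then have "in_chart G c holomorphic_on ball (snd c p) r"
    using G c by (auto simp: holomorphic_fun_def intro: holomorphic_on_subset)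
  ultimately have "deriv (in_chart G c) (snd c p) \<noteq> 0"
    using r(1) by (intro holomorphic_injective_imp_regular) auto
  then show False using crit c by (auto simp: regular_at_def chart_deriv_def)
qed

lemma nonconstant_open:
  assumes G: "holomorphic_fun A G" and p: "p \<in> topspace X" and V: "openin X V" "p \<in> V"
    and nc: "\<And>U. openin X U \<Longrightarrow> p \<in> U \<Longrightarrow> \<exists>q\<in>U. G q \<noteq> G p"
  shows "\<exists>r>0. ball (G p) r \<subseteq> G ` V"
proof -
  obtain c where c: "c \<in> A" "p \<in> fst c" using chart_at[OF p] by blast
  define \<psi> where "\<psi> = inv_into (fst c) (snd c)"
  obtain r where r: "0 < r" "ball (snd c p) r \<subseteq> snd c ` (V \<inter> fst c)" "openin X (\<psi> ` ball (snd c p) r)"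
      "\<psi> ` ball (snd c p) r \<subseteq> V \<inter> fst c" "p \<in> \<psi> ` ball (snd c p) r"
    using chart_disc[OF c V] unfolding \<psi>_def by metis
  define D where "D = ball (snd c p) r"
  have gp: "in_chart G c (snd c p) = G p" by (rule in_chart_apply[OF c])
  have "D \<subseteq> snd c ` fst c" using r(2) by (auto simp: D_def)
  then have hol: "in_chart G c holomorphic_on D"
    using G c by (auto simp: holomorphic_fun_def intro: holomorphic_on_subset)
  obtain q where q: "q \<in> \<psi> ` D" "G q \<noteq> G p" using nc[OF r(3,5)] by (auto simp: D_def)
  then obtain z where z: "z \<in> D" "in_chart G c z \<noteq> G p" by (auto simp: in_chart_def \<psi>_def)
  moreover have "snd c p \<in> D" using r(1) by (simp add: D_def)
  ultimately have "\<not> in_chart G c constant_on D" using gp unfolding constant_on_def by metis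
  then have "open (in_chart G c ` D)"
    using open_mapping_thm[OF hol, of D] by (auto simp: D_def)
  moreover have "G p \<in> in_chart G c ` D"
    using gp r(1) by (intro image_eqI[of _ _ "snd c p"]) (auto simp: D_def)
  ultimately obtain e where "0 < e" "ball (G p) e \<subseteq> in_chart G c ` D" by (meson open_contains_ball)
  moreover have "in_chart G c ` D \<subseteq> G ` V" using r(4) by (auto simp: in_chart_def \<psi>_def D_def)
  ultimately show ?thesis by blast
qed

end

section \<open>The area measure and the curvature integral\<close>

locale immersed_surface = surface +
  fixes F :: "'a \<Rightarrow> complex ^ 3"
  assumes holF: "holomorphic_map A F"
    and immF: "\<And>c z. c \<in> A \<Longrightarrow> z \<in> snd c ` fst c \<Longrightarrow> velocity (in_chart F c) z \<noteq> 0"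
begin

abbreviation "MX \<equiv> sigma (topspace X) {U. openin X U}"

lemma space_MX [simp]: "space MX = topspace X"
  by (simp add: space_measure_of_conv)

lemma openin_MX: "openin X U \<Longrightarrow> U \<in> sets MX"
  by (auto simp: sets_measure_of_conv openin_subset dest: openin_subset)

lemma sets_MX_subset: "B \<in> sets MX \<Longrightarrow> B \<subseteq> topspace X"
  using sets.sets_into_space by fastforce

lemma compactin_MX: "compactin X K \<Longrightarrow> K \<in> sets MX"
proof -
  assume "compactin X K"
  then have "closedin X K" using hausdorff by (simp add: compactin_imp_closedin)
  then have "K \<subseteq> topspace X" "openin X (topspace X - K)" by (auto simp: closedin_def)
  then have "space MX - (topspace X - K) \<in> sets MX" by (intro sets.compl_sets openin_MX)
  then show ?thesis using \<open>K \<subseteq> topspace X\<close> by (simp add: double_diff)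
qed

lemma continuous_map_MX:
  assumes "continuous_map X euclidean f"
  shows "f \<in> borel_measurable MX"
proof (rule borel_measurableI)
  fix S :: "'b set" assume "open S"
  then have "openin X {x \<in> topspace X. f x \<in> S}"
    using assms by (intro openin_continuous_map_preimage[of X euclidean]) auto
  moreover have "f -` S \<inter> space MX = {x \<in> topspace X. f x \<in> S}" by auto
  ultimately show "f -` S \<inter> space MX \<in> sets MX" by (simp add: openin_MX)
qed

lemma immersion: "c \<in> A \<Longrightarrow> holomorphic_immersion (in_chart F c) (snd c ` fst c)"
  using holF immF chart(2)
  by unfold_locales (auto simp: holomorphic_map_def in_chart_def o_def)

definition area_density :: "'a chart \<Rightarrow> complex \<Rightarrow> real" where
  "area_density c z = sqrt (det (induced_metric (in_chart F c) z))"

lemma area_density_eq: "c \<in> A \<Longrightarrow> z \<in> snd c ` fst c \<Longrightarrow> area_density c z = (norm (velocity (in_chart F c) z))\<^sup>2"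
  using holomorphic_immersion.det_induced_metric[OF immersion, of c z]
  by (simp only: area_density_def real_sqrt_abs abs_power2 abs_norm_cancel power2_abs zero_le_power2 abs_of_nonneg)

text \<open>The inverse chart, extended by the dummy value \<open>x\<close> to a measurable map on
  the whole plane; it is used only under densities that vanish off the chart image.\<close>

definition chart_inv :: "'a \<Rightarrow> 'a chart \<Rightarrow> complex \<Rightarrow> 'a" where
  "chart_inv x c z = (if z \<in> snd c ` fst c then inv_into (fst c) (snd c) z else x)"

lemma chart_inv_measurable:
  assumes c: "c \<in> A" and x: "x \<in> topspace X"
  shows "chart_inv x c \<in> borel \<rightarrow>\<^sub>M MX"
proof (rule measurable_measure_of)
  show "chart_inv x c \<in> space borel \<rightarrow> topspace X"
    using x subsetD[OF chart_subset[OF c]] chart_inverse[OF c] by (auto simp: chart_inv_def)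
  fix U assume "U \<in> {U. openin X U}"
  then have U: "openin X U" by simp
  have o: "open (snd c ` (U \<inter> fst c))"
    using U chart(1)[OF c] by (intro open_chart_image c) auto
  have "chart_inv x c -` U \<inter> space borel = snd c ` (U \<inter> fst c) \<union> (if x \<in> U then - snd c ` fst c else {})"
  proof (intro equalityI subsetI)
    fix z assume z: "z \<in> chart_inv x c -` U \<inter> space borel"
    show "z \<in> snd c ` (U \<inter> fst c) \<union> (if x \<in> U then - snd c ` fst c else {})"
    proof (cases "z \<in> snd c ` fst c")
      case True
      then have "inv_into (fst c) (snd c) z \<in> U \<inter> fst c" "z = snd c (inv_into (fst c) (snd c) z)"
        using z inverse_chart[OF True] by (auto simp: chart_inv_def split: if_splits)
      then show ?thesis by blast
    qed (use z in \<open>auto simp: chart_inv_def\<close>)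
  next
    fix z assume "z \<in> snd c ` (U \<inter> fst c) \<union> (if x \<in> U then - snd c ` fst c else {})"
    then show "z \<in> chart_inv x c -` U \<inter> space borel"
    proof
      assume "z \<in> snd c ` (U \<inter> fst c)"
      then obtain p where "p \<in> U" "p \<in> fst c" "z = snd c p" by blast
      then show ?thesis using chart_inverse[OF c, of p] by (simp add: chart_inv_def)
    qed (auto simp: chart_inv_def split: if_splits)
  qed
  moreover have "snd c ` (U \<inter> fst c) \<in> sets borel" "- snd c ` fst c \<in> sets borel"
    using o chart(2)[OF c] by auto
  ultimately show "chart_inv x c -` U \<inter> space borel \<in> sets borel" by (simp del: space_borel)
qed (auto dest: openin_subset)

lemma chart_image_Int:
  assumes c: "c \<in> A" and B: "B \<subseteq> fst c"
  shows "z \<in> snd c ` (B \<inter> B') \<longleftrightarrow> z \<in> snd c ` B \<and> chart_inv x c z \<in> B'"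
proof -
  have inv: "chart_inv x c (snd c p) = p" if "p \<in> B" for p
    using chart_inverse[OF c, of p] B that by (auto simp: chart_inv_def)
  show ?thesis
  proof
    assume "z \<in> snd c ` (B \<inter> B')"
    then obtain p where "p \<in> B" "p \<in> B'" "z = snd c p" by blast
    then show "z \<in> snd c ` B \<and> chart_inv x c z \<in> B'" using inv by simp
  next
    assume "z \<in> snd c ` B \<and> chart_inv x c z \<in> B'"
    then obtain p where "p \<in> B" "z = snd c p" "chart_inv x c z \<in> B'" by blast
    then show "z \<in> snd c ` (B \<inter> B')" using inv by auto
  qed
qed

lemma chart_image_borel:
  assumes c: "c \<in> A" and B: "B \<in> sets MX" "B \<subseteq> fst c"
  shows "snd c ` B \<in> sets borel"
proof (cases "topspace X = {}")
  case True
  then have "B = {}" using sets_MX_subset[OF B(1)] by simp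
  then show ?thesis by simp
next
  case False
  then obtain x where x: "x \<in> topspace X" by blast
  have "snd c ` B = (chart_inv x c -` B \<inter> space borel) \<inter> snd c ` fst c"
  proof (intro equalityI subsetI)
    fix z assume "z \<in> snd c ` B"
    then obtain p where "p \<in> B" "z = snd c p" by blast
    then show "z \<in> (chart_inv x c -` B \<inter> space borel) \<inter> snd c ` fst c"
      using B(2) chart_inverse[OF c, of p] by (auto simp: chart_inv_def)
  next
    fix z assume z: "z \<in> (chart_inv x c -` B \<inter> space borel) \<inter> snd c ` fst c"
    then have "inv_into (fst c) (snd c) z \<in> B" by (auto simp: chart_inv_def split: if_splits)
    moreover have "z = snd c (inv_into (fst c) (snd c) z)" using z inverse_chart[of z c] by auto
    ultimately show "z \<in> snd c ` B" by blast
  qed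
  also have "\<dots> \<in> sets borel"
    using measurable_sets[OF chart_inv_measurable[OF c x] B(1)] chart(2)[OF c] by (intro sets.Int) auto
  finally show ?thesis .
qed

lemma area_density_measurable:
  assumes c: "c \<in> A" and B: "B \<in> sets borel" "B \<subseteq> snd c ` fst c"
  shows "(\<lambda>z. ennreal (area_density c z) * indicator B z) \<in> borel_measurable borel"
proof -
  interpret I: holomorphic_immersion "in_chart F c" "snd c ` fst c" by (rule immersion[OF c])
  have "continuous_on B (area_density c)"
    using continuous_on_subset[OF I.continuous_E B(2)] area_density_eq[OF c] B(2)
    by (subst continuous_on_cong[OF refl]) auto
  then have "area_density c \<in> borel_measurable (restrict_space borel B)"
    by (rule borel_measurable_continuous_on_restrict)
  then have "(\<lambda>z. indicator B z *\<^sub>R area_density c z) \<in> borel_measurable borel"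
    using B(1) by (subst (asm) borel_measurable_restrict_space_iff) auto
  then have "(\<lambda>z. ennreal (indicator B z *\<^sub>R area_density c z)) \<in> borel_measurable borel" by measurable
  then show ?thesis
    by (rule measurable_cong[THEN iffD1, rotated]) (auto simp: indicator_def)
qed

lemma transition:
  assumes c: "c \<in> A" "d \<in> A"
  defines "S \<equiv> snd c ` (fst c \<inter> fst d)" and "T \<equiv> snd d \<circ> inv_into (fst c) (snd c)"
  shows "open S" "T holomorphic_on S" "inj_on T S" "T ` S \<subseteq> snd d ` fst d"
    "\<And>f z. z \<in> S \<Longrightarrow> in_chart f c z = in_chart f d (T z)"
    "\<And>p. p \<in> fst c \<Longrightarrow> T (snd c p) = snd d p"
proof -
  show "open S" unfolding S_def
    using chart(1)[OF c(1)] chart(1)[OF c(2)] by (intro open_chart_image c openin_Int) auto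
  show "T holomorphic_on S"
    using atlas c unfolding holomorphic_atlas_def S_def T_def by (auto simp: case_prod_unfold)
  show T: "T (snd c p) = snd d p" if "p \<in> fst c" for p
    using chart_inverse[OF c(1) that] by (simp add: T_def)
  show "inj_on T S"
    using T chart_inj[OF c(2)] by (auto simp: S_def inj_on_def)
  show "T ` S \<subseteq> snd d ` fst d" using T by (auto simp: S_def)
  show "in_chart f c z = in_chart f d (T z)" if "z \<in> S" for f z
    using that T in_chart_apply[OF c(1), of _ f] in_chart_apply[OF c(2), of _ f] by (auto simp: S_def)
qed

lemma change_chart:
  assumes c: "c \<in> A" "d \<in> A" and z: "z \<in> snd c ` (fst c \<inter> fst d)"
  defines "T \<equiv> snd d \<circ> inv_into (fst c) (snd c)"
  shows "area_density c z = (norm (deriv T z))\<^sup>2 * area_density d (T z)"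
    "gauss_curvature (induced_metric (in_chart F c)) z = gauss_curvature (induced_metric (in_chart F d)) (T z)"
proof -
  note t = transition[OF c, folded T_def]
  interpret Ic: holomorphic_immersion "in_chart F c" "snd c ` (fst c \<inter> fst d)"
    using immersion[OF c(1)] t(1) unfolding holomorphic_immersion_def by (auto intro: holomorphic_on_subset)
  interpret Id: holomorphic_immersion "in_chart F d" "snd d ` fst d" by (rule immersion[OF c(2)])
  note r = gauss_curvature_reparam[OF t(1) z t(2,4) chart(2)[OF c(2)] Id.hol t(5) Ic.holomorphic_immersion_axioms Id.holomorphic_immersion_axioms]
  have "z \<in> snd c ` fst c" "T z \<in> snd d ` fst d" using z t(4) by auto
  then show "area_density c z = (norm (deriv T z))\<^sup>2 * area_density d (T z)"
    using r(1) area_density_eq c by simp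
  show "gauss_curvature (induced_metric (in_chart F c)) z = gauss_curvature (induced_metric (in_chart F d)) (T z)"
    by (rule r(2))
qed

abbreviation "K \<equiv> induced_gauss_curvature A F"

text \<open>Curvature is invariant under transition maps, so the chart selected by
  \<open>SOME\<close> may be exchanged for any other chart around the point.\<close>

lemma K_chart:
  assumes c: "c \<in> A" "p \<in> fst c"
  shows "K p = gauss_curvature (induced_metric (in_chart F c)) (snd c p)"
proof -
  define d where "d = (SOME c. c \<in> A \<and> p \<in> fst c)"
  have d: "d \<in> A" "p \<in> fst d" using someI[of "\<lambda>c. c \<in> A \<and> p \<in> fst c" c] c by (auto simp: d_def)
  have "K p = gauss_curvature (induced_metric (in_chart F d)) (snd d p)"
    unfolding induced_gauss_curvature_def d_def Let_def ..
  also have "\<dots> = gauss_curvature (induced_metric (in_chart F c)) (snd c p)"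
    using change_chart(2)[OF c(1) d(1), of "snd c p"] transition(6)[OF c(1) d(1) c(2)] c d by auto
  finally show ?thesis .
qed

lemma K_continuous: "continuous_map X euclidean K"
  unfolding continuous_map_def
proof (intro conjI allI impI)
  fix Q :: "real set" assume "openin euclidean Q"
  then have Q: "open Q" by simp
  show "openin X {x \<in> topspace X. K x \<in> Q}"
  proof (subst openin_subopen, intro ballI)
    fix p assume p: "p \<in> {x \<in> topspace X. K x \<in> Q}"
    then obtain c where c: "c \<in> A" "p \<in> fst c" using chart_at by blast
    let ?k = "gauss_curvature (induced_metric (in_chart F c))"
    have "continuous_on (snd c ` fst c) ?k"
      by (rule holomorphic_immersion.continuous_gauss_curvature[OF immersion[OF c(1)]])
    then have "open (snd c ` fst c \<inter> ?k -` Q)"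
      using Q chart(2)[OF c(1)] by (simp add: continuous_on_open_vimage Int_commute)
    then have "openin X {q \<in> fst c. snd c q \<in> snd c ` fst c \<inter> ?k -` Q}"
      by (rule openin_chart_preimage[OF c(1)])
    moreover have "{q \<in> fst c. snd c q \<in> snd c ` fst c \<inter> ?k -` Q} = {q \<in> fst c. K q \<in> Q}"
      using K_chart[OF c(1)] by auto
    ultimately show "\<exists>T. openin X T \<and> p \<in> T \<and> T \<subseteq> {x \<in> topspace X. K x \<in> Q}"
      using c p chart_subset[OF c(1)] by (intro exI[of _ "{q \<in> fst c. K q \<in> Q}"]) auto
  qed
qed auto

text \<open>Under the transition map \<open>T\<close> the densities differ by
  \<open>(norm (deriv T z))\<^sup>2\<close>, which is exactly the Jacobian in the change of
  variables.\<close>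

lemma area_chart_independent:
  assumes c: "c \<in> A" "d \<in> A" and B: "B \<in> sets MX" "B \<subseteq> fst c" "B \<subseteq> fst d"
  shows "(\<integral>\<^sup>+ z\<in>snd c ` B. ennreal (area_density c z) \<partial>lborel) = (\<integral>\<^sup>+ z\<in>snd d ` B. ennreal (area_density d z) \<partial>lborel)"
proof -
  define T where "T = snd d \<circ> inv_into (fst c) (snd c)"
  note t = transition[OF c, folded T_def]
  have TB: "T ` (snd c ` B) = snd d ` B" using t(6) B(2) by (force simp: image_iff)
  have sub: "snd c ` B \<subseteq> snd c ` (fst c \<inter> fst d)" using B by auto
  have bc: "snd c ` B \<in> sets borel" and bd: "snd d ` B \<in> sets borel"
    using B c by (auto intro: chart_image_borel)
  let ?f = "\<lambda>z. ennreal (area_density d z) * indicator (snd d ` B) z"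
  have "(\<integral>\<^sup>+ z\<in>snd d ` B. ennreal (area_density d z) \<partial>lborel) = (\<integral>\<^sup>+ z\<in>T ` (snd c ` B). ?f z \<partial>lborel)"
    unfolding TB by (intro nn_integral_cong) (auto simp: indicator_def)
  also have "\<dots> = (\<integral>\<^sup>+ z\<in>snd c ` B. ?f (T z) * ennreal ((norm (deriv T z))\<^sup>2) \<partial>lborel)"
    using B by (intro nn_integral_holomorphic_image[OF t(1,2,3) bc sub] area_density_measurable[OF c(2) bd]) auto
  also have "\<dots> = (\<integral>\<^sup>+ z\<in>snd c ` B. ennreal (area_density c z) \<partial>lborel)"
  proof (intro nn_integral_cong)
    fix z :: complex
    show "?f (T z) * ennreal ((norm (deriv T z))\<^sup>2) * indicator (snd c ` B) z = ennreal (area_density c z) * indicator (snd c ` B) z"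
    proof (cases "z \<in> snd c ` B")
      case True
      then have "T z \<in> snd d ` B" using TB by blast
      moreover have "area_density c z = (norm (deriv T z))\<^sup>2 * area_density d (T z)"
        using change_chart(1)[OF c, of z] True sub by (auto simp: T_def)
      moreover have "0 \<le> area_density d (T z)"
        using area_density_eq[OF c(2), of "T z"] calculation B by auto
      ultimately show ?thesis using True by (simp add: ennreal_mult mult.commute)
    qed simp
  qed
  finally show ?thesis by simp
qed


text \<open>Restricted to \<open>B\<close>, the area measure is the image of a plane density under
  the inverse chart, because the two measures agree on all Borel sets.\<close>

lemma nn_integral_chart:
  assumes \<mu>: "induced_area_measure X A F \<mu>" and c: "c \<in> A" and B: "B \<in> sets MX" "B \<subseteq> fst c"
    and v: "v \<in> borel_measurable MX"
  shows "(\<integral>\<^sup>+ p\<in>B. v p \<partial>\<mu>) =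
    (\<integral>\<^sup>+ z\<in>snd c ` B. v (inv_into (fst c) (snd c) z) * ennreal (area_density c z) \<partial>lborel)"
proof (cases "B = {}")
  case False
  then obtain x where x: "x \<in> topspace X" using sets_MX_subset[OF B(1)] by blast
  have s\<mu>: "sets \<mu> = sets MX" and e\<mu>: "\<And>c B. c\<in>A \<Longrightarrow> B \<in> sets MX \<Longrightarrow> B \<subseteq> fst c \<Longrightarrow>
      emeasure \<mu> B = (\<integral>\<^sup>+ z\<in>snd c ` B. ennreal (area_density c z) \<partial>lborel)"
    using \<mu> by (simp_all add: induced_area_measure_def area_density_def)
  define D where "D = (\<lambda>z. ennreal (area_density c z) * indicator (snd c ` B) z)"
  have bB: "snd c ` B \<in> sets borel" by (rule chart_image_borel[OF c B])
  have Dm: "D \<in> borel_measurable borel"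
    unfolding D_def using B by (intro area_density_measurable c bB) auto
  note inv_m = chart_inv_measurable[OF c x]
  have eq: "density \<mu> (indicator B) = distr (density lborel D) MX (chart_inv x c)"
  proof (rule measure_eqI)
    fix B' assume "B' \<in> sets (density \<mu> (indicator B :: 'a \<Rightarrow> ennreal))"
    then have B': "B' \<in> sets MX" by (simp add: s\<mu>)
    have "emeasure (density \<mu> (indicator B)) B' = (\<integral>\<^sup>+ p. indicator (B \<inter> B') p \<partial>\<mu>)"
    proof -
      have "emeasure (density \<mu> (indicator B)) B' = (\<integral>\<^sup>+ p. indicator B p * indicator B' p \<partial>\<mu>)"
        using B B' by (intro emeasure_density borel_measurable_indicator) (simp_all add: s\<mu>)
      then show ?thesis by (simp only: indicator_inter_arith)
    qed
    also have "\<dots> = emeasure \<mu> (B \<inter> B')" using B B' by (intro nn_integral_indicator) (simp add: s\<mu> sets.Int)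
    also have "\<dots> = (\<integral>\<^sup>+ z\<in>snd c ` (B \<inter> B'). ennreal (area_density c z) \<partial>lborel)"
      using B B' by (intro e\<mu> c sets.Int) auto
    also have "\<dots> = (\<integral>\<^sup>+ z. D z * indicator (chart_inv x c -` B') z \<partial>lborel)"
    proof (intro nn_integral_cong)
      fix z :: complex
      show "ennreal (area_density c z) * indicator (snd c ` (B \<inter> B')) z = D z * indicator (chart_inv x c -` B') z"
        using chart_image_Int[OF c B(2), of z B' x] by (simp add: D_def indicator_def)
    qed
    also have "\<dots> = emeasure (distr (density lborel D) MX (chart_inv x c)) B'"
      using B' inv_m Dm measurable_sets[OF inv_m B'] by (simp add: emeasure_distr emeasure_density)
    finally show "emeasure (density \<mu> (indicator B)) B' = emeasure (distr (density lborel D) MX (chart_inv x c)) B'" .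
  qed (simp add: s\<mu>)
  have vm: "v \<in> borel_measurable \<mu>" using v by (simp cong: measurable_cong_sets add: s\<mu>)
  have "(\<integral>\<^sup>+ p\<in>B. v p \<partial>\<mu>) = integral\<^sup>N (density \<mu> (indicator B)) v"
    using vm B by (subst nn_integral_density) (auto simp: s\<mu> mult.commute intro!: borel_measurable_indicator)
  also have "\<dots> = (\<integral>\<^sup>+ z. D z * v (chart_inv x c z) \<partial>lborel)"
    unfolding eq using v inv_m Dm by (simp add: nn_integral_distr nn_integral_density measurable_compose[OF inv_m v])
  also have "\<dots> = (\<integral>\<^sup>+ z\<in>snd c ` B. v (inv_into (fst c) (snd c) z) * ennreal (area_density c z) \<partial>lborel)"
    using B by (intro nn_integral_cong) (auto simp: D_def chart_inv_def indicator_def mult.commute)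
  finally show ?thesis .
qed simp

text \<open>The charts are cut down to disjoint Borel pieces and the chart densities on the pieces
  are added. Compatibility with an arbitrary chart is then checked piece by piece.\<close>

lemma induced_area_measure_exists:
  fixes c :: "nat \<Rightarrow> 'a chart"
  assumes c: "\<And>i. c i \<in> A" "topspace X = (\<Union>i. fst (c i))" and ne: "topspace X \<noteq> {}"
  obtains \<mu> where "induced_area_measure X A F \<mu>"
proof -
  obtain x where x: "x \<in> topspace X" using ne by blast
  define D where "D = disjointed (\<lambda>i. fst (c i))"
  have Dsub: "D i \<subseteq> fst (c i)" for i unfolding D_def by (rule disjointed_subset)
  have Dm: "D i \<in> sets MX" for i
    unfolding D_def using openin_MX[OF chart(1)[OF c(1)]] by (intro sets.range_disjointed_sets'[THEN subsetD, of "\<lambda>i. fst (c i)"]) auto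
  have DU: "(\<Union>i. D i) = topspace X" unfolding D_def UN_disjointed_eq c(2) ..
  have Ddis: "disjoint_family D" unfolding D_def by (rule disjoint_family_disjointed)
  define w where "w = (\<lambda>i z. ennreal (area_density (c i) z) * indicator (snd (c i) ` D i) z)"
  \<comment> \<open>One copy of the plane for each chart: the countable sum of measures becomes a
    single density \<open>W\<close> on this product, which \<open>\<Psi>\<close> carries to the
    surface.\<close>
  define P where "P = count_space (UNIV::nat set) \<Otimes>\<^sub>M (lborel :: complex measure)"
  define W where "W = (\<lambda>(i, z). w i z)"
  define \<Psi> where "\<Psi> = (\<lambda>(i, z). chart_inv x (c i) z)"
  have wm: "w i \<in> borel_measurable borel" for i
    unfolding w_def by (intro area_density_measurable c chart_image_borel[OF c(1) Dm Dsub]) (use Dsub in auto)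
  have Wm: "W \<in> borel_measurable P"
    unfolding P_def by (rule measurable_pair_measure_countable1) (use wm in \<open>auto simp: W_def\<close>)
  have \<Psi>m: "\<Psi> \<in> P \<rightarrow>\<^sub>M MX"
    unfolding P_def by (rule measurable_pair_measure_countable1)
      (use chart_inv_measurable[OF c(1) x] in \<open>auto simp: \<Psi>_def cong: measurable_cong_sets\<close>)
  define \<mu> where "\<mu> = distr (density P W) MX \<Psi>"
  have em: "emeasure \<mu> B = (\<Sum>i. \<integral>\<^sup>+ z\<in>snd (c i) ` (B \<inter> D i). ennreal (area_density (c i) z) \<partial>lborel)"
    if B: "B \<in> sets MX" for B
  proof -
    have \<Psi>B: "\<Psi> -` B \<inter> space P \<in> sets P" by (rule measurable_sets[OF \<Psi>m B])
    have im: "(\<lambda>q. W q * indicator B (\<Psi> q)) \<in> borel_measurable P"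
      using Wm measurable_compose[OF \<Psi>m borel_measurable_indicator[OF B]] by (intro borel_measurable_times_ennreal)
    have "emeasure \<mu> B = (\<integral>\<^sup>+ q. W q * indicator (\<Psi> -` B \<inter> space P) q \<partial>P)"
      unfolding \<mu>_def using B \<Psi>m Wm \<Psi>B by (simp add: emeasure_distr emeasure_density)
    also have "\<dots> = (\<integral>\<^sup>+ q. W q * indicator B (\<Psi> q) \<partial>P)"
      by (intro nn_integral_cong) (auto simp: indicator_def)
    also have "\<dots> = (\<integral>\<^sup>+ i. \<integral>\<^sup>+ z. W (i, z) * indicator B (\<Psi> (i, z)) \<partial>lborel \<partial>count_space UNIV)"
      unfolding P_def by (rule lborel.nn_integral_fst[symmetric]) (use im in \<open>simp add: P_def\<close>)
    also have "\<dots> = (\<Sum>i. \<integral>\<^sup>+ z. W (i, z) * indicator B (\<Psi> (i, z)) \<partial>lborel)"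
      by (rule nn_integral_count_space_nat)
    also have "\<dots> = (\<Sum>i. \<integral>\<^sup>+ z\<in>snd (c i) ` (B \<inter> D i). ennreal (area_density (c i) z) \<partial>lborel)"
    proof (intro suminf_cong nn_integral_cong)
      fix i and z :: complex
      show "W (i, z) * indicator B (\<Psi> (i, z)) = ennreal (area_density (c i) z) * indicator (snd (c i) ` (B \<inter> D i)) z"
        using chart_image_Int[OF c(1) Dsub[of i], of z B x]
        by (simp add: W_def w_def \<Psi>_def indicator_def Int_commute)
    qed
    finally show ?thesis .
  qed
  have "emeasure \<mu> B = (\<integral>\<^sup>+ z\<in>snd d ` B. ennreal (area_density d z) \<partial>lborel)"
    if d: "d \<in> A" and B: "B \<in> sets MX" "B \<subseteq> fst d" for d B
  proof -
    have BD: "B \<inter> D i \<in> sets MX" "B \<inter> D i \<subseteq> fst (c i)" "B \<inter> D i \<subseteq> fst d" for i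
      using B Dm Dsub by auto
    have bo: "snd d ` (B \<inter> D i) \<in> sets borel" for i by (rule chart_image_borel[OF d BD(1,3)])
    have "(\<Sum>i. indicator (snd d ` (B \<inter> D i)) z) = (indicator (snd d ` B) z :: ennreal)" for z
    proof -
      have "disjoint_family (\<lambda>i. snd d ` (B \<inter> D i))"
        unfolding disjoint_family_on_def
      proof (intro ballI impI)
        fix i j :: nat assume "i \<noteq> j"
        then have "B \<inter> D i \<inter> (B \<inter> D j) = {}" using Ddis by (auto simp: disjoint_family_on_def)
        then show "snd d ` (B \<inter> D i) \<inter> snd d ` (B \<inter> D j) = {}"
          using inj_on_image_Int[OF chart_inj[OF d] BD(3) BD(3), of i j] by simp
      qed
      then have "(\<Sum>i. indicator (snd d ` (B \<inter> D i)) z) = (indicator (\<Union>i. snd d ` (B \<inter> D i)) z :: ennreal)"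
        by (rule suminf_indicator)
      also have "(\<Union>i. snd d ` (B \<inter> D i)) = snd d ` B"
        using DU sets_MX_subset[OF B(1)] by blast
      finally show ?thesis .
    qed
    then have "(\<integral>\<^sup>+ z\<in>snd d ` B. ennreal (area_density d z) \<partial>lborel) =
        (\<integral>\<^sup>+ z. (\<Sum>i. ennreal (area_density d z) * indicator (snd d ` (B \<inter> D i)) z) \<partial>lborel)"
      by simp
    also have "\<dots> = (\<Sum>i. \<integral>\<^sup>+ z\<in>snd d ` (B \<inter> D i). ennreal (area_density d z) \<partial>lborel)"
      using BD(3) by (intro nn_integral_suminf) (auto intro!: area_density_measurable d bo)
    also have "\<dots> = emeasure \<mu> B"
      unfolding em[OF B(1)] using area_chart_independent[OF d c(1) BD(1,3,2)] by simp
    finally show ?thesis by simp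
  qed
  then have "induced_area_measure X A F \<mu>"
    by (auto simp: induced_area_measure_def area_density_def \<mu>_def)
  then show thesis by (rule that)
qed

lemma K_locally_finite:
  assumes \<mu>: "induced_area_measure X A F \<mu>" and p: "p \<in> topspace X"
  shows "\<exists>V. openin X V \<and> p \<in> V \<and> (\<integral>\<^sup>+ q\<in>V. ennreal \<bar>K q\<bar> \<partial>\<mu>) < \<infinity>"
proof -
  obtain c where c: "c \<in> A" "p \<in> fst c" using chart_at[OF p] by blast
  obtain r where r: "0 < r" "ball (snd c p) r \<subseteq> snd c ` (fst c \<inter> fst c)"
    using chart_disc[OF c chart(1)[OF c(1)] c(2)] by metis
  define D where "D = ball (snd c p) (r / 2)"
  have cD: "cball (snd c p) (r / 2) \<subseteq> snd c ` fst c" using r by auto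
  have D: "open D" "D \<subseteq> snd c ` fst c" "snd c p \<in> D" using cD r by (auto simp: D_def)
  let ?k = "gauss_curvature (induced_metric (in_chart F c))"
  interpret I: holomorphic_immersion "in_chart F c" "snd c ` fst c" by (rule immersion[OF c(1)])
  have "continuous_on (cball (snd c p) (r / 2)) (\<lambda>z. ?k z * (norm (velocity (in_chart F c) z))\<^sup>2)"
    using continuous_on_subset[OF I.continuous_E cD] continuous_on_subset[OF I.continuous_gauss_curvature cD]
    by (intro continuous_on_mult)
  then have "bounded ((\<lambda>z. ?k z * (norm (velocity (in_chart F c) z))\<^sup>2) ` cball (snd c p) (r / 2))"
    by (intro compact_imp_bounded compact_continuous_image) auto
  then obtain M where "\<forall>y\<in>(\<lambda>z. ?k z * (norm (velocity (in_chart F c) z))\<^sup>2) ` cball (snd c p) (r / 2). norm y \<le> M"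
    unfolding bounded_iff by blast
  then have M: "\<bar>?k z * (norm (velocity (in_chart F c) z))\<^sup>2\<bar> \<le> M" if "z \<in> cball (snd c p) (r / 2)" for z
    using that by simp
  define V where "V = inv_into (fst c) (snd c) ` D"
  have VD: "V = {q \<in> fst c. snd c q \<in> D}" unfolding V_def by (rule inverse_chart_image[OF c(1) D(2)])
  have V: "openin X V" "p \<in> V" "V \<subseteq> fst c"
    unfolding VD using openin_chart_preimage[OF c(1) D(1)] c D by auto
  have DV: "snd c ` V = D" unfolding VD using D(2) by auto
  have Km: "(\<lambda>q. ennreal \<bar>K q\<bar>) \<in> borel_measurable MX"
    using continuous_map_MX[OF K_continuous] by measurable
  have "(\<integral>\<^sup>+ q\<in>V. ennreal \<bar>K q\<bar> \<partial>\<mu>) =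
      (\<integral>\<^sup>+ z\<in>D. ennreal \<bar>K (inv_into (fst c) (snd c) z)\<bar> * ennreal (area_density c z) \<partial>lborel)"
    using nn_integral_chart[OF \<mu> c(1) openin_MX[OF V(1)] V(3) Km] by (simp add: DV)
  also have "\<dots> \<le> (\<integral>\<^sup>+ z\<in>D. ennreal M \<partial>lborel)"
  proof (intro nn_integral_mono)
    fix z
    show "ennreal \<bar>K (inv_into (fst c) (snd c) z)\<bar> * ennreal (area_density c z) * indicator D z \<le> ennreal M * indicator D z"
    proof (cases "z \<in> D")
      case True
      then have z: "z \<in> snd c ` fst c" "z \<in> cball (snd c p) (r / 2)" using D by (auto simp: D_def)
      have "K (inv_into (fst c) (snd c) z) = ?k z"
        using K_chart[OF c(1), of "inv_into (fst c) (snd c) z"] inverse_chart[OF z(1)] by simp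
      then have "\<bar>K (inv_into (fst c) (snd c) z)\<bar> * area_density c z \<le> M"
        using M[OF z(2)] area_density_eq[OF c(1) z(1)] by (simp add: abs_mult)
      then show ?thesis using True by (simp add: ennreal_mult''[symmetric] area_density_eq[OF c(1) z(1)] ennreal_leI)
    qed simp
  qed
  also have "\<dots> = ennreal M * emeasure lborel D" using D by (simp add: nn_integral_cmult_indicator)
  also have "\<dots> < \<infinity>" using emeasure_lborel_ball_finite[of "snd c p" "r / 2"] by (simp add: D_def ennreal_mult_less_top)
  finally show ?thesis using V by blast
qed

lemma K_compact_finite:
  assumes \<mu>: "induced_area_measure X A F \<mu>" and S: "compactin X S"
  shows "(\<integral>\<^sup>+ q\<in>S. ennreal \<bar>K q\<bar> \<partial>\<mu>) < \<infinity>"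
proof -
  have s\<mu>: "sets \<mu> = sets MX" using \<mu> by (simp add: induced_area_measure_def)
  define \<U> where "\<U> = {V. openin X V \<and> (\<integral>\<^sup>+ q\<in>V. ennreal \<bar>K q\<bar> \<partial>\<mu>) < \<infinity>}"
  have "S \<subseteq> \<Union>\<U>" using K_locally_finite[OF \<mu>] compactin_subset_topspace[OF S] by (fastforce simp: \<U>_def)
  moreover have "\<forall>U\<in>\<U>. openin X U" by (auto simp: \<U>_def)
  ultimately obtain \<F> where \<F>: "finite \<F>" "\<F> \<subseteq> \<U>" "S \<subseteq> \<Union>\<F>"
    using S unfolding compactin_def by metis
  have Km: "(\<lambda>q. ennreal \<bar>K q\<bar>) \<in> borel_measurable \<mu>"
    using continuous_map_MX[OF K_continuous] by (simp cong: measurable_cong_sets add: s\<mu>)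
  have "(\<integral>\<^sup>+ q\<in>S. ennreal \<bar>K q\<bar> \<partial>\<mu>) \<le> (\<integral>\<^sup>+ q. (\<Sum>V\<in>\<F>. ennreal \<bar>K q\<bar> * indicator V q) \<partial>\<mu>)"
  proof (intro nn_integral_mono)
    fix q
    show "ennreal \<bar>K q\<bar> * indicator S q \<le> (\<Sum>V\<in>\<F>. ennreal \<bar>K q\<bar> * indicator V q)"
    proof (cases "q \<in> S")
      case True
      then obtain V where "V \<in> \<F>" "q \<in> V" using \<F> by blast
      then show ?thesis
        using member_le_sum[of V \<F> "\<lambda>V. ennreal \<bar>K q\<bar> * indicator V q"] \<F>(1) True by simp
    qed simp
  qed
  also have "\<dots> = (\<Sum>V\<in>\<F>. \<integral>\<^sup>+ q\<in>V. ennreal \<bar>K q\<bar> \<partial>\<mu>)"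
    using \<F>(2) Km openin_MX
    by (intro nn_integral_sum) (auto simp: \<U>_def s\<mu> intro!: borel_measurable_times_ennreal borel_measurable_indicator)
  also have "\<dots> < \<infinity>" using \<F> by (auto simp: \<U>_def)
  finally show ?thesis .
qed

end

section \<open>Integrating the curvature over an end\<close>

text \<open>Dyadic shells: beyond radius \<open>r k\<close> the integrand is at most
  \<open>r k powr (-2 - \<delta>)\<close>, and the disc of radius \<open>2 * r k\<close> has area
  \<open>4 \<pi> (r k)^2\<close>; what is left is a geometric series of ratio
  \<open>2 powr (- \<delta>)\<close>.\<close>

lemma nn_integral_powr_tail_finite:
  assumes R: "0 < R" and \<delta>: "0 < \<delta>"
  shows "(\<integral>\<^sup>+ w\<in>{w::complex. R < norm w}. ennreal (norm w powr (-2 - \<delta>)) \<partial>lborel) < \<infinity>"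
proof -
  define r where "r = (\<lambda>k::nat. R * 2 ^ k)"
  have r: "0 < r k" for k using R by (simp add: r_def)
  have pt: "ennreal (norm w powr (-2 - \<delta>)) * indicator {w. R < norm w} w
      \<le> (\<Sum>k. ennreal (r k powr (-2 - \<delta>)) * indicator (cball 0 (r (Suc k))) w)" for w :: complex
  proof (cases "R < norm w")
    case True
    obtain n where "norm w / R < 2 ^ n" using real_arch_pow[of 2 "norm w / R"] by auto
    then have n: "norm w \<le> r n" using R by (simp add: r_def field_simps)
    define k where "k = (LEAST n. norm w \<le> r n)"
    have k: "norm w \<le> r k" unfolding k_def using n by (rule LeastI)
    have "k \<noteq> 0" using k True by (auto simp: r_def intro: gr0I)
    then obtain j where j: "k = Suc j" by (cases k) auto
    have "\<not> norm w \<le> r j" using not_less_Least[of j "\<lambda>n. norm w \<le> r n"] j by (simp add: k_def)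
    then have "norm w powr (-2 - \<delta>) \<le> r j powr (-2 - \<delta>)"
      using r[of j] \<delta> by (intro powr_mono2') auto
    then have "ennreal (norm w powr (-2 - \<delta>)) * indicator {w. R < norm w} w
        \<le> ennreal (r j powr (-2 - \<delta>)) * indicator (cball 0 (r (Suc j))) w"
      using True k j by (simp add: ennreal_leI)
    also have "\<dots> \<le> (\<Sum>k. ennreal (r k powr (-2 - \<delta>)) * indicator (cball 0 (r (Suc k))) w)"
    proof -
      define t where "t = (\<lambda>k. ennreal (r k powr (-2 - \<delta>)) * indicator (cball 0 (r (Suc k))) w)"
      have "sum t {j} \<le> suminf t" by (intro sum_le_suminf summableI) auto
      then have "t j \<le> suminf t" by simp
      then show ?thesis unfolding t_def .
    qed
    finally show ?thesis .
  qed simp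
  have tm: "(\<integral>\<^sup>+ w. ennreal (r k powr (-2 - \<delta>)) * indicator (cball 0 (r (Suc k))) (w::complex) \<partial>lborel)
      = ennreal (4 * pi * R powr (- \<delta>) * (2 powr (- \<delta>)) ^ k)" for k
  proof -
    have "(\<integral>\<^sup>+ w. ennreal (r k powr (-2 - \<delta>)) * indicator (cball 0 (r (Suc k))) (w::complex) \<partial>lborel)
        = ennreal (r k powr (-2 - \<delta>)) * ennreal (pi * (r (Suc k))\<^sup>2)"
      using r[of "Suc k"] by (simp add: nn_integral_cmult_indicator emeasure_cball unit_ball_vol_2 less_imp_le)
    also have "\<dots> = ennreal (r k powr (-2 - \<delta>) * (pi * (r (Suc k))\<^sup>2))"
      by (simp add: ennreal_mult)
    also have "r k powr (-2 - \<delta>) * (pi * (r (Suc k))\<^sup>2) = 4 * pi * r k powr (- \<delta>)"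
    proof -
      have "r k powr (-2 - \<delta>) = r k powr (- \<delta>) / (r k)\<^sup>2"
        using r[of k] by (simp add: powr_diff powr_minus field_simps)
      moreover have "r (Suc k) = 2 * r k" by (simp add: r_def)
      ultimately show ?thesis using r[of k] by (simp add: power_mult_distrib)
    qed
    also have "r k powr (- \<delta>) = R powr (- \<delta>) * (2 powr (- \<delta>)) ^ k"
    proof -
      have "r k powr (- \<delta>) = R powr (- \<delta>) * (2 ^ k) powr (- \<delta>)"
        unfolding r_def using R by (simp add: powr_mult)
      also have "(2 ^ k :: real) powr (- \<delta>) = (2 powr (- \<delta>)) ^ k"
        by (simp add: powr_powr powr_realpow[symmetric] powr_gt_zero mult.commute)
      finally show ?thesis .
    qed
    finally show ?thesis by (simp add: mult.assoc)
  qed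
  have q: "2 powr (- \<delta>) < 1" using \<delta> by (simp add: powr_less_one)
  have "norm (2 powr (- \<delta>)) < 1" unfolding real_norm_def abs_of_nonneg[OF powr_ge_zero] by (rule q)
  then have sm: "summable (\<lambda>k. 4 * pi * R powr (- \<delta>) * (2 powr (- \<delta>)) ^ k)"
    using summable_mult[OF summable_geometric, of "2 powr (- \<delta>)" "4 * pi * R powr (- \<delta>)"] by blast
  have "(\<integral>\<^sup>+ w\<in>{w::complex. R < norm w}. ennreal (norm w powr (-2 - \<delta>)) \<partial>lborel)
      \<le> (\<integral>\<^sup>+ w. (\<Sum>k. ennreal (r k powr (-2 - \<delta>)) * indicator (cball 0 (r (Suc k))) (w::complex)) \<partial>lborel)"
    by (rule nn_integral_mono) (rule pt)
  also have "\<dots> = (\<Sum>k. ennreal (4 * pi * R powr (- \<delta>) * (2 powr (- \<delta>)) ^ k))"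
  proof -
    have "(\<lambda>w::complex. ennreal (r k powr (-2 - \<delta>)) * indicator (cball 0 (r (Suc k))) w) \<in> borel_measurable lborel" for k
      by (intro borel_measurable_times_ennreal borel_measurable_indicator) simp_all
    from nn_integral_suminf[OF this] show ?thesis unfolding tm .
  qed
  also have "\<dots> = ennreal (\<Sum>k. 4 * pi * R powr (- \<delta>) * (2 powr (- \<delta>)) ^ k)"
    by (rule suminf_ennreal2[OF _ sm]) (intro mult_nonneg_nonneg zero_le_power powr_ge_zero; simp)
  also have "\<dots> < \<infinity>" by simp
  finally show ?thesis .
qed

context immersed_surface
begin

text \<open>\<open>G\<close> maps \<open>W\<close> to the exterior of a disc with at most
  \<open>d\<close> points in each fibre. Pushing \<open>|K| dA\<close> down by \<open>G\<close>
  therefore gives at most \<open>d\<close> times the integrable bound in the plane.\<close>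

lemma K_multivalent_chart_finite:
  assumes \<mu>: "induced_area_measure X A F \<mu>" and G: "holomorphic_fun A G"
    and W: "openin X W" "W = (\<Union>n::nat. Q n)" "\<And>n. compactin X (Q n)"
    and reg: "\<And>p. p \<in> W \<Longrightarrow> regular_at A G p"
    and fib: "\<And>w. finite {p\<in>W. G p = w}" "\<And>w. card {p\<in>W. G p = w} \<le> d"
    and R: "0 < R" "\<And>p. p \<in> W \<Longrightarrow> R < norm (G p)" and \<delta>: "0 < \<delta>" and C: "0 \<le> C"
    and bnd: "\<And>p c. p \<in> W \<Longrightarrow> c \<in> A \<Longrightarrow> p \<in> fst c \<Longrightarrow>
      \<bar>K p\<bar> * area_density c (snd c p) \<le> C * norm (G p) powr (-2 - \<delta>) * (norm (chart_deriv G c p))\<^sup>2"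
  shows "(\<integral>\<^sup>+ p\<in>W. ennreal \<bar>K p\<bar> \<partial>\<mu>) < \<infinity>"
proof (cases "W = {}")
  case False
  have s\<mu>: "sets \<mu> = sets MX" using \<mu> by (simp add: induced_area_measure_def)
  have Km: "(\<lambda>q. ennreal \<bar>K q\<bar>) \<in> borel_measurable MX"
    using continuous_map_MX[OF K_continuous] by measurable
  \<comment> \<open>Patches inside one chart on which \<open>G\<close> is injective; countably many
    of them cover \<open>W\<close>, since \<open>W\<close> is a countable union of compact
    sets.\<close>
  define good where "good = (\<lambda>V. openin X V \<and> V \<subseteq> W \<and> inj_on G V \<and> (\<exists>c\<in>A. V \<subseteq> fst c))"
  have ex: "\<exists>V. good V \<and> p \<in> V" if p: "p \<in> W" for p
  proof -
    have "p \<in> topspace X" using p W(1) openin_subset by blast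
    then obtain c where c: "c \<in> A" "p \<in> fst c" using chart_at by blast
    have o: "openin X (W \<inter> fst c)" "p \<in> W \<inter> fst c" using W(1) chart(1)[OF c(1)] p c by auto
    obtain r \<sigma> V where "openin X V" "p \<in> V" "V \<subseteq> W \<inter> fst c" "\<And>q. q \<in> V \<Longrightarrow> G q \<in> ball (G p) r \<and> \<sigma> (G q) = q"
      using local_section[OF G reg[OF p] o] by metis
    moreover from this have "inj_on G V" by (metis inj_onI)
    ultimately show ?thesis using c by (auto simp: good_def)
  qed
  have "\<exists>\<F>. finite \<F> \<and> (\<forall>V\<in>\<F>. good V) \<and> Q n \<subseteq> \<Union>\<F>" for n
  proof -
    have "Q n \<subseteq> \<Union>{V. good V}" using ex W(2) by blast
    moreover have "\<forall>V\<in>{V. good V}. openin X V" by (auto simp: good_def)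
    ultimately obtain \<F> where "finite \<F>" "\<F> \<subseteq> {V. good V}" "Q n \<subseteq> \<Union>\<F>"
      using W(3)[of n] unfolding compactin_def by metis
    then show ?thesis by blast
  qed
  then obtain \<F> where \<F>: "\<And>n. finite (\<F> n)" "\<And>n V. V \<in> \<F> n \<Longrightarrow> good V" "\<And>n. Q n \<subseteq> \<Union>(\<F> n)" by metis
  define \<V> where "\<V> = (\<Union>n. \<F> n)"
  have "countable \<V>" unfolding \<V>_def using \<F>(1) by (intro countable_UN) (auto intro: countable_finite)
  moreover have "W \<subseteq> \<Union>\<V>" using \<F>(3) W(2) unfolding \<V>_def by blast
  then have "\<V> \<noteq> {}" using False by auto
  ultimately obtain V :: "nat \<Rightarrow> 'a set" where V: "range V = \<V>"
    using range_from_nat_into by metis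
  have gV: "good (V i)" for i using V \<F>(2) unfolding \<V>_def by blast
  then have "\<exists>c\<in>A. V i \<subseteq> fst c" for i by (auto simp: good_def)
  then obtain c where c: "\<And>i. c i \<in> A" "\<And>i. V i \<subseteq> fst (c i)" by metis
  have Vo: "openin X (V i)" "V i \<subseteq> W" "inj_on G (V i)" for i using gV by (auto simp: good_def)
  have WV: "W = (\<Union>i. V i)" using V \<open>W \<subseteq> \<Union>\<V>\<close> Vo by auto
  define E where "E = disjointed V"
  have EV: "E i \<subseteq> V i" for i unfolding E_def by (rule disjointed_subset)
  have Em: "E i \<in> sets MX" for i
    unfolding E_def using openin_MX[OF Vo(1)] by (intro sets.range_disjointed_sets'[THEN subsetD, of V]) auto
  have EU: "(\<Union>i. E i) = W" unfolding E_def UN_disjointed_eq WV ..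
  have Ed: "disjoint_family E" unfolding E_def by (rule disjoint_family_disjointed)
  define \<rho> where "\<rho> = (\<lambda>w::complex. ennreal (C * norm w powr (-2 - \<delta>)))"
  have \<rho>m: "\<rho> \<in> borel_measurable borel" unfolding \<rho>_def by measurable
  have piece: "(\<integral>\<^sup>+ p\<in>E i. ennreal \<bar>K p\<bar> \<partial>\<mu>) \<le> (\<integral>\<^sup>+ w\<in>G ` E i. \<rho> w \<partial>lborel) \<and> G ` E i \<in> sets borel" for i
  proof -
    define S where "S = snd (c i) ` V i"
    define g where "g = in_chart G (c i)"
    have S: "open S" "S \<subseteq> snd (c i) ` fst (c i)"
      unfolding S_def using open_chart_image[OF c(1) Vo(1) c(2)] c(2)[of i] by auto
    have gS: "g (snd (c i) p) = G p" if "p \<in> V i" for p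
      using in_chart_apply[OF c(1), of p i G] c(2) that by (auto simp: g_def)
    have hol: "g holomorphic_on S"
      using G c(1) S(2) unfolding holomorphic_fun_def g_def by (blast intro: holomorphic_on_subset)
    have inj: "inj_on g S"
    proof (rule inj_onI)
      fix x y assume "x \<in> S" "y \<in> S" "g x = g y"
      then obtain p q where "x = snd (c i) p" "y = snd (c i) q" "p \<in> V i" "q \<in> V i" "G p = G q"
        using gS by (auto simp: S_def)
      then show "x = y" using inj_onD[OF Vo(3)] by blast
    qed
    have Ei: "E i \<subseteq> fst (c i)" using EV c(2) by blast
    have bE: "snd (c i) ` E i \<in> sets borel" by (rule chart_image_borel[OF c(1) Em Ei])
    have ES: "snd (c i) ` E i \<subseteq> S" using EV by (auto simp: S_def)
    have gE: "g ` (snd (c i) ` E i) = G ` E i" using gS EV by (force simp: image_image)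
    have "(\<integral>\<^sup>+ p\<in>E i. ennreal \<bar>K p\<bar> \<partial>\<mu>) = (\<integral>\<^sup>+ z\<in>snd (c i) ` E i.
        ennreal \<bar>K (inv_into (fst (c i)) (snd (c i)) z)\<bar> * ennreal (area_density (c i) z) \<partial>lborel)"
      by (rule nn_integral_chart[OF \<mu> c(1) Em Ei Km])
    also have "\<dots> \<le> (\<integral>\<^sup>+ z\<in>snd (c i) ` E i. \<rho> (g z) * ennreal ((norm (deriv g z))\<^sup>2) \<partial>lborel)"
    proof (intro nn_integral_mono)
      fix z
      show "ennreal \<bar>K (inv_into (fst (c i)) (snd (c i)) z)\<bar> * ennreal (area_density (c i) z) * indicator (snd (c i) ` E i) z
        \<le> \<rho> (g z) * ennreal ((norm (deriv g z))\<^sup>2) * indicator (snd (c i) ` E i) z"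
      proof (cases "z \<in> snd (c i) ` E i")
        case True
        then obtain p where p: "p \<in> E i" "z = snd (c i) p" by blast
        then have pp: "p \<in> V i" "p \<in> W" "p \<in> fst (c i)" using EV Vo(2) Ei by auto
        have "inv_into (fst (c i)) (snd (c i)) z = p" using chart_inverse[OF c(1) pp(3)] p by simp
        moreover have "\<bar>K p\<bar> * area_density (c i) z \<le> C * norm (g z) powr (-2 - \<delta>) * (norm (deriv g z))\<^sup>2"
          using bnd[OF pp(2) c(1) pp(3)] gS[OF pp(1)] p by (simp add: chart_deriv_def g_def)
        moreover have "0 \<le> area_density (c i) z" using area_density_eq[OF c(1)] p pp(3) by simp
        ultimately show ?thesis
          using True C by (simp add: \<rho>_def ennreal_mult''[symmetric] ennreal_leI)
      qed simp
    qed
    also have "\<dots> = (\<integral>\<^sup>+ w\<in>G ` E i. \<rho> w \<partial>lborel)"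
      using nn_integral_holomorphic_image[OF S(1) hol inj bE ES \<rho>m] by (simp only: gE)
    finally show ?thesis using holomorphic_image_borel[OF S(1) hol inj bE ES] by (simp add: gE)
  qed
  \<comment> \<open>The pieces \<open>E i\<close> are disjoint, so different indices whose image
    contains \<open>w\<close> give different points of the fibre over \<open>w\<close>.\<close>
  have cnt: "(\<Sum>i. indicator (G ` E i) w) \<le> of_nat d * (indicator {w. R < norm w} w :: ennreal)" for w
  proof (rule suminf_le_const)
    show "summable (\<lambda>i. indicator (G ` E i) w :: ennreal)" by (rule summableI)
    fix n
    show "(\<Sum>i<n. indicator (G ` E i) w :: ennreal) \<le> of_nat d * indicator {w. R < norm w} w"
    proof (cases "R < norm w")
      case True
      define I where "I = {i. i < n \<and> w \<in> G ` E i}"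
      have "\<forall>i\<in>I. \<exists>p. p \<in> E i \<and> G p = w" by (auto simp: I_def)
      then obtain h where h: "\<And>i. i \<in> I \<Longrightarrow> h i \<in> E i \<and> G (h i) = w" by metis
      have "inj_on h I"
        using h Ed unfolding inj_on_def disjoint_family_on_def by (metis UNIV_I disjoint_iff)
      moreover have "h ` I \<subseteq> {p\<in>W. G p = w}" using h EU by blast
      ultimately have "card I \<le> card {p\<in>W. G p = w}" using fib(1) card_inj_on_le by metis
      then have "card I \<le> d" using fib(2)[of w] by linarith
      moreover have "(\<Sum>i<n. indicator (G ` E i) w :: ennreal) = of_nat (card I)"
      proof -
        have "(\<Sum>i<n. indicator (G ` E i) w :: ennreal) = (\<Sum>i\<in>I. 1)"
          unfolding I_def by (intro sum.mono_neutral_cong_right) (auto simp: indicator_def)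
        then show ?thesis by simp
      qed
      ultimately show ?thesis using True by simp
    next
      case False
      then have "w \<notin> G ` E i" for i using R(2) EU by blast
      then show ?thesis by simp
    qed
  qed
  have "(\<integral>\<^sup>+ p\<in>W. ennreal \<bar>K p\<bar> \<partial>\<mu>) = (\<integral>\<^sup>+ p. (\<Sum>i. ennreal \<bar>K p\<bar> * indicator (E i) p) \<partial>\<mu>)"
    using suminf_indicator[OF Ed] by (simp add: EU)
  also have "\<dots> = (\<Sum>i. \<integral>\<^sup>+ p\<in>E i. ennreal \<bar>K p\<bar> \<partial>\<mu>)"
    using Km Em by (intro nn_integral_suminf)
      (auto simp: s\<mu> cong: measurable_cong_sets intro!: borel_measurable_times_ennreal borel_measurable_indicator)
  also have "\<dots> \<le> (\<Sum>i. \<integral>\<^sup>+ w\<in>G ` E i. \<rho> w \<partial>lborel)"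
    using piece by (intro suminf_le summableI) auto
  also have "\<dots> = (\<integral>\<^sup>+ w. (\<Sum>i. \<rho> w * indicator (G ` E i) w) \<partial>lborel)"
    using piece \<rho>m by (intro nn_integral_suminf[symmetric]) (auto intro!: borel_measurable_times_ennreal borel_measurable_indicator)
  also have "\<dots> = (\<integral>\<^sup>+ w. \<rho> w * (\<Sum>i. indicator (G ` E i) w) \<partial>lborel)" by simp
  also have "\<dots> \<le> (\<integral>\<^sup>+ w. \<rho> w * (of_nat d * indicator {w. R < norm w} w) \<partial>lborel)"
    by (intro nn_integral_mono mult_left_mono cnt) auto
  also have "\<dots> = (\<integral>\<^sup>+ w. ennreal (d * C) * (ennreal (norm w powr (-2 - \<delta>)) * indicator {w::complex. R < norm w} w) \<partial>lborel)"
    using C by (intro nn_integral_cong) (auto simp: \<rho>_def indicator_def ennreal_mult ennreal_of_nat_eq_real_of_nat mult_ac)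
  also have "\<dots> = ennreal (d * C) * (\<integral>\<^sup>+ w\<in>{w::complex. R < norm w}. ennreal (norm w powr (-2 - \<delta>)) \<partial>lborel)"
    by (intro nn_integral_cmult) measurable
  also have "\<dots> < \<infinity>"
    using nn_integral_powr_tail_finite[OF R(1) \<delta>] by (simp add: ennreal_mult_less_top)
  finally show ?thesis .
qed simp

end

section \<open>Proper ends\<close>

text \<open>One half of the surface, where \<open>norm (H p) \<le> norm (G p)\<close>. The number
  \<open>R\<close> exceeds \<open>norm (G p)\<close> wherever both moduli agree, so beyond
  \<open>R\<close> the weak inequality is strict and hence an open condition.\<close>

locale proper_end = surface +
  fixes G H :: "'a \<Rightarrow> complex" and R :: real
  assumes connected: "connected_space X" and noncompact: "\<not> compact_space X"
    and holG: "holomorphic_fun A G" and holH: "holomorphic_fun A H"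
    and immersed: "\<And>p. p \<in> topspace X \<Longrightarrow> regular_at A G p \<or> regular_at A H p"
    and proper: "\<And>r. compactin X {p \<in> topspace X. norm (H p) \<le> norm (G p) \<and> norm (G p) - norm (H p) \<le> r}"
    and R: "0 < R" "\<And>p. p \<in> topspace X \<Longrightarrow> norm (H p) = norm (G p) \<Longrightarrow> norm (G p) < R"
begin

definition tail :: "real \<Rightarrow> 'a set" where
  "tail r = {p \<in> topspace X. norm (H p) \<le> norm (G p) \<and> r < norm (G p)}"

definition fib :: "complex \<Rightarrow> 'a set" where
  "fib w = {p \<in> topspace X. norm (H p) \<le> norm (G p) \<and> G p = w}"

lemma openin_tail:
  assumes "R \<le> r"
  shows "openin X (tail r)"
proof -
  have "continuous_map X euclidean (\<lambda>p. norm (G p) - norm (H p))"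
    using holomorphic_fun_continuous[OF holG] holomorphic_fun_continuous[OF holH]
    by (intro continuous_map_diff continuous_map_norm)
  then have "openin X {p \<in> topspace X. norm (G p) - norm (H p) \<in> {0<..}}"
    by (rule openin_continuous_map_preimage) auto
  moreover have "openin X {p \<in> topspace X. G p \<in> - cball 0 r}"
    by (rule openin_holomorphic_preimage[OF holG]) auto
  ultimately have "openin X ({p \<in> topspace X. norm (G p) - norm (H p) \<in> {0<..}} \<inter> {p \<in> topspace X. G p \<in> - cball 0 r})"
    by (rule openin_Int)
  also have "\<dots> = tail r"
  proof -
    have "norm (H p) < norm (G p)" if "p \<in> topspace X" "norm (H p) \<le> norm (G p)" "r < norm (G p)" for p
      using R(2)[OF that(1)] that assms by force
    then show ?thesis by (auto simp: tail_def)
  qed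
  finally show ?thesis .
qed

text \<open>Properness of \<open>G\<close> on its half: a bound on \<open>norm (G p)\<close> also
  bounds \<open>norm (G p) - norm (H p)\<close>.\<close>

lemma compactin_preimage:
  assumes "closed T" "bounded T"
  shows "compactin X {p \<in> topspace X. norm (H p) \<le> norm (G p) \<and> G p \<in> T}"
proof -
  obtain B where B: "\<And>w. w \<in> T \<Longrightarrow> norm w \<le> B" using assms(2) by (auto simp: bounded_iff)
  have "closedin X {p \<in> topspace X. G p \<in> T}"
    using holomorphic_fun_continuous[OF holG] assms(1) by (intro closedin_continuous_map_preimage[of X euclidean]) auto
  from closed_Int_compactin[OF this proper[of B]]
  have "compactin X ({p \<in> topspace X. G p \<in> T} \<inter> {p \<in> topspace X. norm (H p) \<le> norm (G p) \<and> norm (G p) - norm (H p) \<le> B})" .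
  also have "\<dots> = {p \<in> topspace X. norm (H p) \<le> norm (G p) \<and> G p \<in> T}"
  proof -
    have "norm (G p) - norm (H p) \<le> B" if "G p \<in> T" for p using B[OF that] norm_ge_zero[of "H p"] by linarith
    then show ?thesis by auto
  qed
  finally show ?thesis .
qed

lemma compactin_fib: "compactin X (fib w)"
  using compactin_preimage[of "{w}"] by (simp add: fib_def)

lemma fib_tail: "r < norm w \<Longrightarrow> fib w \<subseteq> tail r"
  by (auto simp: fib_def tail_def)

lemma tail_fib: "p \<in> tail r \<Longrightarrow> p \<in> fib (G p)"
  by (auto simp: fib_def tail_def)

lemma tail_topspace: "tail r \<subseteq> topspace X"
  by (auto simp: tail_def)

text \<open>The set \<open>Z\<close> of points of the fibre near which \<open>G\<close> is constant
  is open and closed. If it contained \<open>p\<close> it would be the whole surface, which would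
  then be a compact fibre.\<close>

lemma not_locally_constant:
  assumes p: "p \<in> tail R" and V: "openin X V" "p \<in> V"
  shows "\<exists>q\<in>V. G q \<noteq> G p"
proof (rule ccontr)
  assume "\<not> ?thesis"
  then have const: "\<And>q. q \<in> V \<Longrightarrow> G q = G p" by blast
  define w where "w = G p"
  have w: "R < norm w" using p by (simp add: tail_def w_def)
  define Z where "Z = {q \<in> fib w. \<exists>U. openin X U \<and> q \<in> U \<and> (\<forall>x\<in>U. G x = w)}"
  have "openin X Z"
  proof (subst openin_subopen, intro ballI)
    fix q assume q: "q \<in> Z"
    then obtain U where U: "openin X U" "q \<in> U" "\<forall>x\<in>U. G x = w" by (auto simp: Z_def)
    have "openin X (U \<inter> tail R)" using U openin_tail by auto
    moreover have "q \<in> U \<inter> tail R" using q U fib_tail[OF w] by (auto simp: Z_def)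
    moreover have "U \<inter> tail R \<subseteq> Z"
      using U tail_fib[of _ R] by (auto simp: Z_def)
    ultimately show "\<exists>T. openin X T \<and> q \<in> T \<and> T \<subseteq> Z" by blast
  qed
  moreover have "openin X (topspace X - Z)"
  proof (subst openin_subopen, intro ballI)
    fix q assume q: "q \<in> topspace X - Z"
    show "\<exists>T. openin X T \<and> q \<in> T \<and> T \<subseteq> topspace X - Z"
    proof (cases "q \<in> fib w")
      case False
      have "closedin X (fib w)" using compactin_fib hausdorff by (simp add: compactin_imp_closedin)
      then have "openin X (topspace X - fib w)" by auto
      then show ?thesis using False q by (intro exI[of _ "topspace X - fib w"]) (auto simp: Z_def)
    next
      case True
      then have Gq: "G q = w" by (simp add: fib_def)
      have "q \<in> topspace X" using q by simp
      from holG this show ?thesis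
      proof (cases rule: locally_constant_or_isolated)
        case (const V)
        then show ?thesis using True Gq q by (auto simp: Z_def)
      next
        case (isolated V)
        have "x \<notin> Z" if "x \<in> V" for x
          using isolated(3)[OF that] Gq q by (cases "x = q") (auto simp: Z_def fib_def)
        then have "V \<subseteq> topspace X - Z"
          using openin_subset[OF isolated(1)] by auto
        then show ?thesis using isolated by blast
      qed
    qed
  qed
  ultimately have "Z = {} \<or> Z = topspace X"
  proof -
    assume Z: "openin X Z" "openin X (topspace X - Z)"
    have "closedin X Z" unfolding closedin_def using Z(2) openin_subset[OF Z(1)] by blast
    then show ?thesis using connected Z(1) unfolding connected_space_clopen_in by blast
  qed
  moreover have "p \<in> Z" unfolding Z_def w_def using V const tail_fib[OF p] by blast
  ultimately have "Z = topspace X" by blast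
  moreover have "Z \<subseteq> fib w" "fib w \<subseteq> topspace X" unfolding Z_def fib_def by blast+
  ultimately have "fib w = topspace X" by blast
  then show False using compactin_fib[of w] noncompact by (simp add: compact_space_def)
qed

lemma isolated_nbhd:
  assumes p: "p \<in> tail R"
  obtains V where "openin X V" "p \<in> V" "V \<subseteq> tail R" "\<And>q. q \<in> V \<Longrightarrow> q \<noteq> p \<Longrightarrow> G q \<noteq> G p \<and> regular_at A G q"
proof -
  have "p \<in> topspace X" using p tail_topspace by blast
  from holG this show thesis
  proof (cases rule: locally_constant_or_isolated)
    case (const V)
    then show ?thesis using not_locally_constant[OF p const(1,2)] by blast
  next
    case (isolated V)
    then show ?thesis using p openin_tail[of R] by (intro that[of "V \<inter> tail R"]) auto
  qed
qed

lemma finite_fib: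
  assumes w: "R < norm w"
  shows "finite (fib w)"
proof -
  have "\<exists>V. openin X V \<and> p \<in> V \<and> V \<inter> fib w \<subseteq> {p}" if p: "p \<in> fib w" for p
  proof -
    obtain V where "openin X V" "p \<in> V" "\<And>q. q \<in> V \<Longrightarrow> q \<noteq> p \<Longrightarrow> G q \<noteq> G p \<and> regular_at A G q"
      using isolated_nbhd[of p] p fib_tail[OF w] by (metis subsetD)
    then show ?thesis using p by (auto simp: fib_def intro!: exI[of _ V])
  qed
  then obtain V where V: "\<And>p. p \<in> fib w \<Longrightarrow> openin X (V p) \<and> p \<in> V p \<and> V p \<inter> fib w \<subseteq> {p}" by metis
  have "\<forall>U\<in>V ` fib w. openin X U" "fib w \<subseteq> \<Union>(V ` fib w)" using V by auto
  then obtain \<F> where \<F>: "finite \<F>" "\<F> \<subseteq> V ` fib w" "fib w \<subseteq> \<Union>\<F>"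
    using compactin_fib[of w] unfolding compactin_def by metis
  then obtain P where P: "P \<subseteq> fib w" "finite P" "\<F> = V ` P" by (metis finite_subset_image)
  have "fib w \<subseteq> P" using \<F>(3) P V by blast
  then show ?thesis using P(2) finite_subset by blast
qed

text \<open>The part outside \<open>Q\<close> of the compact preimage of \<open>cball w 1\<close>
  has closed image, and this image misses \<open>w\<close>; so it misses a disc around
  \<open>w\<close>.\<close>

lemma tube:
  assumes Q: "openin X Q" "fib w \<subseteq> Q"
  obtains r where "0 < r" "\<And>x. x \<in> ball w r \<Longrightarrow> fib x \<subseteq> Q"
proof -
  define S where "S = {p \<in> topspace X. norm (H p) \<le> norm (G p) \<and> G p \<in> cball w 1}"
  have "compactin X S" unfolding S_def by (intro compactin_preimage) auto
  moreover have "closedin X (topspace X - Q)" using Q by auto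
  ultimately have "compactin X (S \<inter> (topspace X - Q))" by (rule compact_Int_closedin)
  then have "compactin euclidean (G ` (S \<inter> (topspace X - Q)))"
    by (rule image_compactin[OF _ holomorphic_fun_continuous[OF holG]])
  then have "closed (G ` (S \<inter> (topspace X - Q)))" by (simp add: compact_imp_closed)
  moreover have "w \<notin> G ` (S \<inter> (topspace X - Q))" using Q by (auto simp: S_def fib_def)
  ultimately obtain r where r: "0 < r" "ball w r \<subseteq> - G ` (S \<inter> (topspace X - Q))"
    by (metis ComplI open_Compl open_contains_ball)
  show thesis
  proof (rule that[of "min r 1"])
    fix x assume x: "x \<in> ball w (min r 1)"
    show "fib x \<subseteq> Q"
    proof
      fix p assume p: "p \<in> fib x"
      then have "p \<in> S" using x by (auto simp: S_def fib_def)
      moreover have "x \<notin> G ` (S \<inter> (topspace X - Q))" using r x by auto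
      ultimately show "p \<in> Q" using p by (auto simp: fib_def)
    qed
  qed (use r in auto)
qed

section \<open>Critical values and the unramified part of the covering\<close>

definition crit :: "complex set" where
  "crit = {w. R < norm w \<and> (\<exists>p\<in>fib w. \<not> regular_at A G p)}"

text \<open>Each point of the fibre has a neighbourhood whose other points are regular. By
  \<open>tube\<close> nearby fibres lie in the union of these neighbourhoods, and they do not meet
  the fibre over \<open>w\<close>.\<close>

lemma crit_isolated:
  assumes w: "R < norm w"
  shows "\<exists>r>0. \<forall>x\<in>ball w r. R < norm x \<and> (x \<noteq> w \<longrightarrow> x \<notin> crit)"
proof -
  have "\<exists>V. openin X V \<and> p \<in> V \<and> (\<forall>q\<in>V. q \<noteq> p \<longrightarrow> regular_at A G q)" if p: "p \<in> fib w" for p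
    using isolated_nbhd[of p] p fib_tail[OF w] by (metis subsetD)
  then obtain V where V: "\<And>p. p \<in> fib w \<Longrightarrow> openin X (V p) \<and> p \<in> V p \<and> (\<forall>q\<in>V p. q \<noteq> p \<longrightarrow> regular_at A G q)" by metis
  have "openin X (\<Union>(V ` fib w))" "fib w \<subseteq> \<Union>(V ` fib w)" using V by auto
  then obtain r where r: "0 < r" "\<And>x. x \<in> ball w r \<Longrightarrow> fib x \<subseteq> \<Union>(V ` fib w)" by (rule tube) blast
  have "open {x::complex. R < norm x}" by (intro open_Collect_less continuous_intros)
  then obtain r' where r': "0 < r'" "ball w r' \<subseteq> {x. R < norm x}" using w by (metis mem_Collect_eq open_contains_ball)
  show ?thesis
  proof (intro exI[of _ "min r r'"] conjI ballI impI)
    fix x assume x: "x \<in> ball w (min r r')" "x \<noteq> w"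
    have "regular_at A G q" if q: "q \<in> fib x" for q
    proof -
      obtain p where p: "p \<in> fib w" "q \<in> V p" using r(2)[of x] x q by auto
      have "q \<noteq> p" using p q x by (auto simp: fib_def)
      then show ?thesis using V p by blast
    qed
    then show "x \<notin> crit" by (auto simp: crit_def)
  qed (use r r' in auto)
qed

definition base :: "complex set" where
  "base = {w. R < norm w} - crit"

lemma open_base: "open base"
  unfolding open_contains_ball
proof
  fix w assume w: "w \<in> base"
  then have "R < norm w" by (simp add: base_def)
  then obtain r where "0 < r" "\<forall>x\<in>ball w r. R < norm x \<and> (x \<noteq> w \<longrightarrow> x \<notin> crit)"
    using crit_isolated by blast
  then show "\<exists>e>0. ball w e \<subseteq> base" using w by (intro exI[of _ r]) (auto simp: base_def)
qed

text \<open>Removing a discrete set from a connected plane domain keeps it connected; this is what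
  makes the number of sheets constant.\<close>

lemma connected_base: "connected base"
  unfolding base_def
proof (rule sparse_imp_connected)
  have D: "{w::complex. R < norm w} = - cball 0 R" by auto
  show "connected {w::complex. R < norm w}"
    unfolding D by (rule connected_complement_bounded_convex) auto
  show "open {w::complex. R < norm w}" by (intro open_Collect_less continuous_intros)
  then show "crit sparse_in {w. R < norm w}"
  proof (subst sparse_in_eventually_iff, blast, intro ballI)
    fix w :: complex assume "w \<in> {w. R < norm w}"
    then have "R < norm w" by simp
    then obtain r where "0 < r" "\<forall>x\<in>ball w r. R < norm x \<and> (x \<noteq> w \<longrightarrow> x \<notin> crit)"
      using crit_isolated by blast
    then show "\<forall>\<^sub>F y in at w. y \<notin> crit"
      unfolding eventually_at by (intro exI[of _ r]) (auto simp: dist_commute)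
  qed
qed simp

lemma base_nonempty: "base \<noteq> {}"
proof -
  have "R < norm (of_real (R + 1) :: complex)" using R(1) by (simp del: of_real_add)
  then obtain r where r: "0 < r" "\<forall>x\<in>ball (of_real (R + 1)) r. R < norm x \<and> (x \<noteq> of_real (R + 1) \<longrightarrow> x \<notin> crit)"
    using crit_isolated by blast
  define x :: complex where "x = of_real (R + 1 + r / 2)"
  have "x \<in> ball (of_real (R + 1)) r" "x \<noteq> of_real (R + 1)"
    using r(1) by (auto simp: x_def dist_complex_def simp flip: of_real_diff)
  then show ?thesis using r by (auto simp: base_def)
qed

lemma disjoint_nbhds:
  assumes P: "finite P" "P \<subseteq> topspace X"
  obtains U where "\<And>p. p \<in> P \<Longrightarrow> openin X (U p) \<and> p \<in> U p"
    "\<And>p q. p \<in> P \<Longrightarrow> q \<in> P \<Longrightarrow> p \<noteq> q \<Longrightarrow> U p \<inter> U q = {}"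
proof -
  have "\<exists>U V. openin X U \<and> openin X V \<and> p \<in> U \<and> q \<in> V \<and> disjnt U V" if "p \<in> P" "q \<in> P" "p \<noteq> q" for p q
    using hausdorff that P(2) unfolding Hausdorff_space_def by blast
  then obtain U V where UV: "\<And>p q. p \<in> P \<Longrightarrow> q \<in> P \<Longrightarrow> p \<noteq> q \<Longrightarrow>
      openin X (U p q) \<and> openin X (V p q) \<and> p \<in> U p q \<and> q \<in> V p q \<and> disjnt (U p q) (V p q)"
    by metis
  define N where "N = (\<lambda>p. \<Inter>q\<in>P. if q = p then topspace X else U p q \<inter> V q p)"
  show thesis
  proof (rule that[of N])
    fix p assume p: "p \<in> P"
    have "openin X (N p)"
      unfolding N_def using P(1) p UV by (intro openin_INT2) (auto simp: openin_INT)
    then show "openin X (N p) \<and> p \<in> N p" using p UV P(2) by (auto simp: N_def)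
  next
    fix p q assume pq: "p \<in> P" "q \<in> P" "p \<noteq> q"
    then have "N p \<subseteq> U p q" "N q \<subseteq> V p q" by (auto simp: N_def split: if_splits)
    then show "N p \<inter> N q = {}" using UV[OF pq] by (auto simp: disjnt_def)
  qed
qed

definition section_at :: "complex \<Rightarrow> 'a \<Rightarrow> real \<Rightarrow> (complex \<Rightarrow> 'a) \<Rightarrow> 'a set \<Rightarrow> bool" where
  "section_at w p r \<sigma> V \<longleftrightarrow> 0 < r \<and> openin X V \<and> p \<in> V \<and> \<sigma> ` ball w r = V \<and> \<sigma> w = p \<and>
      (\<forall>x\<in>ball w r. G (\<sigma> x) = x) \<and> (\<forall>q\<in>V. \<sigma> (G q) = q) \<and>
      (\<forall>f. holomorphic_fun A f \<longrightarrow> (\<lambda>x. f (\<sigma> x)) holomorphic_on ball w r)"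

lemma section_at_exists:
  assumes "regular_at A G p" "openin X Q" "p \<in> Q"
  shows "\<exists>r \<sigma> V. V \<subseteq> Q \<and> section_at (G p) p r \<sigma> V"
proof (rule local_section[OF holG assms])
  fix r \<sigma> V
  assume *: "0 < r" "openin X V" "p \<in> V" "V \<subseteq> Q" "\<sigma> ` ball (G p) r = V" "\<sigma> (G p) = p"
    "\<And>x. x \<in> ball (G p) r \<Longrightarrow> G (\<sigma> x) = x" "\<And>q. q \<in> V \<Longrightarrow> G q \<in> ball (G p) r \<and> \<sigma> (G q) = q"
    "\<And>f. holomorphic_fun A f \<Longrightarrow> (\<lambda>x. f (\<sigma> x)) holomorphic_on ball (G p) r"
  have "section_at (G p) p r \<sigma> V"
    unfolding section_at_def using *(1-3,5-6) *(7) *(8) *(9) by blast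
  then show ?thesis using *(4) by blast
qed

text \<open>Over \<open>base\<close> the map \<open>G\<close> is an unramified finite covering:
  sections through the points of the fibre have disjoint images, and by \<open>tube\<close> these
  images exhaust the nearby fibres.\<close>

lemma sections:
  assumes w: "w \<in> base"
  obtains r \<sigma> where "0 < r" "ball w r \<subseteq> base"
    "\<And>q. q \<in> fib w \<Longrightarrow> \<sigma> q w = q"
    "\<And>q f. q \<in> fib w \<Longrightarrow> holomorphic_fun A f \<Longrightarrow> (\<lambda>x. f (\<sigma> q x)) holomorphic_on ball w r"
    "\<And>x. x \<in> ball w r \<Longrightarrow> bij_betw (\<lambda>q. \<sigma> q x) (fib w) (fib x)"
proof -
  have Rw: "R < norm w" and reg: "\<And>p. p \<in> fib w \<Longrightarrow> regular_at A G p" using w by (auto simp: base_def crit_def)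
  have fin: "finite (fib w)" by (rule finite_fib[OF Rw])
  have "fib w \<subseteq> topspace X" by (auto simp: fib_def)
  with fin obtain U where U: "\<And>p. p \<in> fib w \<Longrightarrow> openin X (U p) \<and> p \<in> U p"
    "\<And>p q. p \<in> fib w \<Longrightarrow> q \<in> fib w \<Longrightarrow> p \<noteq> q \<Longrightarrow> U p \<inter> U q = {}"
    by (rule disjoint_nbhds) blast
  have "\<exists>r \<sigma> V. V \<subseteq> U p \<inter> tail R \<and> section_at w p r \<sigma> V" if p: "p \<in> fib w" for p
  proof -
    have "openin X (U p \<inter> tail R)" "p \<in> U p \<inter> tail R"
      using U(1)[OF p] openin_tail[of R] p fib_tail[OF Rw] by auto
    from section_at_exists[OF reg[OF p] this] show ?thesis using p by (simp add: fib_def)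
  qed
  then obtain r \<sigma> V where loc': "\<And>p. p \<in> fib w \<Longrightarrow> V p \<subseteq> U p \<inter> tail R \<and> section_at w p (r p) (\<sigma> p) (V p)"
    by metis
  have loc: "0 < r p" "openin X (V p)" "p \<in> V p" "V p \<subseteq> U p" "V p \<subseteq> tail R" "\<sigma> p ` ball w (r p) = V p" "\<sigma> p w = p"
    "\<And>x. x \<in> ball w (r p) \<Longrightarrow> G (\<sigma> p x) = x" "\<And>q. q \<in> V p \<Longrightarrow> \<sigma> p (G q) = q"
    "\<And>f. holomorphic_fun A f \<Longrightarrow> (\<lambda>x. f (\<sigma> p x)) holomorphic_on ball w (r p)" if "p \<in> fib w" for p
    using loc'[OF that] unfolding section_at_def by simp_all
  have "openin X (\<Union>(V ` fib w))" "fib w \<subseteq> \<Union>(V ` fib w)" using loc(2,3) by auto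
  then obtain r1 where r1: "0 < r1" "\<And>x. x \<in> ball w r1 \<Longrightarrow> fib x \<subseteq> \<Union>(V ` fib w)" by (rule tube) blast
  obtain r2 where r2: "0 < r2" "ball w r2 \<subseteq> base" using open_base w open_contains_ball by metis
  define rs where "rs = insert r1 (insert r2 (r ` fib w))"
  define \<rho> where "\<rho> = Min rs"
  have rs: "finite rs" "rs \<noteq> {}" "\<And>x. x \<in> rs \<Longrightarrow> 0 < x"
    using fin loc(1) r1(1) r2(1) by (auto simp: rs_def)
  have "0 < \<rho>" unfolding \<rho>_def using Min_in[OF rs(1,2)] by (rule rs(3))
  moreover have "\<rho> \<le> x" if "x \<in> rs" for x unfolding \<rho>_def using Min_le[OF rs(1) that] .
  ultimately have \<rho>: "0 < \<rho>" "\<rho> \<le> r1" "\<rho> \<le> r2" "\<And>p. p \<in> fib w \<Longrightarrow> \<rho> \<le> r p"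
    by (auto simp: rs_def)
  have sub: "ball w \<rho> \<subseteq> ball w (r p)" if "p \<in> fib w" for p using \<rho>(4)[OF that] by auto
  show thesis
  proof (rule that[of \<rho> \<sigma>])
    show "ball w \<rho> \<subseteq> base" using r2(2) \<rho>(3) by auto
    show "(\<lambda>x. f (\<sigma> q x)) holomorphic_on ball w \<rho>" if "q \<in> fib w" "holomorphic_fun A f" for q f
      by (rule holomorphic_on_subset[OF loc(10)[OF that] sub[OF that(1)]])
    fix x assume x: "x \<in> ball w \<rho>"
    have mem: "\<sigma> q x \<in> V q \<and> G (\<sigma> q x) = x" if "q \<in> fib w" for q
      using loc(6,8)[OF that] sub[OF that] x by blast
    show "bij_betw (\<lambda>q. \<sigma> q x) (fib w) (fib x)"
      unfolding bij_betw_def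
    proof
      show "inj_on (\<lambda>q. \<sigma> q x) (fib w)"
      proof (rule inj_onI, rule ccontr)
        fix p q assume pq: "p \<in> fib w" "q \<in> fib w" "\<sigma> p x = \<sigma> q x" "p \<noteq> q"
        then have "\<sigma> p x \<in> U p \<inter> U q" using mem[OF pq(1)] mem[OF pq(2)] loc(4)[OF pq(1)] loc(4)[OF pq(2)] by auto
        then show False using U(2)[OF pq(1,2,4)] by blast
      qed
      show "(\<lambda>q. \<sigma> q x) ` fib w = fib x"
      proof
        show "(\<lambda>q. \<sigma> q x) ` fib w \<subseteq> fib x"
        proof (intro image_subsetI)
          fix q assume "q \<in> fib w"
          then have "\<sigma> q x \<in> tail R" "G (\<sigma> q x) = x" using mem loc(5) by blast+
          then show "\<sigma> q x \<in> fib x" using tail_fib by metis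
        qed
        show "fib x \<subseteq> (\<lambda>q. \<sigma> q x) ` fib w"
        proof
          fix p assume p: "p \<in> fib x"
          then obtain q where q: "q \<in> fib w" "p \<in> V q" using r1(2)[of x] x \<rho>(2) by auto
          have "G p = x" using p by (simp add: fib_def)
          then have "\<sigma> q x = p" using loc(9)[OF q(1)] q(2) by blast
          then show "p \<in> (\<lambda>q. \<sigma> q x) ` fib w" using q by blast
        qed
      qed
    qed
  qed (use \<rho>(1) loc(7) in auto)
qed

lemma card_fib_base:
  obtains d where "\<And>w. w \<in> base \<Longrightarrow> card (fib w) = d"
proof -
  obtain b where b: "b \<in> base" using base_nonempty by blast
  have "card (fib b) = card (fib w)" if w: "w \<in> base" for w
  proof (rule connected_local_const[OF connected_base b w], intro ballI)
    fix a assume a: "a \<in> base"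
    obtain r \<sigma> where "0 < r" "\<And>x. x \<in> ball a r \<Longrightarrow> bij_betw (\<lambda>q. \<sigma> q x) (fib a) (fib x)"
      using sections[OF a] by metis
    then have "card (fib a) = card (fib x)" if "x \<in> ball a r" for x
      using that bij_betw_same_card by blast
    with \<open>0 < r\<close> show "\<forall>\<^sub>F b in at a within base. card (fib a) = card (fib b)"
      unfolding eventually_at by (intro exI[of _ r]) (auto simp: dist_commute)
  qed
  then show thesis by (intro that[of "card (fib b)"]) auto
qed

end

lemma finite_separated:
  fixes Y :: "'b :: metric_space set"
  assumes "finite Y"
  obtains \<epsilon> where "0 < \<epsilon>" "\<And>y y'. y \<in> Y \<Longrightarrow> y' \<in> Y \<Longrightarrow> y \<noteq> y' \<Longrightarrow> 2 * \<epsilon> \<le> dist y y'"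
proof -
  \<comment> \<open>The extra element 1 keeps the minimum defined when \<open>Y\<close> has fewer
    than two points.\<close>
  define D where "D = insert 1 ((\<lambda>(a, b). dist a b) ` (Y \<times> Y) - {0})"
  have D: "finite D" "D \<noteq> {}" "\<And>x. x \<in> D \<Longrightarrow> 0 < x" using assms by (auto simp: D_def)
  have "0 < Min D" using Min_in[OF D(1,2)] by (rule D(3))
  moreover have "Min D \<le> dist y y'" if "y \<in> Y" "y' \<in> Y" "y \<noteq> y'" for y y'
    using that by (intro Min_le[OF D(1)]) (force simp: D_def)
  ultimately show thesis by (intro that[of "Min D / 2"]) auto
qed

context proper_end
begin

section \<open>Counting the values of \<open>H\<close> on the fibres of \<open>G\<close>\<close>

text \<open>Counts distinct values of \<open>H\<close>, not points of the fibre. The maximum exists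
  because the cardinality of the fibre bounds the count on \<open>base\<close>.\<close>

definition sheets :: nat where
  "sheets = Max ((\<lambda>w. card (H ` fib w)) ` base)"

lemma sheets:
  shows "w \<in> base \<Longrightarrow> card (H ` fib w) \<le> sheets" "\<exists>w\<in>base. card (H ` fib w) = sheets"
proof -
  obtain d where d: "\<And>w. w \<in> base \<Longrightarrow> card (fib w) = d" using card_fib_base by metis
  have "card (H ` fib w) \<le> d" if "w \<in> base" for w
    using card_image_le[OF finite_fib, of w H] d[OF that] that by (auto simp: base_def)
  then have "(\<lambda>w. card (H ` fib w)) ` base \<subseteq> {..d}" by auto
  then have fin: "finite ((\<lambda>w. card (H ` fib w)) ` base)" using finite_subset by blast
  show "card (H ` fib w) \<le> sheets" if "w \<in> base"
    unfolding sheets_def using fin that by (intro Max_ge) auto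
  have "sheets \<in> (\<lambda>w. card (H ` fib w)) ` base"
    unfolding sheets_def using fin base_nonempty by (intro Max_in) auto
  then show "\<exists>w\<in>base. card (H ` fib w) = sheets" by auto
qed

text \<open>On a noncritical fibre close to the critical one, every value of \<open>H\<close>
  reappears approximately, while \<open>H p0\<close> splits into two different values. So a nearby
  fibre has at least one value more.\<close>

lemma crit_fewer_values:
  assumes w: "w \<in> crit"
  shows "card (H ` fib w) < sheets"
proof -
  have Rw: "R < norm w" using w by (simp add: crit_def)
  obtain p0 where p0: "p0 \<in> fib w" "\<not> regular_at A G p0" using w by (auto simp: crit_def)
  have p0X: "p0 \<in> topspace X" and Gp0: "G p0 = w" using p0 by (auto simp: fib_def)
  have regH: "regular_at A H p0" using immersed[OF p0X] p0 by simp
  have p0t: "p0 \<in> tail R" using p0 fib_tail[OF Rw] by blast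
  define Y where "Y = H ` fib w"
  have Y: "finite Y" "H p0 \<in> Y" unfolding Y_def using finite_fib[OF Rw] p0 by auto
  obtain \<epsilon> where \<epsilon>: "0 < \<epsilon>" "\<And>y y'. y \<in> Y \<Longrightarrow> y' \<in> Y \<Longrightarrow> y \<noteq> y' \<Longrightarrow> 2 * \<epsilon> \<le> dist y y'"
    using finite_separated[OF Y(1)] by metis
  define Q where "Q = (\<lambda>y. {p \<in> topspace X. H p \<in> ball y \<epsilon>} \<inter> tail R)"
  have Qo: "openin X (Q y)" for y
    unfolding Q_def using openin_holomorphic_preimage[OF holH open_ball] openin_tail[OF order_refl] by (rule openin_Int)
  \<comment> \<open>Open mapping: every value \<open>y\<close> on the critical fibre is met up to
    \<open>\<epsilon>\<close> on all nearby fibres.\<close>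
  have "\<exists>r>0. ball w r \<subseteq> G ` Q y" if y: "y \<in> Y" for y
  proof -
    obtain q where q: "q \<in> fib w" "H q = y" using y by (auto simp: Y_def)
    have qt: "q \<in> tail R" and qX: "q \<in> topspace X" and Gq: "G q = w" using q fib_tail[OF Rw] by (auto simp: fib_def)
    have "q \<in> Q y" using qt qX q \<epsilon> by (simp add: Q_def)
    from nonconstant_open[OF holG qX Qo this not_locally_constant[OF qt]] show ?thesis by (simp add: Gq)
  qed
  then obtain r where r: "\<And>y. y \<in> Y \<Longrightarrow> 0 < r y \<and> ball w (r y) \<subseteq> G ` Q y" by metis
  obtain r1 where r1: "0 < r1" "\<forall>x\<in>ball w r1. R < norm x \<and> (x \<noteq> w \<longrightarrow> x \<notin> crit)"
    using crit_isolated[OF Rw] by blast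
  define rs where "rs = insert r1 (r ` Y)"
  have rs: "finite rs" "rs \<noteq> {}" "\<And>x. x \<in> rs \<Longrightarrow> 0 < x" using Y r r1(1) by (auto simp: rs_def)
  define \<rho> where "\<rho> = Min rs"
  have \<rho>0: "0 < \<rho>" unfolding \<rho>_def using Min_in[OF rs(1,2)] by (rule rs(3))
  have "\<rho> \<le> x" if "x \<in> rs" for x unfolding \<rho>_def using Min_le[OF rs(1) that] .
  then have \<rho>: "\<rho> \<le> r1" "\<And>y. y \<in> Y \<Longrightarrow> \<rho> \<le> r y" by (auto simp: rs_def)
  obtain V0 where V0: "openin X V0" "p0 \<in> V0" "inj_on H V0"
  proof (rule local_section[OF holH regH openin_topspace p0X])
    fix r \<sigma> V assume "openin X V" "p0 \<in> V" "\<And>q. q \<in> V \<Longrightarrow> H q \<in> ball (H p0) r \<and> \<sigma> (H q) = q"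
    then show thesis by (intro that[of V]) (auto intro: inj_on_inverseI)
  qed
  obtain V1 where V1: "openin X V1" "p0 \<in> V1" "\<And>q. q \<in> V1 \<Longrightarrow> q \<noteq> p0 \<Longrightarrow> G q \<noteq> G p0 \<and> regular_at A G q"
    using isolated_nbhd[OF p0t] by metis
  define V where "V = V0 \<inter> V1 \<inter> Q (H p0) \<inter> {p \<in> topspace X. G p \<in> ball w \<rho>}"
  have "openin X V"
    unfolding V_def using V0 V1 Qo openin_holomorphic_preimage[OF holG, of "ball w \<rho>"] by auto
  moreover have "p0 \<in> V" using V0 V1 p0t p0X \<epsilon> \<rho>0 Gp0 by (simp add: V_def Q_def)
  \<comment> \<open>Two points of one fibre near the critical point \<open>p0\<close>; as
    \<open>H\<close> is injective near \<open>p0\<close>, it separates them.\<close>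
  ultimately obtain q1 q2 where q: "q1 \<in> V" "q2 \<in> V" "q1 \<noteq> q2" "G q1 = G q2"
    using critical_not_injective[OF holG p0X p0(2)] by blast
  define x where "x = G q1"
  have "x \<noteq> w"
    using V1(3)[of q1] V1(3)[of q2] q Gp0 unfolding x_def V_def by auto
  have xw: "x \<in> ball w \<rho>" using q by (simp add: x_def V_def)
  then have xb: "x \<in> base" using r1(2) \<rho>(1) \<open>x \<noteq> w\<close> by (auto simp: base_def)
  have Hq: "H q1 \<noteq> H q2" using q inj_onD[OF V0(3), of q1 q2] by (auto simp: V_def)
  have qf: "q1 \<in> fib x" "q2 \<in> fib x"
    using q tail_fib[of q1 R] tail_fib[of q2 R] by (auto simp: V_def Q_def x_def)
  have qe: "dist (H p0) (H q1) < \<epsilon>" "dist (H p0) (H q2) < \<epsilon>" using q by (auto simp: V_def Q_def)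
  have "\<exists>p. p \<in> fib x \<and> dist y (H p) < \<epsilon>" if y: "y \<in> Y" for y
  proof -
    have "x \<in> G ` Q y" using r[OF y] \<rho>(2)[OF y] xw by auto
    then obtain p where "p \<in> Q y" "G p = x" by blast
    then show ?thesis using tail_fib[of p R] by (auto simp: Q_def)
  qed
  then obtain f where f: "\<And>y. y \<in> Y \<Longrightarrow> f y \<in> fib x \<and> dist y (H (f y)) < \<epsilon>" by metis
  \<comment> \<open>One nearby value for each \<open>y\<close>, with \<open>H q1\<close> taken at
    \<open>H p0\<close>; then \<open>H q2\<close> is an additional value.\<close>
  define g where "g = (\<lambda>y. if y = H p0 then H q1 else H (f y))"
  have g: "g y \<in> H ` fib x" "dist y (g y) < \<epsilon>" if "y \<in> Y" for y
    using f[OF that] qf qe by (auto simp: g_def)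
  have sep: "y = y'" if "y \<in> Y" "y' \<in> Y" "dist y z < \<epsilon>" "dist y' z < \<epsilon>" for y y' z
    using \<epsilon>(2)[OF that(1,2)] that dist_triangle2[of y y' z] by force
  have inj: "inj_on g Y" using g(2) sep by (metis inj_onI)
  have "H q2 \<notin> g ` Y"
  proof
    assume "H q2 \<in> g ` Y"
    then obtain y where y: "y \<in> Y" "H q2 = g y" by blast
    then have "y = H p0" using sep[OF y(1) Y(2), of "H q2"] g(2)[OF y(1)] qe by simp
    then show False using y Hq by (simp add: g_def)
  qed
  moreover have "insert (H q2) (g ` Y) \<subseteq> H ` fib x" using g qf by auto
  moreover have "finite (H ` fib x)" using finite_fib[of x] xb by (auto simp: base_def)
  ultimately have "Suc (card Y) \<le> card (H ` fib x)"
    using card_mono[of "H ` fib x" "insert (H q2) (g ` Y)"] Y(1) by (simp add: card_image[OF inj])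
  then show ?thesis using sheets(1)[OF xb] by (simp add: Y_def)
qed

text \<open>
  The sum over \<open>m\<close>-element subsets of the fibre sees only the number of distinct values of \<open>H\<close>:
  it vanishes if there are fewer than \<open>m\<close> and is a positive multiple of a discriminant if there are exactly \<open>m\<close>.
\<close>

definition vandermonde :: "'a set \<Rightarrow> complex" where
  "vandermonde S = (\<Prod>a\<in>S. \<Prod>b\<in>S - {a}. H a - H b)"

definition disc :: "complex \<Rightarrow> complex" where
  "disc w = (\<Sum>S | S \<subseteq> fib w \<and> card S = sheets. vandermonde S)"

lemma finite_subsets_fib: "R < norm w \<Longrightarrow> finite {S. S \<subseteq> fib w \<and> card S = sheets}"
  using finite_fib[of w] by (auto intro: finite_subset[of _ "Pow (fib w)"])

lemma vandermonde_eq_0: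
  assumes "finite S" "a \<in> S" "b \<in> S" "a \<noteq> b" "H a = H b"
  shows "vandermonde S = 0"
  unfolding vandermonde_def
proof (rule prod_zero[OF assms(1)], intro bexI[OF _ assms(2)] prod_zero)
  show "\<exists>c\<in>S - {a}. H a - H c = 0" using assms by (intro bexI[of _ b]) auto
qed (use assms in auto)

lemma pigeonhole_fib:
  assumes "S \<subseteq> P" "finite P" "card (k ` P) < card S"
  shows "\<exists>a\<in>S. \<exists>b\<in>S. a \<noteq> b \<and> k a = k b"
proof -
  have "card (k ` S) \<le> card (k ` P)" using assms by (intro card_mono image_mono) auto
  then have "\<not> inj_on k S" using card_image[of k S] assms(3) by linarith
  then show ?thesis by (auto simp: inj_on_def)
qed

lemma disc_eq_0:
  assumes w: "R < norm w" and few: "card (H ` fib w) < sheets"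
  shows "disc w = 0"
  unfolding disc_def
proof (rule sum.neutral, intro ballI)
  fix S assume S: "S \<in> {S. S \<subseteq> fib w \<and> card S = sheets}"
  then obtain a b where "a \<in> S" "b \<in> S" "a \<noteq> b" "H a = H b"
    using pigeonhole_fib[of S "fib w" H] finite_fib[OF w] few by auto
  then show "vandermonde S = 0"
    using S finite_fib[OF w] finite_subset by (intro vandermonde_eq_0[of S a b]) auto
qed

text \<open>If \<open>H\<close> is injective on \<open>S\<close>, it maps \<open>S\<close> onto the
  whole set of values; all nonzero summands thus equal the same product \<open>P\<close> and cannot
  cancel.\<close>

lemma disc_neq_0:
  assumes w: "R < norm w" and eq: "card (H ` fib w) = sheets"
  shows "disc w \<noteq> 0"
proof -
  define Y where "Y = H ` fib w"
  define P where "P = (\<Prod>y\<in>Y. \<Prod>y'\<in>Y - {y}. y - y')"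
  define \<S> where "\<S> = {S. S \<subseteq> fib w \<and> card S = sheets}"
  have fin: "finite (fib w)" by (rule finite_fib[OF w])
  have f\<S>: "finite \<S>" unfolding \<S>_def by (rule finite_subsets_fib[OF w])
  have v: "vandermonde S = (if inj_on H S then P else 0)" if S: "S \<in> \<S>" for S
  proof (cases "inj_on H S")
    case True
    have "H ` S = Y"
      unfolding Y_def using S eq fin by (intro card_subset_eq) (auto simp: \<S>_def card_image[OF True])
    have "P = (\<Prod>a\<in>S. \<Prod>y'\<in>Y - {H a}. H a - y')"
      unfolding P_def \<open>H ` S = Y\<close>[symmetric] by (subst prod.reindex[OF True]) simp
    also have "\<dots> = vandermonde S"
      unfolding vandermonde_def
    proof (rule prod.cong[OF refl])
      fix a assume a: "a \<in> S"
      have "Y - {H a} = H ` (S - {a})" using True a \<open>H ` S = Y\<close> by (auto simp: inj_on_def)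
      then show "(\<Prod>y'\<in>Y - {H a}. H a - y') = (\<Prod>b\<in>S - {a}. H a - H b)"
        using True by (subst \<open>Y - {H a} = _\<close>, subst prod.reindex) (auto intro: inj_on_subset)
    qed
    finally show ?thesis using True by simp
  next
    case False
    then obtain a b where "a \<in> S" "b \<in> S" "a \<noteq> b" "H a = H b" by (auto simp: inj_on_def)
    then show ?thesis
      using False vandermonde_eq_0[of S a b] S fin finite_subset by (auto simp: \<S>_def)
  qed
  have "disc w = (\<Sum>S\<in>\<S>. if inj_on H S then P else 0)"
    unfolding disc_def \<S>_def[symmetric] by (rule sum.cong[OF refl v])
  also have "\<dots> = of_nat (card {S\<in>\<S>. inj_on H S}) * P"
    using f\<S> by (simp add: sum.If_cases Int_def)
  finally have d: "disc w = of_nat (card {S\<in>\<S>. inj_on H S}) * P" .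
  obtain S where "S \<subseteq> fib w" "inj_on H S" "H ` fib w = H ` S"
    using subset_image_inj[of "H ` fib w" H "fib w"] by auto
  then have "S \<in> {S\<in>\<S>. inj_on H S}" using eq by (auto simp: \<S>_def card_image)
  then have "card {S\<in>\<S>. inj_on H S} \<noteq> 0" using f\<S> by auto
  moreover have "P \<noteq> 0" unfolding P_def Y_def using fin by auto
  ultimately show ?thesis by (simp add: d)
qed

text \<open>Over an evenly covered disc the subsets of the fibre move along with the sections, so
  \<open>disc\<close> is a fixed polynomial in the holomorphic functions
  \<open>H (\<sigma> q x)\<close>.\<close>

lemma disc_holomorphic_base:
  assumes w: "w \<in> base"
  shows "\<exists>r>0. ball w r \<subseteq> base \<and> disc holomorphic_on ball w r"
proof -
  obtain r \<sigma> where r: "0 < r" "ball w r \<subseteq> base"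
    and hol: "\<And>q f. q \<in> fib w \<Longrightarrow> holomorphic_fun A f \<Longrightarrow> (\<lambda>x. f (\<sigma> q x)) holomorphic_on ball w r"
    and bij: "\<And>x. x \<in> ball w r \<Longrightarrow> bij_betw (\<lambda>q. \<sigma> q x) (fib w) (fib x)"
    using sections[OF w] by metis
  define \<S> where "\<S> = (\<lambda>x. {S. S \<subseteq> fib x \<and> card S = sheets})"
  have eq: "disc x = (\<Sum>S\<in>\<S> w. \<Prod>a\<in>S. \<Prod>b\<in>S - {a}. H (\<sigma> a x) - H (\<sigma> b x))" if x: "x \<in> ball w r" for x
  proof -
    define k where "k = (\<lambda>q. \<sigma> q x)"
    have inj: "inj_on k (fib w)" and im: "k ` fib w = fib x" using bij[OF x] by (auto simp: bij_betw_def k_def)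
    have injS: "inj_on k S" if "S \<in> \<S> w" for S using that inj by (auto simp: \<S>_def intro: inj_on_subset)
    have "bij_betw (image k) (\<S> w) (\<S> x)"
      unfolding bij_betw_def
    proof
      show "inj_on (image k) (\<S> w)"
        by (rule inj_on_subset[OF inj_on_image_Pow[OF inj]]) (auto simp: \<S>_def)
      show "image k ` \<S> w = \<S> x"
      proof
        show "image k ` \<S> w \<subseteq> \<S> x" using im injS by (auto simp: \<S>_def card_image)
        show "\<S> x \<subseteq> image k ` \<S> w"
        proof
          fix S assume S: "S \<in> \<S> x"
          then have "S \<subseteq> k ` fib w" by (simp add: \<S>_def im)
          then obtain T where "T \<subseteq> fib w" "S = k ` T" "inj_on k T" using subset_image_inj[of S k "fib w"] by auto
          then show "S \<in> image k ` \<S> w" using S by (auto simp: \<S>_def card_image)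
        qed
      qed
    qed
    then have "(\<Sum>S\<in>\<S> w. vandermonde (k ` S)) = (\<Sum>S\<in>\<S> x. vandermonde S)"
      by (rule sum.reindex_bij_betw)
    then have "disc x = (\<Sum>S\<in>\<S> w. vandermonde (k ` S))"
      unfolding disc_def \<S>_def by simp
    also have "\<dots> = (\<Sum>S\<in>\<S> w. \<Prod>a\<in>S. \<Prod>b\<in>S - {a}. H (\<sigma> a x) - H (\<sigma> b x))"
    proof (rule sum.cong[OF refl])
      fix S assume S: "S \<in> \<S> w"
      have "vandermonde (k ` S) = (\<Prod>a\<in>S. \<Prod>b\<in>k ` S - {k a}. H (k a) - H b)"
        unfolding vandermonde_def by (subst prod.reindex[OF injS[OF S]]) simp
      also have "\<dots> = (\<Prod>a\<in>S. \<Prod>b\<in>S - {a}. H (k a) - H (k b))"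
      proof (rule prod.cong[OF refl])
        fix a assume a: "a \<in> S"
        have "k ` S - {k a} = k ` (S - {a})" using injS[OF S] a by (auto simp: inj_on_def)
        then show "(\<Prod>b\<in>k ` S - {k a}. H (k a) - H b) = (\<Prod>b\<in>S - {a}. H (k a) - H (k b))"
          using injS[OF S] by (subst \<open>k ` S - {k a} = _\<close>, subst prod.reindex) (auto intro: inj_on_subset)
      qed
      finally show "vandermonde (k ` S) = (\<Prod>a\<in>S. \<Prod>b\<in>S - {a}. H (\<sigma> a x) - H (\<sigma> b x))" by (simp add: k_def)
    qed
    finally show ?thesis .
  qed
  have "(\<lambda>x. \<Sum>S\<in>\<S> w. \<Prod>a\<in>S. \<Prod>b\<in>S - {a}. H (\<sigma> a x) - H (\<sigma> b x)) holomorphic_on ball w r"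
    using hol[OF _ holH] by (intro holomorphic_intros) (auto simp: \<S>_def)
  then have "disc holomorphic_on ball w r" using eq by (subst holomorphic_cong[OF refl eq]) auto
  then show ?thesis using r by blast
qed

text \<open>There are at most \<open>m\<close> rows of at most \<open>m\<close> factors, and
  \<open>1 \<le> B\<close> allows missing factors to be replaced by \<open>B\<close>. The second
  bound isolates one factor, for use when two values of \<open>H\<close> nearly collide.\<close>

lemma vandermonde_bound:
  assumes S: "finite S" "card S = m" and B: "1 \<le> B" "\<And>a b. a \<in> S \<Longrightarrow> b \<in> S \<Longrightarrow> norm (H a - H b) \<le> B"
  shows "norm (vandermonde S) \<le> B ^ (m * m)"
    "\<And>a b. a \<in> S \<Longrightarrow> b \<in> S \<Longrightarrow> a \<noteq> b \<Longrightarrow> norm (vandermonde S) \<le> norm (H a - H b) * B ^ (m + m * m)"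
proof -
  have row: "norm (\<Prod>b\<in>T. H a - H b) \<le> B ^ m" if "a \<in> S" "T \<subseteq> S" for a T
  proof -
    have "norm (\<Prod>b\<in>T. H a - H b) = (\<Prod>b\<in>T. norm (H a - H b))" by (simp add: prod_norm)
    also have "\<dots> \<le> B ^ m"
      using that B S card_mono[OF S(1) that(2)] by (intro prod_le_power) auto
    finally show ?thesis .
  qed
  have all: "norm (\<Prod>a\<in>T. \<Prod>b\<in>S - {a}. H a - H b) \<le> B ^ (m * m)" if "T \<subseteq> S" for T
  proof -
    have "norm (\<Prod>a\<in>T. \<Prod>b\<in>S - {a}. H a - H b) = (\<Prod>a\<in>T. norm (\<Prod>b\<in>S - {a}. H a - H b))" by (simp add: prod_norm)
    also have "\<dots> \<le> (B ^ m) ^ m"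
      using that row B S card_mono[OF S(1) that] by (intro prod_le_power) (auto intro: one_le_power)
    finally show ?thesis by (simp add: power_mult)
  qed
  show "norm (vandermonde S) \<le> B ^ (m * m)" unfolding vandermonde_def by (rule all) simp
  fix a b assume ab: "a \<in> S" "b \<in> S" "a \<noteq> b"
  have "vandermonde S = (\<Prod>c\<in>S - {a}. H a - H c) * (\<Prod>a'\<in>S - {a}. \<Prod>b\<in>S - {a'}. H a' - H b)"
    unfolding vandermonde_def by (rule prod.remove[OF S(1) ab(1)])
  also have "(\<Prod>c\<in>S - {a}. H a - H c) = (H a - H b) * (\<Prod>c\<in>S - {a} - {b}. H a - H c)"
    using ab S by (intro prod.remove) auto
  finally have "norm (vandermonde S) = norm (H a - H b) * (norm (\<Prod>c\<in>S - {a} - {b}. H a - H c) *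
      norm (\<Prod>a'\<in>S - {a}. \<Prod>b\<in>S - {a'}. H a' - H b))" by (simp add: norm_mult)
  also have "\<dots> \<le> norm (H a - H b) * (B ^ m * B ^ (m * m))"
    using ab B row[of a "S - {a} - {b}"] all[of "S - {a}"] by (intro mult_left_mono mult_mono) auto
  finally show "norm (vandermonde S) \<le> norm (H a - H b) * B ^ (m + m * m)" by (simp add: power_add)
qed

lemma fib_diff_bound: "a \<in> fib w \<Longrightarrow> b \<in> fib w \<Longrightarrow> norm (H a - H b) \<le> 2 * norm w"
  using norm_triangle_ineq4[of "H a" "H b"] by (auto simp: fib_def)

lemma disc_sum_bound:
  assumes w: "w \<in> base" and B: "\<And>S. S \<subseteq> fib w \<Longrightarrow> card S = sheets \<Longrightarrow> norm (vandermonde S) \<le> B" "0 \<le> B"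
  shows "norm (disc w) \<le> 2 ^ card (fib w) * B"
proof -
  have Rw: "R < norm w" using w by (simp add: base_def)
  have "norm (disc w) \<le> of_nat (card {S. S \<subseteq> fib w \<and> card S = sheets}) * B"
    unfolding disc_def using B by (intro sum_norm_bound) auto
  also have "card {S. S \<subseteq> fib w \<and> card S = sheets} \<le> card (Pow (fib w))"
    using finite_fib[OF Rw] by (intro card_mono) auto
  then have "of_nat (card {S. S \<subseteq> fib w \<and> card S = sheets}) * B \<le> 2 ^ card (fib w) * B"
    using B(2) finite_fib[OF Rw] by (intro mult_right_mono) (simp_all add: card_Pow flip: of_nat_power of_nat_le_iff)
  finally show ?thesis .
qed


text \<open>The critical fibre has fewer than \<open>sheets\<close> values. Among
  \<open>sheets\<close> points of a nearby fibre, two must have values of \<open>H\<close> close to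
  the same one, and their difference is a small factor of the Vandermonde product.\<close>

lemma disc_tendsto_0:
  assumes w: "w \<in> crit"
  shows "(disc \<longlongrightarrow> 0) (at w)"
proof (rule tendstoI)
  fix \<epsilon> :: real assume \<epsilon>: "0 < \<epsilon>"
  obtain d where d: "\<And>w. w \<in> base \<Longrightarrow> card (fib w) = d" using card_fib_base by metis
  have Rw: "R < norm w" using w by (simp add: crit_def)
  define Y where "Y = H ` fib w"
  define B where "B = 2 * (norm w + 1)"
  have B: "1 \<le> B" using norm_ge_zero[of w] by (simp add: B_def)
  define K where "K = 2 ^ d * B ^ (sheets + sheets * sheets)"
  have K: "0 \<le> K" using B by (simp add: K_def)
  \<comment> \<open>Chosen so that at most \<open>2 ^ d\<close> summands, each bounded by
    \<open>2 * \<eta>\<close> times the power of \<open>B\<close>, stay below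
    \<open>\<epsilon>\<close> in total.\<close>
  define \<eta> where "\<eta> = \<epsilon> / (2 * (K + 1))"
  have \<eta>: "0 < \<eta>" "K * (2 * \<eta>) < \<epsilon>" using \<epsilon> K by (auto simp: \<eta>_def field_simps)
  define Q where "Q = (\<Union>y\<in>Y. {p \<in> topspace X. H p \<in> ball y \<eta>})"
  have "openin X Q" unfolding Q_def using openin_holomorphic_preimage[OF holH open_ball] by blast
  moreover have "fib w \<subseteq> Q" using \<eta>(1) by (auto simp: Q_def Y_def fib_def)
  ultimately obtain r0 where r0: "0 < r0" "\<And>x. x \<in> ball w r0 \<Longrightarrow> fib x \<subseteq> Q" using tube by metis
  obtain r1 where r1: "0 < r1" "\<forall>x\<in>ball w r1. R < norm x \<and> (x \<noteq> w \<longrightarrow> x \<notin> crit)"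
    using crit_isolated[OF Rw] by blast
  have "norm (disc x) < \<epsilon>" if x: "x \<noteq> w" "dist w x < min r0 (min r1 1)" for x
  proof -
    have xb: "x \<in> base" using r1 x by (auto simp: base_def)
    have nx: "norm x \<le> norm w + 1"
      using x norm_triangle_ineq2[of x w] by (simp add: dist_norm norm_minus_commute)
    have "\<exists>y\<in>Y. dist y (H p) < \<eta>" if "p \<in> fib x" for p using r0(2)[of x] x that by (auto simp: Q_def)
    then obtain k where k: "\<And>p. p \<in> fib x \<Longrightarrow> k p \<in> Y \<and> dist (k p) (H p) < \<eta>" by metis
    have finx: "finite (fib x)" using finite_fib[of x] xb by (auto simp: base_def)
    have finY: "finite Y" using finite_fib[OF Rw] by (simp add: Y_def)
    have "card (k ` fib x) \<le> card Y" using k finY by (intro card_mono) auto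
    then have few: "card (k ` fib x) < sheets" using crit_fewer_values[OF w] by (simp add: Y_def)
    have "norm (vandermonde S) \<le> 2 * \<eta> * B ^ (sheets + sheets * sheets)" if S: "S \<subseteq> fib x" "card S = sheets" for S
    proof -
      obtain a b where ab: "a \<in> S" "b \<in> S" "a \<noteq> b" "k a = k b"
        using pigeonhole_fib[OF S(1) finx, of k] few S(2) by auto
      have "dist (k a) (H a) < \<eta>" "dist (k a) (H b) < \<eta>" using k ab S by (metis subsetD)+
      then have "norm (H a - H b) \<le> 2 * \<eta>"
        using dist_triangle3[of "H a" "H b" "k a"] by (simp add: dist_norm)
      moreover have "norm (H p - H q) \<le> B" if "p \<in> S" "q \<in> S" for p q
        using fib_diff_bound[of p x q] subsetD[OF S(1) that(1)] subsetD[OF S(1) that(2)] nx by (simp add: B_def)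
      then have "norm (vandermonde S) \<le> norm (H a - H b) * B ^ (sheets + sheets * sheets)"
        using finite_subset[OF S(1) finx] S(2) B ab by (intro vandermonde_bound(2)) auto
      ultimately show ?thesis using B by (smt (verit) mult_right_mono zero_le_power)
    qed
    then have "norm (disc x) \<le> 2 ^ card (fib x) * (2 * \<eta> * B ^ (sheets + sheets * sheets))"
      using \<eta>(1) B by (intro disc_sum_bound[OF xb]) auto
    also have "\<dots> = K * (2 * \<eta>)" by (simp add: K_def d[OF xb])
    finally show ?thesis using \<eta>(2) by simp
  qed
  then show "\<forall>\<^sub>F x in at w. dist (disc x) 0 < \<epsilon>"
    unfolding eventually_at using r0(1) r1(1)
    by (intro exI[of _ "min r0 (min r1 1)"]) (auto simp: dist_commute)
qed

text \<open>Critical values are isolated, and \<open>disc\<close> is continuous there with value 0,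
  so the singularities are removable.\<close>

lemma disc_holomorphic: "disc holomorphic_on {w. R < norm w}"
proof -
  have o: "open {w::complex. R < norm w}" by (intro open_Collect_less continuous_intros)
  have "disc field_differentiable at w" if w: "R < norm w" for w
  proof (cases "w \<in> crit")
    case False
    then have "w \<in> base" using w by (simp add: base_def)
    then obtain r where "0 < r" "disc holomorphic_on ball w r" using disc_holomorphic_base by blast
    then show ?thesis by (auto intro: holomorphic_on_imp_differentiable_at[of _ "ball w r"])
  next
    case True
    obtain r where r: "0 < r" "\<forall>x\<in>ball w r. R < norm x \<and> (x \<noteq> w \<longrightarrow> x \<notin> crit)"
      using crit_isolated[OF w] by blast
    have diff: "disc field_differentiable at x" if "x \<in> ball w r - {w}" for x
    proof -
      have "x \<in> base" using r(2) that by (auto simp: base_def)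
      then obtain r where "0 < r" "disc holomorphic_on ball x r" using disc_holomorphic_base by blast
      then show ?thesis by (auto intro: holomorphic_on_imp_differentiable_at[of _ "ball x r"])
    qed
    have "isCont disc x" if "x \<in> ball w r" for x
    proof (cases "x = w")
      case True
      have "disc w = 0" by (rule disc_eq_0[OF w crit_fewer_values[OF \<open>w \<in> crit\<close>]])
      then show ?thesis using disc_tendsto_0[OF \<open>w \<in> crit\<close>] True by (simp add: isCont_def)
    next
      case False
      then show ?thesis using diff[of x] that by (simp add: field_differentiable_imp_continuous_at)
    qed
    then have "continuous_on (ball w r) disc" by (simp add: continuous_at_imp_continuous_on)
    moreover have "disc holomorphic_on ball w r - {w}"
      unfolding holomorphic_on_def using diff field_differentiable_at_within by blast
    ultimately have "disc holomorphic_on ball w r" by (rule no_isolated_singularity) auto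
    then show ?thesis using r(1) by (auto intro: holomorphic_on_imp_differentiable_at[of _ "ball w r"])
  qed
  then show ?thesis unfolding holomorphic_on_def using field_differentiable_at_within by blast
qed

lemma nonzero_near_puncture:
  fixes g :: "complex \<Rightarrow> complex"
  assumes g: "g holomorphic_on ball 0 s" and b: "\<beta> \<in> ball 0 s" "g \<beta> \<noteq> 0" and s: "0 < s"
  shows "\<exists>\<rho>>0. \<forall>t. 0 < norm t \<and> norm t < \<rho> \<longrightarrow> g t \<noteq> 0"
proof (cases "g 0 = 0")
  case True
  obtain \<rho> where "0 < \<rho>" "\<And>z. z \<in> ball 0 \<rho> - {0} \<Longrightarrow> g z \<noteq> 0"
    by (rule isolated_zeros[OF g open_ball connected_ball _ True b]) (use s in auto)
  then show ?thesis by (intro exI[of _ \<rho>]) auto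
next
  case False
  have "isCont g 0"
    using holomorphic_on_imp_continuous_on[OF g] s by (simp add: continuous_on_eq_continuous_at)
  then obtain e where "0 < e" "\<And>z. dist 0 z < e \<Longrightarrow> g z \<noteq> 0"
    using continuous_at_avoid[of 0 g 0] False by auto
  then show ?thesis by (intro exI[of _ e]) auto
qed

text \<open>\<open>disc\<close> has at most a pole at infinity and is nonzero at a base point where
  the count \<open>sheets\<close> is attained. Its zeros, among them all critical values, therefore
  cannot accumulate at infinity.\<close>

lemma generic_near_infinity:
  obtains R1 where "R \<le> R1" "\<And>w. R1 < norm w \<Longrightarrow> w \<in> base \<and> card (H ` fib w) = sheets"
proof -
  obtain d where d: "\<And>w. w \<in> base \<Longrightarrow> card (fib w) = d" using card_fib_base by metis
  \<comment> \<open>A Vandermonde product over \<open>sheets\<close> points has at most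
    \<open>M\<close> factors, each of linear growth in \<open>w\<close>; multiplication by
    \<open>t ^ M\<close> makes \<open>disc (inverse t)\<close> bounded near 0.\<close>
  define M where "M = sheets * sheets"
  define E where "E = (\<lambda>t. t ^ M * disc (inverse t))"
  define s where "s = 1 / R"
  have s: "0 < s" using R(1) by (simp add: s_def)
  have inv: "R < norm (inverse t)" if "t \<in> ball 0 s - {0}" for t :: complex
    using that R(1) by (auto simp: s_def norm_inverse norm_divide field_simps)
  have "(disc \<circ> inverse) holomorphic_on (ball 0 s - {0})"
    by (rule holomorphic_on_compose_gen[OF _ disc_holomorphic]) (use inv in \<open>auto intro!: holomorphic_intros\<close>)
  then have "E holomorphic_on (ball 0 s - {0})"
    unfolding E_def o_def by (intro holomorphic_intros)
  moreover have "\<forall>\<^sub>F t in at 0. norm (E t) \<le> 2 ^ d * (2 + s) ^ M"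
  proof -
    have "\<forall>\<^sub>F t in at 0. t \<in> ball 0 s - {0::complex}"
      using s by (auto simp: eventually_at_filter intro: eventually_nhds_in_open[THEN eventually_mono, of "ball 0 s"])
    then show ?thesis
    proof eventually_elim
      case (elim t)
      define w where "w = inverse t"
      have t: "t \<noteq> 0" "norm t < s" using elim by auto
      show ?case
      proof (cases "w \<in> base")
        case True
        then have fw: "finite (fib w)" using finite_fib[of w] by (auto simp: base_def)
        have v: "norm (vandermonde S) \<le> (2 * norm w + 1) ^ M" if S: "S \<subseteq> fib w" "card S = sheets" for S
          unfolding M_def
        proof (rule vandermonde_bound(1)[OF finite_subset[OF S(1) fw] S(2)])
          show "norm (H a - H b) \<le> 2 * norm w + 1" if "a \<in> S" "b \<in> S" for a b
            using fib_diff_bound[OF subsetD[OF S(1) that(1)] subsetD[OF S(1) that(2)]] by simp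
        qed simp
        have "norm (disc w) \<le> 2 ^ d * (2 * norm w + 1) ^ M"
          using disc_sum_bound[OF True v] d[OF True] by simp
        then have "norm (E t) \<le> norm t ^ M * (2 ^ d * (2 * norm w + 1) ^ M)"
          unfolding E_def w_def by (simp add: norm_mult norm_power mult_left_mono)
        also have "\<dots> = 2 ^ d * (norm t * (2 * norm w + 1)) ^ M" by (simp add: power_mult_distrib)
        also have "norm t * (2 * norm w + 1) = 2 + norm t"
          using t by (simp add: w_def norm_inverse norm_divide field_simps)
        also have "2 ^ d * (2 + norm t) ^ M \<le> 2 ^ d * (2 + s) ^ M"
          using t by (intro mult_left_mono power_mono) auto
        finally show ?thesis .
      next
        case False
        then have "w \<in> crit" "R < norm w" using inv[OF elim] by (auto simp: base_def w_def)
        then have "disc w = 0" using disc_eq_0 crit_fewer_values by blast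
        then show ?thesis using s by (simp add: E_def w_def)
      qed
    qed
  qed
  ultimately obtain g where g: "g holomorphic_on ball 0 s" "\<And>t. t \<in> ball 0 s - {0} \<Longrightarrow> g t = E t"
    using holomorphic_on_extend_bounded[of E "ball 0 s" 0] s by (auto simp: interior_open)
  obtain b where b: "b \<in> base" "card (H ` fib b) = sheets" using sheets(2) by blast
  then have Rb: "R < norm b" by (simp add: base_def)
  have b0: "b \<noteq> 0" using Rb R(1) by auto
  have bs: "inverse b \<in> ball 0 s - {0}"
    using Rb b0 R(1) by (auto simp: s_def norm_inverse norm_divide field_simps)
  have "disc b \<noteq> 0" by (rule disc_neq_0[OF Rb b(2)])
  then have "g (inverse b) \<noteq> 0" using g(2)[OF bs] b0 by (simp add: E_def)
  then obtain \<rho> where \<rho>: "0 < \<rho>" "\<And>t. 0 < norm t \<Longrightarrow> norm t < \<rho> \<Longrightarrow> g t \<noteq> 0"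
    using nonzero_near_puncture[OF g(1) _ _ s, of "inverse b"] bs by blast
  show thesis
  proof (rule that[of "max R (1 / \<rho>)"])
    fix w :: complex assume w: "max R (1 / \<rho>) < norm w"
    then have Rw: "R < norm w" and "1 / \<rho> < norm w" by auto
    have w0: "w \<noteq> 0" using Rw R(1) by auto
    have "norm (inverse w) < \<rho>" "inverse w \<in> ball 0 s - {0}"
      using \<rho>(1) \<open>1 / \<rho> < norm w\<close> Rw w0 R(1) by (auto simp: s_def norm_inverse norm_divide field_simps)
    then have "E (inverse w) \<noteq> 0" using \<rho>(2)[of "inverse w"] g(2)[of "inverse w"] w0 by auto
    then have nz: "disc w \<noteq> 0" by (simp add: E_def)
    then have "w \<notin> crit" using disc_eq_0[OF Rw crit_fewer_values] by blast
    then have wb: "w \<in> base" using Rw by (simp add: base_def)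
    moreover have "\<not> card (H ` fib w) < sheets" using disc_eq_0[OF Rw] nz by blast
    ultimately show "w \<in> base \<and> card (H ` fib w) = sheets" using sheets(1)[OF wb] by simp
  qed simp
qed

text \<open>Each value is followed along the section through one chosen point of the fibre. Distinct
  values stay distinct nearby, and since every fibre concerned has exactly \<open>sheets\<close>
  values, these are all of them.\<close>

lemma local_branches_fib:
  assumes gen: "\<And>w. R1 < norm w \<Longrightarrow> w \<in> base \<and> card (H ` fib w) = sheets" and w: "R1 < norm w"
  shows "\<exists>r \<beta>. local_branches (\<lambda>w. H ` fib w) w r \<beta>"
proof -
  define Y where "Y = H ` fib w"
  have wb: "w \<in> base" using gen[OF w] by simp
  have finw: "finite (fib x)" if "R1 < norm x" for x using finite_fib[of x] gen[OF that] by (auto simp: base_def)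
  have finY: "finite Y" using finw[OF w] by (simp add: Y_def)
  obtain r \<sigma> where r: "0 < r" "ball w r \<subseteq> base" and \<sigma>w: "\<And>q. q \<in> fib w \<Longrightarrow> \<sigma> q w = q"
    and hol: "\<And>q f. q \<in> fib w \<Longrightarrow> holomorphic_fun A f \<Longrightarrow> (\<lambda>x. f (\<sigma> q x)) holomorphic_on ball w r"
    and bij: "\<And>x. x \<in> ball w r \<Longrightarrow> bij_betw (\<lambda>q. \<sigma> q x) (fib w) (fib x)"
    using sections[OF wb] by metis
  have "\<exists>q. q \<in> fib w \<and> H q = y" if "y \<in> Y" for y using that by (auto simp: Y_def)
  then obtain rep where rep: "\<And>y. y \<in> Y \<Longrightarrow> rep y \<in> fib w \<and> H (rep y) = y" by metis
  define \<beta> where "\<beta> = (\<lambda>y x. H (\<sigma> (rep y) x))"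
  have \<beta>hol: "\<beta> y holomorphic_on ball w r" if "y \<in> Y" for y
    unfolding \<beta>_def using hol[OF _ holH] rep[OF that] by blast
  have \<beta>w: "\<beta> y w = y" if "y \<in> Y" for y using rep[OF that] \<sigma>w by (simp add: \<beta>_def)
  have "\<forall>\<^sub>F x in nhds w. \<beta> y x \<noteq> \<beta> y' x" if y: "y \<in> Y" "y' \<in> Y - {y}" for y y'
  proof -
    have "isCont (\<lambda>x. \<beta> y x - \<beta> y' x) w"
      using holomorphic_on_imp_continuous_on[OF \<beta>hol] y r(1)
      by (intro continuous_diff) (auto simp: continuous_on_eq_continuous_at)
    moreover have "\<beta> y w - \<beta> y' w \<noteq> 0" using \<beta>w y by auto
    ultimately obtain e where "0 < e" "\<And>z. dist w z < e \<Longrightarrow> \<beta> y z - \<beta> y' z \<noteq> 0"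
      using continuous_at_avoid[of w "\<lambda>x. \<beta> y x - \<beta> y' x" 0] by auto
    then show ?thesis unfolding eventually_nhds_metric by (intro exI[of _ e]) (auto simp: dist_commute)
  qed
  then have "\<forall>\<^sub>F x in nhds w. \<forall>y\<in>Y. \<forall>y'\<in>Y - {y}. \<beta> y x \<noteq> \<beta> y' x"
    using finY by (intro eventually_ball_finite ballI) auto
  moreover have "\<forall>\<^sub>F x in nhds w. x \<in> {x. R1 < norm x}"
    using w by (intro eventually_nhds_in_open open_Collect_less continuous_intros) auto
  ultimately have "\<forall>\<^sub>F x in nhds w. (\<forall>y\<in>Y. \<forall>y'\<in>Y - {y}. \<beta> y x \<noteq> \<beta> y' x) \<and> R1 < norm x"
    by eventually_elim auto
  then obtain e where e: "0 < e" "\<And>x. dist x w < e \<Longrightarrow> (\<forall>y\<in>Y. \<forall>y'\<in>Y - {y}. \<beta> y x \<noteq> \<beta> y' x) \<and> R1 < norm x"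
    unfolding eventually_nhds_metric by blast
  define \<rho> where "\<rho> = min r e"
  have "local_branches (\<lambda>w. H ` fib w) w \<rho> \<beta>"
    unfolding local_branches_def Y_def[symmetric]
  proof (intro conjI ballI)
    show "\<beta> y holomorphic_on ball w \<rho>" if "y \<in> Y" for y
      by (rule holomorphic_on_subset[OF \<beta>hol[OF that]]) (auto simp: \<rho>_def)
    fix x assume "x \<in> ball w \<rho>"
    then have x: "x \<in> ball w r" "dist x w < e" by (auto simp: \<rho>_def dist_commute)
    have inj: "inj_on (\<lambda>y. \<beta> y x) Y" using e(2)[OF x(2)] by (auto simp: inj_on_def)
    have "(\<lambda>y. \<beta> y x) ` Y \<subseteq> H ` fib x"
      using bij_betw_apply[OF bij[OF x(1)]] rep by (auto simp: \<beta>_def)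
    moreover have "card ((\<lambda>y. \<beta> y x) ` Y) = card (H ` fib x)"
      using gen[OF w] gen[of x] e(2)[OF x(2)] unfolding card_image[OF inj] by (simp add: Y_def)
    ultimately have "(\<lambda>y. \<beta> y x) ` Y = H ` fib x"
      using finw[of x] e(2)[OF x(2)] by (intro card_subset_eq) auto
    then show "bij_betw (\<lambda>y. \<beta> y x) Y (H ` fib x)" using inj by (simp add: bij_betw_def)
  qed (use finY \<beta>w r(1) e(1) in \<open>auto simp: \<rho>_def\<close>)
  then show ?thesis by blast
qed

theorem end_structure:
  obtains R' C \<delta> d where "R \<le> R'" "0 < C" "0 < \<delta>"
    "\<And>p. p \<in> tail R' \<Longrightarrow> regular_at A G p"
    "\<And>w. R' < norm w \<Longrightarrow> finite (fib w) \<and> card (fib w) = d"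
    "\<And>w h S. \<lbrakk>R' < norm w; open S; w \<in> S; h holomorphic_on S; \<And>x. x \<in> S \<Longrightarrow> h x \<in> H ` fib x\<rbrakk> \<Longrightarrow>
       (norm (deriv (deriv h) w))\<^sup>2 \<le> C * norm w powr (-2 - \<delta>) * norm (deriv h w) \<and>
       norm (deriv h w) \<le> C \<and> (deriv h w = 0 \<longrightarrow> (\<forall>\<^sub>F x in nhds w. deriv h x = 0))"
proof -
  obtain d where d: "\<And>w. w \<in> base \<Longrightarrow> card (fib w) = d" using card_fib_base by metis
  obtain R1 where R1: "R \<le> R1" "\<And>w. R1 < norm w \<Longrightarrow> w \<in> base \<and> card (H ` fib w) = sheets"
    using generic_near_infinity by metis
  have R1pos: "0 < R1" using R(1) R1(1) by simp
  have card: "card (H ` fib w) = sheets" if "R1 < norm w" for w using R1(2)[OF that] by simp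
  have bnd: "norm y \<le> norm w" if "R1 < norm w" "y \<in> H ` fib w" for w y using that by (auto simp: fib_def)
  show thesis
  proof (rule algebraic_branch_bound[OF R1pos card local_branches_fib[OF R1(2)] bnd])
    fix R' C \<delta> :: real
    assume R': "R1 \<le> R'" "0 < C" "0 < \<delta>" and *:
      "\<And>w h S. \<lbrakk>R' < norm w; open S; w \<in> S; h holomorphic_on S; \<And>x. x \<in> S \<Longrightarrow> h x \<in> H ` fib x\<rbrakk> \<Longrightarrow>
       (norm (deriv (deriv h) w))\<^sup>2 \<le> C * norm w powr (-2 - \<delta>) * norm (deriv h w) \<and>
       norm (deriv h w) \<le> C \<and> (deriv h w = 0 \<longrightarrow> (\<forall>\<^sub>F x in nhds w. deriv h x = 0))"
    show thesis
    proof (rule that[OF _ R'(2,3) _ _ *])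
      show "R \<le> R'" using R1 R' by simp
      show "regular_at A G p" if "p \<in> tail R'" for p
      proof -
        have "R1 < norm (G p)" using that R'(1) by (auto simp: tail_def)
        then have "G p \<in> base" using R1(2) by blast
        then show ?thesis using tail_fib[OF that] by (auto simp: base_def crit_def)
      qed
      show "finite (fib w) \<and> card (fib w) = d" if "R' < norm w" for w
        using R1(2)[of w] d[of w] finite_fib[of w] that R'(1) R1(1) by simp
    qed
  qed
qed

end

section \<open>Finite total curvature\<close>

text \<open>For the two ends \<open>e\<close> is \<open>\<i>\<close> or \<open>- \<i>\<close>;
  \<open>x\<close> is the coordinate \<open>G\<close> and \<open>h\<close> is \<open>H\<close> in
  this coordinate. Sum and difference of the first two components are known, so \<open>h'\<close>
  determines their derivatives and, by nullity, the square of the third.\<close>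

lemma null_curve_graph_bound:
  fixes g :: "complex \<Rightarrow> complex ^ 3" and e :: complex
  defines "h \<equiv> \<lambda>x. g x $ 1 - e * g x $ 2"
  assumes S: "open S" and hol: "\<And>j. (\<lambda>x. g x $ j) holomorphic_on S"
    and e: "e\<^sup>2 = -1" and id: "\<And>x. x \<in> S \<Longrightarrow> g x $ 1 + e * g x $ 2 = x"
    and null: "\<And>x. x \<in> S \<Longrightarrow> (\<Sum>j\<in>UNIV. (velocity g x $ j)\<^sup>2) = 0"
  shows "\<And>x. x \<in> S \<Longrightarrow> 1 / 2 \<le> (norm (velocity g x))\<^sup>2"
    and "\<And>w q C. \<lbrakk>w \<in> S; (norm (deriv (deriv h) w))\<^sup>2 \<le> q * norm (deriv h w); norm (deriv h w) \<le> C;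
       deriv h w = 0 \<Longrightarrow> \<forall>\<^sub>F x in nhds w. deriv h x = 0; 0 \<le> q\<rbrakk>
     \<Longrightarrow> 2 * (norm (acceleration g w))\<^sup>2 / (norm (velocity g w))\<^sup>2 \<le> (2 * C + 1) * q"
proof -
  have e0: "e \<noteq> 0" using e by auto
  have ne: "norm e = 1"
  proof -
    have "(norm e)\<^sup>2 = 1" using arg_cong[OF e, of norm] by (simp add: norm_power)
    then show ?thesis using norm_ge_zero[of e] unfolding power2_eq_1_iff by linarith
  qed
  define a where "a = (\<lambda>j x. deriv (\<lambda>x. g x $ j) x)"
  have va: "velocity g x $ j = a j x" for x j by (simp add: velocity_def a_def)
  have acc: "acceleration g x $ j = deriv (a j) x" for x j by (simp add: acceleration_def a_def)
  have da: "((\<lambda>x. g x $ j) has_field_derivative a j x) (at x)" if "x \<in> S" for j x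
    unfolding a_def by (rule holomorphic_derivI[OF hol S that])
  have hola: "a j holomorphic_on S" for j unfolding a_def by (rule holomorphic_deriv[OF hol S])
  have dda: "(a j has_field_derivative deriv (a j) x) (at x)" if "x \<in> S" for j x
    by (rule holomorphic_derivI[OF hola S that])
  have hh: "deriv h x = a 1 x - e * a 2 x" if "x \<in> S" for x
    unfolding h_def by (rule DERIV_imp_deriv) (auto intro!: derivative_eq_intros da[OF that])
  have one: "a 1 x + e * a 2 x = 1" if x: "x \<in> S" for x
  proof -
    have "((\<lambda>x. g x $ 1 + e * g x $ 2) has_field_derivative (a 1 x + e * a 2 x)) (at x)"
      by (auto intro!: derivative_eq_intros da[OF x])
    moreover have "((\<lambda>x. g x $ 1 + e * g x $ 2) has_field_derivative 1) (at x)"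
      by (rule has_field_derivative_transform_within_open[OF DERIV_ident S x]) (simp add: id)
    ultimately show ?thesis by (rule DERIV_unique)
  qed
  have a1: "a 1 x = (1 + deriv h x) / 2" if "x \<in> S" for x
  proof -
    have "1 + deriv h x = (a 1 x + e * a 2 x) + (a 1 x - e * a 2 x)" using one[OF that] hh[OF that] by simp
    also have "\<dots> = 2 * a 1 x" by simp
    finally show ?thesis by simp
  qed
  have a2: "a 2 x = (1 - deriv h x) / (2 * e)" if "x \<in> S" for x
  proof -
    have "1 - deriv h x = (a 1 x + e * a 2 x) - (a 1 x - e * a 2 x)" using one[OF that] hh[OF that] by simp
    also have "\<dots> = 2 * e * a 2 x" by simp
    finally show ?thesis using e0 by simp
  qed
  have a3: "(a 3 x)\<^sup>2 = - deriv h x" if "x \<in> S" for x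
  proof -
    have "(a 1 x)\<^sup>2 + (a 2 x)\<^sup>2 + (a 3 x)\<^sup>2 = 0" using null[OF that] by (simp add: sum_3 va)
    moreover have "(a 1 x)\<^sup>2 + (a 2 x)\<^sup>2 = deriv h x"
      unfolding a1[OF that] a2[OF that] power_divide power_mult_distrib e by (simp add: field_simps power2_eq_square)
    ultimately show ?thesis by (simp add: eq_neg_iff_add_eq_0 add.commute)
  qed
  have par: "(norm (1 + u))\<^sup>2 + (norm (1 - u))\<^sup>2 = 2 + 2 * (norm u)\<^sup>2" for u :: complex
    unfolding cmod_power2 by (simp add: power2_eq_square algebra_simps)
  \<comment> \<open>By the parallelogram law the first two components alone contribute
    \<open>(1 + |h'|^2) / 2\<close>.\<close>
  show E: "1 / 2 \<le> (norm (velocity g x))\<^sup>2" if x: "x \<in> S" for x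
  proof -
    have "1 / 2 \<le> ((norm (1 + deriv h x))\<^sup>2 + (norm (1 - deriv h x))\<^sup>2) / 4" unfolding par by simp
    also have "\<dots> = (norm (a 1 x))\<^sup>2 + (norm (a 2 x))\<^sup>2"
      by (simp add: a1[OF x] a2[OF x] norm_divide norm_mult ne power_divide)
    also have "\<dots> \<le> (norm (velocity g x))\<^sup>2" by (simp add: norm_vec_sqr sum_3 va)
    finally show ?thesis .
  qed
  fix w q C assume w: "w \<in> S" and q: "(norm (deriv (deriv h) w))\<^sup>2 \<le> q * norm (deriv h w)" "norm (deriv h w) \<le> C"
    "deriv h w = 0 \<Longrightarrow> \<forall>\<^sub>F x in nhds w. deriv h x = 0" "0 \<le> q"
  have evS: "\<forall>\<^sub>F x in nhds w. x \<in> S" by (rule eventually_nhds_in_open[OF S w])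
  have holh: "h holomorphic_on S" unfolding h_def using hol by (intro holomorphic_intros)
  have ddh: "(deriv h has_field_derivative deriv (deriv h) w) (at w)"
    by (rule holomorphic_derivI[OF holomorphic_deriv[OF holh S] S w])
  define D where "D = deriv (deriv h) w"
  have b1: "deriv (a 1) w = D / 2"
  proof -
    have "((\<lambda>x. (1 + deriv h x) / 2) has_field_derivative D / 2) (at w)"
      unfolding D_def by (auto intro!: derivative_eq_intros ddh)
    then show ?thesis
      using deriv_cong_ev[OF eventually_mono[OF evS a1] refl] by (simp add: DERIV_imp_deriv)
  qed
  have b2: "deriv (a 2) w = - D / (2 * e)"
  proof -
    have "((\<lambda>x. (1 - deriv h x) / (2 * e)) has_field_derivative - D / (2 * e)) (at w)"
      unfolding D_def using e0 by (auto intro!: derivative_eq_intros ddh)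
    then show ?thesis
      using deriv_cong_ev[OF eventually_mono[OF evS a2] refl] by (simp add: DERIV_imp_deriv)
  qed
  \<comment> \<open>Differentiating \<open>(a 3)^2 = - h'\<close> gives
    \<open>4 |h'| |a 3'|^2 = |h''|^2\<close>. At a zero of \<open>h'\<close>, where one cannot
    divide, \<open>h'\<close> and hence \<open>a 3\<close> vanish in a whole neighbourhood.\<close>
  have b3: "(norm (deriv (a 3) w))\<^sup>2 \<le> q / 4"
  proof (cases "deriv h w = 0")
    case True
    have "\<forall>\<^sub>F x in nhds w. a 3 x = 0"
      using q(3)[OF True] evS
    proof eventually_elim
      case (elim x)
      then show ?case using a3[of x] by simp
    qed
    then have "deriv (a 3) w = deriv (\<lambda>_. 0) w" by (rule deriv_cong_ev) simp
    then show ?thesis using q(4) by simp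
  next
    case False
    have "((\<lambda>x. (a 3 x)\<^sup>2) has_field_derivative 2 * a 3 w * deriv (a 3) w) (at w)"
      by (auto intro!: derivative_eq_intros dda[OF w])
    moreover have "((\<lambda>x. (a 3 x)\<^sup>2) has_field_derivative - D) (at w)"
      by (rule has_field_derivative_transform_within_open[OF _ S w])
        (use a3 in \<open>auto simp: D_def intro!: derivative_eq_intros ddh\<close>)
    ultimately have "2 * a 3 w * deriv (a 3) w = - D" by (rule DERIV_unique)
    then have "(norm (2 * a 3 w * deriv (a 3) w))\<^sup>2 = (norm D)\<^sup>2" by simp
    then have "4 * (norm (a 3 w))\<^sup>2 * (norm (deriv (a 3) w))\<^sup>2 = (norm D)\<^sup>2"
      by (simp add: norm_mult power_mult_distrib)
    moreover have "(norm (a 3 w))\<^sup>2 = norm (deriv h w)" using a3[OF w] by (metis norm_minus_cancel norm_power)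
    ultimately have "norm (deriv h w) * (4 * (norm (deriv (a 3) w))\<^sup>2) \<le> norm (deriv h w) * q"
      using q(1) by (simp add: D_def mult_ac)
    then show ?thesis using False by simp
  qed
  have "(norm D)\<^sup>2 \<le> q * C" unfolding D_def using q(1) mult_left_mono[OF q(2,4)] by (rule order_trans)
  moreover have "(norm (acceleration g w))\<^sup>2 = (norm D)\<^sup>2 / 2 + (norm (deriv (a 3) w))\<^sup>2"
    by (simp add: norm_vec_sqr sum_3 acc b1 b2 norm_divide norm_mult ne power_divide)
  ultimately have acc_le: "(norm (acceleration g w))\<^sup>2 \<le> q * C / 2 + q / 4" using b3 by linarith
  have "2 * (norm (acceleration g w))\<^sup>2 / (norm (velocity g w))\<^sup>2 \<le> 2 * (norm (acceleration g w))\<^sup>2 / (1 / 2)"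
    using E[OF w] by (intro divide_left_mono mult_pos_pos) auto
  \<comment> \<open>The constant is \<open>4 * (q * C / 2 + q / 4)\<close>, with
    \<open>4 = 2 / (1 / 2)\<close> from the lower bound on the speed.\<close>
  also have "\<dots> \<le> (2 * C + 1) * q" using acc_le by (simp add: algebra_simps)
  finally show "2 * (norm (acceleration g w))\<^sup>2 / (norm (velocity g w))\<^sup>2 \<le> (2 * C + 1) * q" .
qed

text \<open>The unit \<open>v\<close> is chosen so that \<open>v a\<close> and \<open>cnj v * cnj b\<close> point in opposite directions.\<close>

lemma unit_cancelling:
  fixes a b :: complex
  obtains v where "norm v = 1" "norm (v * a + cnj v * cnj b) = \<bar>norm a - norm b\<bar>"
proof (cases "a = 0 \<or> b = 0")
  case True
  then show ?thesis by (intro that[of 1]) auto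
next
  case False
  define u where "u = - cnj b * of_real (norm a) / (a * of_real (norm b))"
  define v where "v = csqrt u"
  have nu: "norm u = 1" using False by (simp add: u_def norm_mult norm_divide)
  have v2: "v * v = u" by (simp add: v_def flip: power2_eq_square)
  have nv: "norm v = 1" using nu by (simp add: v_def)
  have vv: "v * cnj v = 1" using nv by (simp add: complex_norm_square[symmetric])
  have "v * a + cnj v * cnj b = cnj v * (v * v * a + cnj b)"
  proof -
    have "cnj v * (v * v * a + cnj b) = (v * cnj v) * v * a + cnj v * cnj b" by (simp add: algebra_simps)
    then show ?thesis unfolding vv by simp
  qed
  also have "v * v * a + cnj b = cnj b * of_real (norm b - norm a) / of_real (norm b)"
    using False by (simp add: v2 u_def field_simps)
  finally have "norm (v * a + cnj v * cnj b) = norm b * \<bar>norm b - norm a\<bar> / norm b"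
    by (simp add: norm_mult norm_divide nv flip: of_real_diff)
  then show ?thesis using False nv by (intro that[of v]) auto
qed

context immersed_surface
begin

text \<open>Changing the sign of \<open>e\<close> exchanges \<open>G\<close> and \<open>H\<close>,
  so one statement serves both halves of the surface. The half splits into a tail, handled by
  counting sheets, and a compact remainder.\<close>

lemma K_end_finite:
  fixes e :: complex and r0 :: real
  defines "G \<equiv> \<lambda>p. F p $ 1 + e * F p $ 2" and "H \<equiv> \<lambda>p. F p $ 1 - e * F p $ 2"
  assumes \<mu>: "induced_area_measure X A F \<mu>"
    and e: "e\<^sup>2 = -1" and pe: "proper_end X A G H r0"
    and null: "\<And>c z. c \<in> A \<Longrightarrow> z \<in> snd c ` fst c \<Longrightarrow> (\<Sum>j\<in>UNIV. (velocity (in_chart F c) z $ j)\<^sup>2) = 0"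
  shows "(\<integral>\<^sup>+ p\<in>{p \<in> topspace X. norm (H p) \<le> norm (G p)}. ennreal \<bar>K p\<bar> \<partial>\<mu>) < \<infinity>"
proof -
  interpret E: proper_end X A G H r0 by (rule pe)
  have s\<mu>: "sets \<mu> = sets MX" using \<mu> by (simp add: induced_area_measure_def)
  have holFj: "holomorphic_fun A (\<lambda>p. F p $ j)" for j
    using holF unfolding holomorphic_map_def holomorphic_fun_def by blast
  obtain R C \<delta> d where R: "r0 \<le> R" "0 < C" "0 < \<delta>"
    and reg: "\<And>p. p \<in> E.tail R \<Longrightarrow> regular_at A G p"
    and fib: "\<And>w. R < norm w \<Longrightarrow> finite (E.fib w) \<and> card (E.fib w) = d"
    and bnd: "\<And>w h S. \<lbrakk>R < norm w; open S; w \<in> S; h holomorphic_on S; \<And>x. x \<in> S \<Longrightarrow> h x \<in> H ` E.fib x\<rbrakk> \<Longrightarrow>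
       (norm (deriv (deriv h) w))\<^sup>2 \<le> C * norm w powr (-2 - \<delta>) * norm (deriv h w) \<and>
       norm (deriv h w) \<le> C \<and> (deriv h w = 0 \<longrightarrow> (\<forall>\<^sub>F x in nhds w. deriv h x = 0))"
  proof (rule E.end_structure)
    fix R' C \<delta> d
    assume "r0 \<le> R'" "0 < C" "0 < \<delta>" "\<And>p. p \<in> E.tail R' \<Longrightarrow> regular_at A G p"
      "\<And>w. R' < norm w \<Longrightarrow> finite (E.fib w) \<and> card (E.fib w) = d"
      "\<And>w h S. \<lbrakk>R' < norm w; open S; w \<in> S; h holomorphic_on S; \<And>x. x \<in> S \<Longrightarrow> h x \<in> H ` E.fib x\<rbrakk> \<Longrightarrow>
       (norm (deriv (deriv h) w))\<^sup>2 \<le> C * norm w powr (-2 - \<delta>) * norm (deriv h w) \<and>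
       norm (deriv h w) \<le> C \<and> (deriv h w = 0 \<longrightarrow> (\<forall>\<^sub>F x in nhds w. deriv h x = 0))"
    then show thesis by (rule that)
  qed
  have R0: "0 < R" using E.R(1) R(1) by simp
  \<comment> \<open>Near \<open>p\<close> the function \<open>G\<close> serves as coordinate and
    \<open>g\<close> is the curve in it. Passing to the chart \<open>c\<close> multiplies the
    curvature density by the squared modulus of \<open>T'\<close>, where \<open>T\<close> is
    \<open>G\<close> read in \<open>c\<close>.\<close>
  have pt: "\<bar>K p\<bar> * area_density c (snd c p) \<le> ((2 * C + 1) * C) * norm (G p) powr (-2 - \<delta>) * (norm (chart_deriv G c p))\<^sup>2"
    if p: "p \<in> E.tail R" and c: "c \<in> A" "p \<in> fst c" for p c
  proof -
    define w where "w = G p"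
    have Rw: "R < norm w" using p by (simp add: w_def E.tail_def)
    have o: "openin X (E.tail R \<inter> fst c)" "p \<in> E.tail R \<inter> fst c"
      using E.openin_tail[OF R(1)] chart(1)[OF c(1)] p c by auto
    obtain r \<sigma> V where V: "V \<subseteq> E.tail R \<inter> fst c" "E.section_at w p r \<sigma> V"
      using E.section_at_exists[OF reg[OF p] o] unfolding w_def by blast
    have sec: "0 < r" "openin X V" "p \<in> V" "\<sigma> ` ball w r = V" "\<sigma> w = p"
      "\<And>x. x \<in> ball w r \<Longrightarrow> G (\<sigma> x) = x" "\<And>q. q \<in> V \<Longrightarrow> \<sigma> (G q) = q"
      "\<And>f. holomorphic_fun A f \<Longrightarrow> (\<lambda>x. f (\<sigma> x)) holomorphic_on ball w r"
      using V(2) unfolding E.section_at_def by simp_all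
    define g where "g = (\<lambda>x. F (\<sigma> x))"
    define f where "f = in_chart F c"
    define T where "T = in_chart G c"
    define S where "S = snd c ` V"
    define z where "z = snd c p"
    have S: "open S" "z \<in> S" "S \<subseteq> snd c ` fst c"
      using open_chart_image[OF c(1) sec(2)] V(1) sec(3) by (auto simp: S_def z_def)
    have fS: "f (snd c q) = F q" "T (snd c q) = G q" if "q \<in> V" for q
      using in_chart_apply[OF c(1), of q F] in_chart_apply[OF c(1), of q G] V(1) that by (auto simp: f_def T_def)
    have GV: "G q \<in> ball w r" if q: "q \<in> V" for q
    proof -
      obtain x where "x \<in> ball w r" "q = \<sigma> x" using sec(4) q by blast
      then show ?thesis using sec(6) by simp
    qed
    have TS: "T ` S \<subseteq> ball w r" using GV fS(2) by (auto simp: S_def)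
    have fgT: "f x = g (T x)" if "x \<in> S" for x
      using that fS sec(7) by (auto simp: S_def g_def)
    have holT: "T holomorphic_on S"
      using E.holG c(1) S(3) unfolding holomorphic_fun_def T_def by (blast intro: holomorphic_on_subset)
    have Tz: "T z = w" using fS(2)[OF sec(3)] by (simp add: z_def w_def)
    have holg: "(\<lambda>x. g x $ j) holomorphic_on ball w r" for j
      unfolding g_def by (rule sec(8)[OF holFj])
    interpret If: holomorphic_immersion f "snd c ` fst c" unfolding f_def by (rule immersion[OF c(1)])
    have IfS: "holomorphic_immersion f S"
      using If.hol If.imm S by unfold_locales (auto intro: holomorphic_on_subset)
    have vel: "velocity f x = deriv T x *s velocity g (T x)" if "x \<in> S" for x
      by (rule velocity_acceleration_comp(1)[OF S(1) that holT TS open_ball holg fgT])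
    have idg: "g x $ 1 + e * g x $ 2 = x" if "x \<in> ball w r" for x
      using sec(6)[OF that] by (simp add: g_def G_def)
    \<comment> \<open>The velocities of \<open>f\<close> and \<open>g\<close> are proportional with
      the nonzero factor \<open>deriv T y\<close>, so nullity carries over.\<close>
    have nullg: "(\<Sum>j\<in>UNIV. (velocity g x $ j)\<^sup>2) = 0" if x: "x \<in> ball w r" for x
    proof -
      have q: "\<sigma> x \<in> V" using sec(4) x by blast
      define y where "y = snd c (\<sigma> x)"
      have y: "y \<in> S" "T y = x" "y \<in> snd c ` fst c" using q fS(2)[OF q] sec(6)[OF x] V(1) by (auto simp: S_def y_def)
      have dT: "deriv T y \<noteq> 0" using vel[OF y(1)] If.imm[OF y(3)] by auto
      have "0 = (\<Sum>j\<in>UNIV. (velocity f y $ j)\<^sup>2)" using null[OF c(1) y(3)] by (simp add: f_def)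
      also have "\<dots> = (deriv T y)\<^sup>2 * (\<Sum>j\<in>UNIV. (velocity g x $ j)\<^sup>2)"
        by (simp add: vel[OF y(1)] y(2) power_mult_distrib sum_distrib_left)
      finally show ?thesis using dT by simp
    qed
    have graph: "1 / 2 \<le> (norm (velocity g x))\<^sup>2" if x: "x \<in> ball w r" for x
      by (rule null_curve_graph_bound(1)[where S = "ball w r" and g = g and e = e, OF open_ball holg e _ _ x])
        (use idg nullg in blast)+
    have wb: "w \<in> ball w r" using sec(1) by simp
    define h where "h = (\<lambda>x. g x $ 1 - e * g x $ 2)"
    have holh: "h holomorphic_on ball w r" unfolding h_def using holg by (intro holomorphic_intros)
    have hfib: "h x \<in> H ` E.fib x" if x: "x \<in> ball w r" for x
    proof -
      have "\<sigma> x \<in> E.tail R" using sec(4) V(1) x by blast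
      then have "\<sigma> x \<in> E.fib x" using E.tail_fib sec(6)[OF x] by metis
      moreover have "h x = H (\<sigma> x)" by (simp add: h_def g_def H_def)
      ultimately show ?thesis by blast
    qed
    define q where "q = C * norm w powr (-2 - \<delta>)"
    have q0: "0 \<le> q" using R(2) by (simp add: q_def)
    from bnd[OF Rw open_ball wb holh hfib]
    have b: "(norm (deriv (deriv h) w))\<^sup>2 \<le> q * norm (deriv h w)" "norm (deriv h w) \<le> C"
      "deriv h w = 0 \<Longrightarrow> \<forall>\<^sub>F x in nhds w. deriv h x = 0" by (auto simp: q_def)
    have acc: "2 * (norm (acceleration g w))\<^sup>2 / (norm (velocity g w))\<^sup>2 \<le> (2 * C + 1) * q"
      by (rule null_curve_graph_bound(2)[where S = "ball w r" and g = g and e = e, OF open_ball holg e _ _ wb b[unfolded h_def] q0])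
        (use idg nullg in blast)+
    have Ig: "holomorphic_immersion g (ball w r)"
    proof
      fix x assume "x \<in> ball w r"
      then show "velocity g x \<noteq> 0" using graph[of x] by auto
    qed (use holg in auto)
    have rep: "(norm (velocity f z))\<^sup>2 = (norm (deriv T z))\<^sup>2 * (norm (velocity g (T z)))\<^sup>2"
      "gauss_curvature (induced_metric f) z = gauss_curvature (induced_metric g) (T z)"
      by (rule gauss_curvature_reparam[where S = S and S' = "ball w r" and T = T and f = f and g = g,
            OF S(1,2) holT TS open_ball holg _ IfS Ig], erule fgT)+
    have "\<bar>K p\<bar> * area_density c (snd c p) =
        \<bar>gauss_curvature (induced_metric f) z\<bar> * (norm (velocity f z))\<^sup>2"
      using K_chart[OF c] area_density_eq[OF c(1), of z] S by (auto simp: f_def z_def)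
    also have "\<dots> = (norm (deriv T z))\<^sup>2 * (\<bar>gauss_curvature (induced_metric g) w\<bar> * (norm (velocity g w))\<^sup>2)"
      unfolding rep Tz by simp
    also have "\<dots> \<le> (norm (deriv T z))\<^sup>2 * ((2 * C + 1) * q)"
      using order_trans[OF holomorphic_immersion.gauss_curvature_bound[OF Ig wb] acc] by (intro mult_left_mono) auto
    finally show ?thesis by (simp add: q_def w_def chart_deriv_def T_def z_def mult_ac)
  qed
  \<comment> \<open>Preimages of the closed annuli between the radii \<open>R + 1 / (n + 1)\<close>
    and \<open>n\<close>: a compact exhaustion of the tail.\<close>
  define Q where "Q = (\<lambda>n::nat. {p \<in> topspace X. norm (H p) \<le> norm (G p) \<and> G p \<in> cball 0 (real n) - ball 0 (R + 1 / Suc n)})"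
  have Qc: "compactin X (Q n)" for n
    unfolding Q_def by (intro E.compactin_preimage closed_Diff) (auto intro: bounded_subset[OF bounded_cball])
  have tailQ: "E.tail R = (\<Union>n. Q n)"
  proof (intro equalityI subsetI)
    fix p assume p: "p \<in> E.tail R"
    then have "0 < norm (G p) - R" by (simp add: E.tail_def)
    then obtain n1 where "1 / Suc n1 < norm (G p) - R" using nat_approx_posE by blast
    moreover obtain n2 where "norm (G p) \<le> real n2" using real_arch_simple by blast
    moreover define n where "n = max n1 n2"
    moreover have "1 / Suc n \<le> 1 / Suc n1" by (rule divide_left_mono) (auto simp: n_def)
    ultimately have "norm (G p) \<le> real n" "R + 1 / Suc n \<le> norm (G p)" by (auto simp: n_def)
    then have "p \<in> Q n" using p by (auto simp: Q_def E.tail_def)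
    then show "p \<in> (\<Union>n. Q n)" by blast
  next
    fix p assume "p \<in> (\<Union>n. Q n)"
    then obtain n where "p \<in> Q n" by blast
    then have "\<not> norm (G p) < R + 1 / real (Suc n)" by (simp add: Q_def)
    moreover have "0 < 1 / real (Suc n)" by simp
    ultimately have "R < norm (G p)" by linarith
    then show "p \<in> E.tail R" using \<open>p \<in> Q n\<close> by (auto simp: Q_def E.tail_def)
  qed
  have fibt: "{p \<in> E.tail R. G p = w} = (if R < norm w then E.fib w else {})" for w
    by (auto simp: E.tail_def E.fib_def)
  have fin1: "(\<integral>\<^sup>+ p\<in>E.tail R. ennreal \<bar>K p\<bar> \<partial>\<mu>) < \<infinity>"
  proof (rule K_multivalent_chart_finite[OF \<mu> E.holG E.openin_tail[OF R(1)] tailQ Qc reg _ _ R0 _ R(3) _ pt])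
    show "finite {p \<in> E.tail R. G p = w}" for w using fib[of w] by (simp add: fibt)
    show "card {p \<in> E.tail R. G p = w} \<le> d" for w using fib[of w] by (simp add: fibt)
    show "R < norm (G p)" if "p \<in> E.tail R" for p using that by (simp add: E.tail_def)
  qed (use R(2) in auto)
  \<comment> \<open>What remains of the half outside the tail is compact, and a continuous curvature
    has finite integral there.\<close>
  define B where "B = {p \<in> topspace X. norm (H p) \<le> norm (G p) \<and> G p \<in> cball 0 R}"
  have Bc: "compactin X B" unfolding B_def by (rule E.compactin_preimage) auto
  then have fin2: "(\<integral>\<^sup>+ p\<in>B. ennreal \<bar>K p\<bar> \<partial>\<mu>) < \<infinity>" by (rule K_compact_finite[OF \<mu>])
  have Km: "(\<lambda>q. ennreal \<bar>K q\<bar>) \<in> borel_measurable \<mu>"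
    using continuous_map_MX[OF K_continuous] by (simp cong: measurable_cong_sets add: s\<mu>)
  have "(\<integral>\<^sup>+ p\<in>{p \<in> topspace X. norm (H p) \<le> norm (G p)}. ennreal \<bar>K p\<bar> \<partial>\<mu>) =
      (\<integral>\<^sup>+ p. ennreal \<bar>K p\<bar> * indicator (E.tail R) p + ennreal \<bar>K p\<bar> * indicator B p \<partial>\<mu>)"
    by (intro nn_integral_cong) (auto simp: indicator_def E.tail_def B_def)
  also have "\<dots> = (\<integral>\<^sup>+ p\<in>E.tail R. ennreal \<bar>K p\<bar> \<partial>\<mu>) + (\<integral>\<^sup>+ p\<in>B. ennreal \<bar>K p\<bar> \<partial>\<mu>)"
    using Km openin_MX[OF E.openin_tail[OF R(1)]] compactin_MX[OF Bc]
    by (intro nn_integral_add borel_measurable_times_ennreal borel_measurable_indicator) (simp_all add: s\<mu>)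
  also have "\<dots> < \<infinity>" using fin1 fin2 by simp
  finally show ?thesis .
qed


text \<open>Each compact set is covered by finitely many charts, so a countable union of compact
  sets needs only countably many.\<close>

lemma countable_charts:
  assumes Q: "\<And>n::nat. compactin X (Q n)" "topspace X = (\<Union>n. Q n)" and ne: "topspace X \<noteq> {}"
  obtains c :: "nat \<Rightarrow> 'a chart" where "\<And>i. c i \<in> A" "topspace X = (\<Union>i. fst (c i))"
proof -
  have "\<exists>C. finite C \<and> C \<subseteq> A \<and> Q n \<subseteq> \<Union>(fst ` C)" for n
  proof -
    have "\<forall>U\<in>fst ` A. openin X U" using chart(1) by blast
    moreover have "Q n \<subseteq> \<Union>(fst ` A)" using Q(2) topspace_charts by blast
    ultimately have "\<exists>\<F>. finite \<F> \<and> \<F> \<subseteq> fst ` A \<and> Q n \<subseteq> \<Union>\<F>"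
      using Q(1)[of n] unfolding compactin_def by blast
    then obtain \<F> where "finite \<F>" "\<F> \<subseteq> fst ` A" "Q n \<subseteq> \<Union>\<F>" by blast
    moreover from this obtain C where "C \<subseteq> A" "finite C" "\<F> = fst ` C"
      using finite_subset_image[of \<F> fst A] by blast
    ultimately show ?thesis by blast
  qed
  then have "\<exists>C. \<forall>n. finite (C n) \<and> C n \<subseteq> A \<and> Q n \<subseteq> \<Union>(fst ` C n)" by (intro choice) blast
  then obtain C where C: "\<And>n. finite (C n)" "\<And>n. C n \<subseteq> A" "\<And>n. Q n \<subseteq> \<Union>(fst ` C n)" by blast
  define D where "D = (\<Union>n. C n)"
  have cov: "topspace X = (\<Union>c\<in>D. fst c)"
  proof
    show "topspace X \<subseteq> (\<Union>c\<in>D. fst c)"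
    proof
      fix p assume "p \<in> topspace X"
      then obtain n where "p \<in> Q n" using Q(2) by blast
      then obtain c where "c \<in> C n" "p \<in> fst c" using C(3)[of n] by blast
      then show "p \<in> (\<Union>c\<in>D. fst c)" by (auto simp: D_def)
    qed
    show "(\<Union>c\<in>D. fst c) \<subseteq> topspace X"
    proof (rule UN_least)
      fix c assume "c \<in> D"
      then show "fst c \<subseteq> topspace X" using C(2) unfolding D_def by (intro chart_subset) blast
    qed
  qed
  have "countable D" unfolding D_def using C(1) by (intro countable_UN) (auto intro: countable_finite)
  moreover have "D \<noteq> {}" using cov ne by auto
  ultimately obtain c :: "nat \<Rightarrow> 'a chart" where c: "range c = D" using range_from_nat_into by metis
  show thesis
  proof (rule that[of c])
    show "c i \<in> A" for i
    proof -
      have "c i \<in> D" unfolding c[symmetric] by (rule rangeI)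
      then show ?thesis using C(2) unfolding D_def by blast
    qed
    show "topspace X = (\<Union>i. fst (c i))" unfolding cov c[symmetric] by simp
  qed
qed

end

theorem corollary4p4:
  fixes X :: "'a topology" and A :: "'a chart set" and F :: "'a \<Rightarrow> complex ^ 3"
  assumes "open_riemann_surface X A"
    and "finite_topology X"
    and "null_curve A F"
    and "compact_preimages
           (prod_topology (top_of_set (sphere (0::complex) 1)) X)
           (euclidean :: (real \<times> real) topology)
           (\<lambda>(v, P). (Re (v * F P $ 1), Re (v * F P $ 2)))"
  shows "finite_total_curvature X A F"
proof -
  have X: "connected_space X" "topspace X \<noteq> {}" "\<not> compact_space X" "Hausdorff_space X" "holomorphic_atlas X A"
    using assms(1) by (auto simp: open_riemann_surface_def riemann_surface_def)
  have hol: "holomorphic_map A F" using assms(3) by (simp add: null_curve_def)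
  have vel: "velocity (in_chart F c) z $ j = deriv (in_chart (\<lambda>p. F p $ j) c) z" for c z j
    by (simp add: velocity_def in_chart_def o_def)
  have null: "(\<Sum>j\<in>UNIV. (velocity (in_chart F c) z $ j)\<^sup>2) = 0" and imm: "velocity (in_chart F c) z \<noteq> 0"
    if "c \<in> A" "z \<in> snd c ` fst c" for c z
  proof -
    have *: "(\<Sum>j\<in>UNIV. (velocity (in_chart F c) z $ j)\<^sup>2) = 0 \<and> (\<exists>j. velocity (in_chart F c) z $ j \<noteq> 0)"
      using assms(3) that unfolding null_curve_def vel[symmetric] by blast
    then show "(\<Sum>j\<in>UNIV. (velocity (in_chart F c) z $ j)\<^sup>2) = 0" by blast
    show "velocity (in_chart F c) z \<noteq> 0" using * by (metis zero_index)
  qed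
  interpret immersed_surface X A F
    by unfold_locales (use X hol imm in auto)
  have holFj: "holomorphic_fun A (\<lambda>p. F p $ j)" for j
    using hol unfolding holomorphic_map_def holomorphic_fun_def by blast
  \<comment> \<open>\<open>G \<i>\<close> and \<open>G (- \<i>)\<close> are the functions called
    \<open>G\<close> and \<open>H\<close> in the overview; the parameter lets either of them take
    the leading role.\<close>
  define G where "G = (\<lambda>(e::complex) p. F p $ 1 + e * F p $ 2)"
  have Ge: "G (- e) = (\<lambda>p. F p $ 1 - e * F p $ 2)" for e by (simp add: G_def)
  have ichG: "in_chart (G e) c = (\<lambda>z. in_chart (\<lambda>p. F p $ 1) c z + e * in_chart (\<lambda>p. F p $ 2) c z)" for e c
    by (simp add: in_chart_def o_def G_def)
  have holG: "holomorphic_fun A (G e)" for e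
    unfolding holomorphic_fun_def ichG
    using holFj[unfolded holomorphic_fun_def] by (intro ballI holomorphic_intros) auto
  have dG: "chart_deriv (G e) c p = velocity (in_chart F c) (snd c p) $ 1 + e * velocity (in_chart F c) (snd c p) $ 2"
    if "c \<in> A" "p \<in> fst c" for e c p
  proof -
    have "(in_chart (\<lambda>p. F p $ j) c has_field_derivative velocity (in_chart F c) (snd c p) $ j) (at (snd c p))" for j
      unfolding vel using holFj[unfolded holomorphic_fun_def] chart(2) that
      by (intro holomorphic_derivI[of _ "snd c ` fst c"]) auto
    then show ?thesis
      unfolding chart_deriv_def ichG by (intro DERIV_imp_deriv) (auto intro!: derivative_eq_intros)
  qed
  \<comment> \<open>The preimage of a ball in the product of circle and surface is compact, and so
    is its projection to the surface. The set in question is closed and contained in that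
    projection.\<close>
  have norm_sub: "compactin X {p \<in> topspace X. \<bar>norm (G \<i> p) - norm (G (- \<i>) p)\<bar> \<le> r}" for r
  proof -
    define f where "f = (\<lambda>(v, P). (Re (v * F P $ 1), Re (v * F P $ 2)))"
    define T where "T = prod_topology (top_of_set (sphere (0::complex) 1)) X"
    have "compactin T {x \<in> topspace T. f x \<in> cball 0 r}"
    proof -
      have "\<forall>K. compactin euclidean K \<longrightarrow> compactin T {x \<in> topspace T. f x \<in> K}"
        using assms(4)[folded f_def T_def] unfolding compact_preimages_def .
      moreover have "compactin euclidean (cball (0 :: real \<times> real) r)" by simp
      ultimately show ?thesis by blast
    qed
    then have "compactin X (snd ` {x \<in> topspace T. f x \<in> cball 0 r})"
      unfolding T_def by (rule image_compactin[OF _ continuous_map_snd])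
    moreover have "{p \<in> topspace X. \<bar>norm (G \<i> p) - norm (G (- \<i>) p)\<bar> \<le> r} \<subseteq> snd ` {x \<in> topspace T. f x \<in> cball 0 r}"
    proof
      fix p assume p: "p \<in> {p \<in> topspace X. \<bar>norm (G \<i> p) - norm (G (- \<i>) p)\<bar> \<le> r}"
      obtain v where v: "norm v = 1" "norm (v * G \<i> p + cnj v * cnj (G (- \<i>) p)) = \<bar>norm (G \<i> p) - norm (G (- \<i>) p)\<bar>"
        by (rule unit_cancelling)
      \<comment> \<open>This packs the two real parts of the hypothesis into one complex number, up
        to the factor 2.\<close>
      have "v * G \<i> p + cnj v * cnj (G (- \<i>) p) = 2 * Complex (Re (v * F p $ 1)) (Re (v * F p $ 2))"
        by (simp add: G_def complex_eq_iff algebra_simps)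
      then have "norm (v * G \<i> p + cnj v * cnj (G (- \<i>) p)) = 2 * norm (Complex (Re (v * F p $ 1)) (Re (v * F p $ 2)))"
        by (simp only: norm_mult norm_numeral)
      also have "norm (Complex (Re (v * F p $ 1)) (Re (v * F p $ 2))) = norm (f (v, p))"
        unfolding f_def by (simp only: prod.case norm_Pair complex_norm real_norm_def power2_abs)
      finally have "2 * norm (f (v, p)) \<le> r" using v(2) p by simp
      then have "norm (f (v, p)) \<le> r" using norm_ge_zero[of "f (v, p)"] by linarith
      then have "f (v, p) \<in> cball 0 r" by simp
      moreover have "(v, p) \<in> topspace T" using v(1) p by (simp add: T_def)
      ultimately show "p \<in> snd ` {x \<in> topspace T. f x \<in> cball 0 r}" by force
    qed
    moreover have "closedin X {p \<in> topspace X. norm (G \<i> p) - norm (G (- \<i>) p) \<in> {-r..r}}"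
      using holomorphic_fun_continuous[OF holG]
      by (intro closedin_continuous_map_preimage[of X euclidean] continuous_map_diff continuous_map_norm) auto
    then have "closedin X {p \<in> topspace X. \<bar>norm (G \<i> p) - norm (G (- \<i>) p)\<bar> \<le> r}"
      by (rule back_subst) auto
    ultimately show ?thesis by (rule closed_compactin)
  qed
  \<comment> \<open>The set where both moduli agree is compact, hence \<open>G \<i>\<close> is
    bounded on it; adding 1 to the bound makes the inequality strict.\<close>
  obtain r0 where r0: "0 < r0" "\<And>p. p \<in> topspace X \<Longrightarrow> norm (G \<i> p) = norm (G (- \<i>) p) \<Longrightarrow> norm (G \<i> p) < r0"
  proof -
    have "compactin euclidean (G \<i> ` {p \<in> topspace X. \<bar>norm (G \<i> p) - norm (G (- \<i>) p)\<bar> \<le> 0})"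
      by (rule image_compactin[OF norm_sub holomorphic_fun_continuous[OF holG]])
    then have "bounded (G \<i> ` {p \<in> topspace X. \<bar>norm (G \<i> p) - norm (G (- \<i>) p)\<bar> \<le> 0})"
      by (simp add: compact_imp_bounded)
    then obtain B where B: "\<And>p. p \<in> topspace X \<Longrightarrow> norm (G \<i> p) = norm (G (- \<i>) p) \<Longrightarrow> norm (G \<i> p) \<le> B"
      unfolding bounded_iff by force
    show thesis
      by (rule that[of "\<bar>B\<bar> + 1"]) (use B in force)+
  qed
  \<comment> \<open>If both differentials vanish, so do those of the first two components; nullity
    then kills the third, against the immersion property.\<close>
  have regular: "regular_at A (G e) p \<or> regular_at A (G (- e)) p" if e: "e\<^sup>2 = -1" and p: "p \<in> topspace X" for e p
  proof (rule ccontr)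
    assume no: "\<not> ?thesis"
    obtain c where c: "c \<in> A" "p \<in> fst c" using chart_at[OF p] by blast
    define a where "a = velocity (in_chart F c) (snd c p)"
    have e0: "e \<noteq> 0" using e by auto
    have "a $ 1 + e * a $ 2 = 0" "a $ 1 - e * a $ 2 = 0"
      using no c dG[OF c, of e] dG[OF c, of "- e"] by (auto simp: regular_at_def a_def)
    then have "2 * a $ 1 = 0" "2 * (e * a $ 2) = 0" by (simp_all add: algebra_simps)
    then have "a $ 1 = 0" "a $ 2 = 0" using e0 by auto
    moreover from this have "a $ 3 = 0" using null[OF c(1), of "snd c p"] c by (simp add: a_def sum_3)
    ultimately have "a = 0" by (simp add: vec_eq_iff forall_3)
    then show False using imm[OF c(1), of "snd c p"] c by (simp add: a_def)
  qed
  have ends: "proper_end X A (G e) (G (- e)) r0" if e: "e = \<i> \<or> e = - \<i>" for e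
  proof
    have e2: "e\<^sup>2 = -1" using e by auto
    show "regular_at A (G e) p \<or> regular_at A (G (- e)) p" if "p \<in> topspace X" for p
      by (rule regular[OF e2 that])
    show "norm (G e p) < r0" if "p \<in> topspace X" "norm (G (- e) p) = norm (G e p)" for p
      using e r0(2)[OF that(1)] that(2) by auto
    fix r
    have "closedin X {p \<in> topspace X. norm (G e p) - norm (G (- e) p) \<in> {0..}}"
      using holomorphic_fun_continuous[OF holG]
      by (intro closedin_continuous_map_preimage[of X euclidean] continuous_map_diff continuous_map_norm) auto
    from closed_Int_compactin[OF this norm_sub[of r]]
    show "compactin X {p \<in> topspace X. norm (G (- e) p) \<le> norm (G e p) \<and> norm (G e p) - norm (G (- e) p) \<le> r}"
      by (rule back_subst) (use e in auto)
  qed (use X holG r0(1) in auto)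
  \<comment> \<open>The compact sublevel sets exhaust the surface; this yields the countable family
    of charts from which the area measure is built.\<close>
  have exh: "topspace X = (\<Union>n::nat. {p \<in> topspace X. \<bar>norm (G \<i> p) - norm (G (- \<i>) p)\<bar> \<le> real n})"
    using real_arch_simple by auto
  obtain c :: "nat \<Rightarrow> 'a chart" where c: "\<And>i. c i \<in> A" "topspace X = (\<Union>i. fst (c i))"
    using countable_charts[OF norm_sub exh X(2)] by metis
  obtain \<mu> where \<mu>: "induced_area_measure X A F \<mu>"
    using induced_area_measure_exists[OF c X(2)] by metis
  have s\<mu>: "sets \<mu> = sets MX" using \<mu> by (simp add: induced_area_measure_def)
  have Km: "K \<in> borel_measurable \<mu>"
    using continuous_map_MX[OF K_continuous] by (simp cong: measurable_cong_sets add: s\<mu>)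
  \<comment> \<open>The two closed halves cover the surface and overlap where the moduli agree, so
    the total integral is at most the sum over both.\<close>
  define W where "W = (\<lambda>e. {p \<in> topspace X. norm (G (- e) p) \<le> norm (G e p)})"
  have WK: "(\<integral>\<^sup>+ p\<in>W e. ennreal \<bar>K p\<bar> \<partial>\<mu>) < \<infinity>" if e: "e = \<i> \<or> e = - \<i>" for e
  proof -
    have "e\<^sup>2 = -1" using e by auto
    from K_end_finite[OF \<mu> this ends[OF e, unfolded Ge, unfolded G_def] null]
    show ?thesis unfolding W_def Ge unfolding G_def .
  qed
  have Wm: "W e \<in> sets \<mu>" for e
  proof -
    have "openin X {p \<in> topspace X. norm (G e p) - norm (G (- e) p) \<in> {..<0}}"
      using holomorphic_fun_continuous[OF holG]
      by (intro openin_continuous_map_preimage[of X euclidean] continuous_map_diff continuous_map_norm) auto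
    then have "space MX - {p \<in> topspace X. norm (G e p) - norm (G (- e) p) \<in> {..<0}} \<in> sets MX"
      by (intro sets.compl_sets openin_MX)
    moreover have "space MX - {p \<in> topspace X. norm (G e p) - norm (G (- e) p) \<in> {..<0}} = W e"
      by (auto simp: W_def)
    ultimately show ?thesis by (simp add: s\<mu>)
  qed
  have spc: "space \<mu> = topspace X" using sets_eq_imp_space_eq[OF s\<mu>] by simp
  have "(\<integral>\<^sup>+ p. ennreal (norm (K p)) \<partial>\<mu>) \<le>
      (\<integral>\<^sup>+ p. ennreal \<bar>K p\<bar> * indicator (W \<i>) p + ennreal \<bar>K p\<bar> * indicator (W (- \<i>)) p \<partial>\<mu>)"
    by (intro nn_integral_mono) (auto simp: spc W_def indicator_def)
  also have "\<dots> = (\<integral>\<^sup>+ p\<in>W \<i>. ennreal \<bar>K p\<bar> \<partial>\<mu>) + (\<integral>\<^sup>+ p\<in>W (- \<i>). ennreal \<bar>K p\<bar> \<partial>\<mu>)"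
    using Km Wm by (intro nn_integral_add borel_measurable_times_ennreal borel_measurable_indicator) auto
  also have "\<dots> < \<infinity>" using WK[of \<i>] WK[of "- \<i>"] by simp
  finally have "integrable \<mu> K" using Km by (intro integrableI_bounded)
  then show ?thesis using \<mu> by (auto simp: finite_total_curvature_def)
qed

end
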